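(* For every $h\ge 1$ and $k=2h$, there exists a depth-$3$ HST on which the competitive ratio of the Work Function Algorithm with $k$ servers against an offline optimum with $h$ servers is at least $h+1/3$.
   Context: The $(h,k)$-server problem: given a metric space, an online algorithm has $k$ servers; requests arrive one at a time at points, each must be served by moving some server to it; cost is total distance moved. It is compared with an offline optimum using $h\le k$ servers. ALG is $R$-competitive on metric $M$ if there is a constant $\alpha$ with $ALG_k(I)\le R\cdot OPT_h(I)+\alpha$ for every finite request sequence $I$; the competitive ratio is the infimum of such $R$. A depth-$d$ tree is an edge-weighted rooted tree with every leaf at depth exactly $d$; requests arrive only at leaves and distances are tree distances. A depth-$d$ HST is a depth-$d$ tree whose edge lengths decrease geometrically along every root-to-leaf path. Work function: for a request sequence $r_1,\dots,r_m$ and a configuration $A$ (multiset of server locations), $w_i(A)$ is the optimal cost of serving $r_1,\dots,r_i$ and ending in configuration $A$. The Work Function Algorithm (WFA), when in configuration $A$ and request $r_i\notin A$ arrives, moves to a configuration $X$ with $r_i\in X$ minimizing $w_i(X)+d(A,X)$, where $d(A,X)$ is the minimum-cost matching distance between configurations. *)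

theory Defs
  imports "HOL-Library.Multiset" "HOL-Library.Extended_Real"
begin

text \<open>
  A rooted tree is given by its parent function; the edge joining a non-root vertex \<open>v\<close>
  to its parent is identified with \<open>v\<close> and has length \<open>elen T v\<close>.  The values of
  \<open>parent\<close> and \<open>elen\<close> at the root and outside \<open>verts\<close> are irrelevant.
  The vertex set may be infinite.
\<close>

record 'v wtree =
  verts :: "'v set"
  root_of :: 'v
  parent :: "'v \<Rightarrow> 'v"
  elen :: "'v \<Rightarrow> real"

definition nonroot :: "'v wtree \<Rightarrow> 'v set" where
  "nonroot T = verts T - {root_of T}"

definition rooted_tree :: "'v wtree \<Rightarrow> bool" where
  "rooted_tree T \<longleftrightarrow>
     root_of T \<in> verts T \<and>
     (\<forall>v\<in>nonroot T. parent T v \<in> verts T \<and> 0 < elen T v) \<and>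
     (\<forall>v\<in>verts T. \<exists>n. (parent T ^^ n) v = root_of T)"

definition depth :: "'v wtree \<Rightarrow> 'v \<Rightarrow> nat" where
  "depth T v = (LEAST n. (parent T ^^ n) v = root_of T)"

definition leaves :: "'v wtree \<Rightarrow> 'v set" where
  "leaves T = {v \<in> verts T. \<forall>u\<in>nonroot T. parent T u \<noteq> v}"

text \<open>
  The bound on the depth of all vertices follows from the condition on the leaves when
  the tree is finite; in general it excludes infinite branches, which contain no leaf.
\<close>

definition depth_tree :: "nat \<Rightarrow> 'v wtree \<Rightarrow> bool" where
  "depth_tree n T \<longleftrightarrow>
     rooted_tree T \<and> (\<forall>v\<in>verts T. depth T v \<le> n) \<and> (\<forall>v\<in>leaves T. depth T v = n)"

definition depth_hst :: "real \<Rightarrow> nat \<Rightarrow> 'v wtree \<Rightarrow> bool" where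
  "depth_hst \<sigma> n T \<longleftrightarrow>
     depth_tree n T \<and>
     (\<forall>v\<in>nonroot T. parent T v \<in> nonroot T \<longrightarrow> \<sigma> * elen T v \<le> elen T (parent T v))"

text \<open>\<open>walk T u v l\<close>: some walk in the underlying undirected tree from \<open>u\<close> to \<open>v\<close> has length \<open>l\<close>.\<close>

inductive walk :: "'v wtree \<Rightarrow> 'v \<Rightarrow> 'v \<Rightarrow> real \<Rightarrow> bool" for T :: "'v wtree" where
  stay: "u \<in> verts T \<Longrightarrow> walk T u u 0"
| up: "u \<in> nonroot T \<Longrightarrow> walk T (parent T u) v l \<Longrightarrow> walk T u v (elen T u + l)"
| down: "u \<in> nonroot T \<Longrightarrow> walk T u v l \<Longrightarrow> walk T (parent T u) v (elen T u + l)"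

definition tree_dist :: "'v wtree \<Rightarrow> 'v \<Rightarrow> 'v \<Rightarrow> real" where
  "tree_dist T u v = Inf {l. walk T u v l}"

text \<open>
  Throughout, \<open>P\<close> is the set of points of the metric space and \<open>d\<close> its distance function.
  A configuration is the multiset of server locations.
\<close>

definition configs :: "'p set \<Rightarrow> nat \<Rightarrow> 'p multiset set" where
  "configs P k = {A. size A = k \<and> set_mset A \<subseteq> P}"

text \<open>A perfect matching between \<open>A\<close> and \<open>B\<close> is a multiset of pairs with marginals \<open>A\<close> and \<open>B\<close>.\<close>

definition matching_dist :: "('p \<Rightarrow> 'p \<Rightarrow> real) \<Rightarrow> 'p multiset \<Rightarrow> 'p multiset \<Rightarrow> real" where
  "matching_dist d A B =
     Inf {(\<Sum>(x, y)\<in>#M. d x y) | M. image_mset fst M = A \<and> image_mset snd M = B}"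

definition serves :: "'p set \<Rightarrow> nat \<Rightarrow> 'p list \<Rightarrow> 'p multiset list \<Rightarrow> bool" where
  "serves P k rs Cs \<longleftrightarrow> list_all2 (\<lambda>r C. C \<in> configs P k \<and> r \<in># C) rs Cs"

fun sched_cost :: "('p \<Rightarrow> 'p \<Rightarrow> real) \<Rightarrow> 'p multiset \<Rightarrow> 'p multiset list \<Rightarrow> real" where
  "sched_cost d A [] = 0"
| "sched_cost d A (C # Cs) = matching_dist d A C + sched_cost d C Cs"

definition opt_cost ::
  "'p set \<Rightarrow> ('p \<Rightarrow> 'p \<Rightarrow> real) \<Rightarrow> 'p multiset \<Rightarrow> 'p list \<Rightarrow> real" where
  "opt_cost P d A0 rs = Inf {sched_cost d A0 Cs | Cs. serves P (size A0) rs Cs}"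

text \<open>The final configuration \<open>A\<close> need not contain the last request.\<close>

definition work_fun ::
  "'p set \<Rightarrow> ('p \<Rightarrow> 'p \<Rightarrow> real) \<Rightarrow> 'p multiset \<Rightarrow> 'p list \<Rightarrow> 'p multiset \<Rightarrow> real" where
  "work_fun P d A0 rs A = Inf {sched_cost d A0 (Cs @ [A]) | Cs. serves P (size A0) rs Cs}"

text \<open>
  A deterministic online algorithm with a fixed initial configuration is a function from the
  requests seen so far to the current configuration.  \<open>is_wfa P d k alg\<close> says that \<open>alg\<close> is
  a Work Function Algorithm with \<open>k\<close> servers: ties between minimizers may be broken in an
  arbitrary way, possibly depending on the whole history.
\<close>

definition is_wfa ::
  "'p set \<Rightarrow> ('p \<Rightarrow> 'p \<Rightarrow> real) \<Rightarrow> nat \<Rightarrow> ('p list \<Rightarrow> 'p multiset) \<Rightarrow> bool" where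
  "is_wfa P d k alg \<longleftrightarrow>
     alg [] \<in> configs P k \<and>
     (\<forall>rs r. set rs \<subseteq> P \<longrightarrow> r \<in> P \<longrightarrow>
        (if r \<in># alg rs then alg (rs @ [r]) = alg rs
         else is_arg_min
                (\<lambda>X. work_fun P d (alg []) (rs @ [r]) X + matching_dist d (alg rs) X)
                (\<lambda>X. X \<in> configs P k \<and> r \<in># X)
                (alg (rs @ [r]))))"

definition alg_cost ::
  "('p \<Rightarrow> 'p \<Rightarrow> real) \<Rightarrow> ('p list \<Rightarrow> 'p multiset) \<Rightarrow> 'p list \<Rightarrow> real" where
  "alg_cost d alg rs =
     (\<Sum>i<length rs. matching_dist d (alg (take i rs)) (alg (take (Suc i) rs)))"

text \<open>The offline servers start in configuration \<open>B0\<close>, whose size is the number of offline servers.\<close>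

definition competitive ::
  "'p set \<Rightarrow> ('p \<Rightarrow> 'p \<Rightarrow> real) \<Rightarrow> ('p list \<Rightarrow> 'p multiset) \<Rightarrow> 'p multiset \<Rightarrow> real \<Rightarrow> bool" where
  "competitive P d alg B0 R \<longleftrightarrow>
     (\<exists>\<alpha>. \<forall>rs. set rs \<subseteq> P \<longrightarrow> alg_cost d alg rs \<le> R * opt_cost P d B0 rs + \<alpha>)"

definition competitive_ratio ::
  "'p set \<Rightarrow> ('p \<Rightarrow> 'p \<Rightarrow> real) \<Rightarrow> ('p list \<Rightarrow> 'p multiset) \<Rightarrow> 'p multiset \<Rightarrow> ereal" where
  "competitive_ratio P d alg B0 = Inf {ereal R | R. competitive P d alg B0 R}"

end

theory Submission
  imports Defs "HOL-Library.Sublist"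
begin

text \<open>
  Since the configuration \<open>X\<close> chosen by the algorithm minimizes \<open>w X + d A X\<close>, it keeps a server
  away from a region until using it there would have saved twice its distance.  Every depth-one
  subtree used has two stars of \<open>h\<close> leaves, at the three scales \<open>D\<close> (subtrees), \<open>m\<close> (stars) and
  \<open>\<delta>\<close> (leaves), and all servers start in the subtree \<open>L\<close>.  In a phase the adversary moves its
  \<open>h\<close> servers to a star of another subtree \<open>R\<close>, at cost \<open>h D\<close>, and requests its leaves.  With \<open>j\<close>
  servers in the star the algorithm misses one of \<open>j + 1\<close> leaves and pays about \<open>2 j D\<close> before the
  next server arrives, altogether \<open>\<Sum>j<h. (2 j + 1) D = h\<^sup>2 D\<close>.  Now the adversary alternates
  \<open>2 D / m\<close> times between the two stars of \<open>R\<close>, paying \<open>h m\<close> each time and \<open>2 h D\<close> in total; by the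
  same argument at scale \<open>m\<close> the algorithm pays \<open>h\<^sup>2 m\<close> each time, because its other \<open>h\<close> servers stay
  in \<open>L\<close> until the cost saved by \<open>i\<close> of them, \<open>i m\<close> per alternation, reaches \<open>2 i D\<close>.  Finally they
  all come to \<open>R\<close> and cost another \<open>h D\<close>.  The work function is then again a cone, now with apex at
  \<open>R\<close>, and the phase can be repeated in the opposite direction.  The ratio is
  \<open>(3 h\<^sup>2 + h) D / (3 h D) = h + 1 / 3\<close>, up to an error that vanishes when \<open>D / m\<close> and \<open>m / \<delta>\<close> tend
  to infinity; the tree contains all scales.
\<close>

subsection \<open>Matching distances\<close>

text \<open>The work function is never computed exactly. A move of the algorithm is restricted by
  comparing its choice with one witness configuration, where an upper bound on the work function
  suffices; all other configurations are met by lower bounds that are linear in the numbers of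
  servers in a side and in a star. These survive further requests because such weighted counts are
  1-Lipschitz for the matching distance.

  When the adversary changes to another star, the work function must be determined by the
  configurations covering the present one (\<open>sat\<close>). On a star this may take any number
  of requests, since the adversary occupies its \<open>h\<close> points and pays nothing. The apex
  of the next cone has \<open>2 * h\<close> points, and there every request may cost the adversary
  \<open>m\<close>. So the last alternations bring the work function within \<open>4 * h * m\<close>
  of a cone, and repeated requests repair only this defect, in about \<open>4 * h * \<kappa>\<close>
  rounds. They cost the adversary up to about \<open>8 * h ^ 2 * \<kappa> * m\<close>, which is
  small against \<open>D\<close> only if \<open>D / m\<close> grows faster than
  \<open>m / \<delta>\<close>.\<close>

abbreviation (input) mcost :: "('p \<Rightarrow> 'p \<Rightarrow> real) \<Rightarrow> ('p \<times> 'p) multiset \<Rightarrow> real" where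
  "mcost d M \<equiv> (\<Sum>(x, y)\<in>#M. d x y)"

definition matchings :: "'p multiset \<Rightarrow> 'p multiset \<Rightarrow> ('p \<times> 'p) multiset set" where
  "matchings A B = {M. image_mset fst M = A \<and> image_mset snd M = B}"

lemma matchings_mem:
  assumes "M \<in> matchings A B" "(x, y) \<in># M"
  shows "x \<in># A" "y \<in># B"
  using assms unfolding matchings_def by force+

lemma finite_matchings: "finite (matchings A B)"
proof (rule finite_subset)
  show "matchings A B \<subseteq> multisets_of_size (set_mset A \<times> set_mset B) (size A)"
    using matchings_mem by (fastforce simp: multisets_of_size_def matchings_def)
qed auto

lemma matchings_ex:
  assumes "size A = size B"
  shows "matchings A B \<noteq> {}"
proof -
  obtain xs ys where xy: "mset xs = A" "mset ys = B" by (meson ex_mset)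
  then have "length xs = length ys" using assms by (metis size_mset)
  then have "mset (zip xs ys) \<in> matchings A B"
    unfolding matchings_def using xy by (auto simp flip: mset_map)
  then show ?thesis by auto
qed

lemma matching_dist_conv: "matching_dist d A B = Inf (mcost d ` matchings A B)"
  unfolding matching_dist_def matchings_def by (rule arg_cong[where f = Inf]) auto

lemma matching_dist_le: "M \<in> matchings A B \<Longrightarrow> matching_dist d A B \<le> mcost d M"
  unfolding matching_dist_conv by (rule cInf_lower) (auto intro!: bdd_below_finite finite_imageI finite_matchings)

lemma matching_dist_attained:
  assumes "size A = size B"
  obtains M where "M \<in> matchings A B" "matching_dist d A B = mcost d M"
proof -
  have "Inf (mcost d ` matchings A B) \<in> mcost d ` matchings A B"
    using finite_matchings matchings_ex[OF assms]
    by (subst cInf_eq_Min) (auto intro!: Min_in)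
  then show thesis using that unfolding matching_dist_conv by auto
qed

lemma matching_dist_union:
  assumes "size A = size B" "size A' = size B'"
  shows "matching_dist d (A + A') (B + B') \<le> matching_dist d A B + matching_dist d A' B'"
proof -
  obtain M where M: "M \<in> matchings A B" "matching_dist d A B = mcost d M"
    using matching_dist_attained[OF assms(1)] by blast
  obtain N where N: "N \<in> matchings A' B'" "matching_dist d A' B' = mcost d N"
    using matching_dist_attained[OF assms(2)] by blast
  have "M + N \<in> matchings (A + A') (B + B')" using M N by (auto simp: matchings_def)
  then show ?thesis using matching_dist_le[of "M + N" _ _ d] M N by auto
qed

lemma matching_dist_le_const:
  assumes "size A = size B" "\<And>x y. x \<in># A \<Longrightarrow> y \<in># B \<Longrightarrow> d x y \<le> c"
  shows "matching_dist d A B \<le> real (size A) * c"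
proof -
  obtain M where M: "M \<in> matchings A B" "matching_dist d A B = mcost d M"
    using matching_dist_attained[OF assms(1)] by blast
  have "mcost d M \<le> (\<Sum>z\<in>#M. c)"
    by (rule sum_mset_mono) (use assms(2) matchings_mem[OF M(1)] in auto)
  moreover have "size M = size A" using M(1) by (auto simp: matchings_def)
  ultimately show ?thesis using M by simp
qed

text \<open>Weak duality for the transport problem: summing the increments of \<open>f\<close> over
  the pairs of a matching bounds its cost from below. With \<open>f\<close> a weighted count of
  servers this yields every lower bound in terms of \<open>cnt\<close>.\<close>

lemma matching_dist_potential:
  assumes "size A = size B" "\<And>x y. x \<in># A \<Longrightarrow> y \<in># B \<Longrightarrow> f y - f x \<le> d x y"
  shows "(\<Sum>x\<in>#B. f x) - (\<Sum>x\<in>#A. f x) \<le> matching_dist d A B"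
proof -
  obtain M where M: "M \<in> matchings A B" "matching_dist d A B = mcost d M"
    using matching_dist_attained[OF assms(1)] by blast
  have "(\<Sum>x\<in>#B. f x) = (\<Sum>(x, y)\<in>#M. f y)" "(\<Sum>x\<in>#A. f x) = (\<Sum>(x, y)\<in>#M. f x)"
    using M(1) by (auto simp: matchings_def image_mset.compositionality comp_def case_prod_unfold)
  moreover have "(\<Sum>(x, y)\<in>#M. f y) \<le> (\<Sum>(x, y)\<in>#M. d x y + f x)"
    by (rule sum_mset_mono) (use assms(2) matchings_mem[OF M(1)] in fastforce)
  moreover have "(\<Sum>(x, y)\<in>#M. d x y + f x) = mcost d M + (\<Sum>(x, y)\<in>#M. f x)"
    by (simp add: case_prod_unfold sum_mset.distrib)
  ultimately show ?thesis using M by simp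
qed

lemma matching_dist_nonneg:
  assumes "size A = size B" "\<And>x y. x \<in># A \<Longrightarrow> y \<in># B \<Longrightarrow> 0 \<le> d x y"
  shows "0 \<le> matching_dist d A B"
  using matching_dist_potential[OF assms(1), of "\<lambda>_. 0"] assms(2) by simp

lemma matching_dist_self_le:
  assumes "\<And>x. x \<in># A \<Longrightarrow> d x x = 0"
  shows "matching_dist d A A \<le> 0"
proof -
  have "image_mset (\<lambda>x. (x, x)) A \<in> matchings A A"
    by (auto simp: matchings_def image_mset.compositionality comp_def)
  from matching_dist_le[OF this, of d] show ?thesis
    using assms by (simp add: image_mset.compositionality comp_def cong: image_mset_cong)
qed

lemma matching_dist_le_add:
  assumes "size A = size B" "\<And>x y. x \<in># A \<Longrightarrow> y \<in># B \<Longrightarrow> d x y \<le> d' x y + c"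
  shows "matching_dist d A B \<le> matching_dist d' A B + real (size A) * c"
proof -
  obtain M where M: "M \<in> matchings A B" "matching_dist d' A B = mcost d' M"
    using matching_dist_attained[OF assms(1)] by blast
  have "mcost d M \<le> (\<Sum>(x, y)\<in>#M. d' x y + c)"
    by (rule sum_mset_mono) (use assms(2) matchings_mem[OF M(1)] in auto)
  also have "\<dots> = mcost d' M + real (size M) * c"
    by (simp add: case_prod_unfold sum_mset.distrib)
  finally show ?thesis using M matching_dist_le[OF M(1), of d] by (auto simp: matchings_def)
qed

lemma matching_dist_image_le:
  assumes "size A = size B" "\<And>x y. x \<in># A \<Longrightarrow> y \<in># B \<Longrightarrow> d (g x) (g y) \<le> d x y"
  shows "matching_dist d (image_mset g A) (image_mset g B) \<le> matching_dist d A B"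
proof -
  obtain M where M: "M \<in> matchings A B" "matching_dist d A B = mcost d M"
    using matching_dist_attained[OF assms(1)] by blast
  let ?N = "image_mset (\<lambda>(x, y). (g x, g y)) M"
  have "?N \<in> matchings (image_mset g A) (image_mset g B)"
    using M(1) by (auto simp: matchings_def image_mset.compositionality comp_def case_prod_unfold)
  then have "matching_dist d (image_mset g A) (image_mset g B) \<le> mcost d ?N"
    by (rule matching_dist_le)
  also have "mcost d ?N = (\<Sum>(x, y)\<in>#M. d (g x) (g y))"
    by (simp add: image_mset.compositionality comp_def case_prod_unfold)
  also have "\<dots> \<le> mcost d M"
    by (rule sum_mset_mono) (use assms(2) matchings_mem[OF M(1)] in auto)
  finally show ?thesis using M by simp
qed

lemma matching_dist_sym_le:
  assumes "size A = size B" "\<And>x y. x \<in># A \<Longrightarrow> y \<in># B \<Longrightarrow> d y x = d x y"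
  shows "matching_dist d B A \<le> matching_dist d A B"
proof -
  obtain M where M: "M \<in> matchings A B" "matching_dist d A B = mcost d M"
    using matching_dist_attained[OF assms(1)] by blast
  let ?N = "image_mset (\<lambda>(x, y). (y, x)) M"
  have "?N \<in> matchings B A"
    using M(1) by (auto simp: matchings_def image_mset.compositionality comp_def case_prod_unfold)
  then have "matching_dist d B A \<le> mcost d ?N"
    by (rule matching_dist_le)
  also have "mcost d ?N = (\<Sum>(x, y)\<in>#M. d y x)"
    by (simp add: image_mset.compositionality comp_def case_prod_unfold)
  also have "\<dots> \<le> mcost d M"
    by (rule sum_mset_mono) (use assms(2) matchings_mem[OF M(1)] in auto)
  finally show ?thesis using M by simp
qed

text \<open>Gluing along the common marginal, by induction on the first matching: a pair
  \<open>(x, y)\<close> consumes one pair \<open>(y, z)\<close> of the second and leaves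
  \<open>(x, z)\<close>.\<close>

lemma matchings_comp:
  assumes "image_mset snd M = image_mset fst N"
    "\<And>x y z. (x, y) \<in># M \<Longrightarrow> (y, z) \<in># N \<Longrightarrow> f x z \<le> d x y + e y z"
  shows "\<exists>K. image_mset fst K = image_mset fst M \<and> image_mset snd K = image_mset snd N \<and>
             mcost f K \<le> mcost d M + mcost e N"
  using assms
proof (induction M arbitrary: N)
  case empty
  then show ?case by (intro exI[of _ "{#}"]) auto
next
  case (add p M)
  obtain x y where p: "p = (x, y)" by (cases p)
  have "y \<in># image_mset fst N" using add.prems(1) p by (metis image_mset_add_mset snd_conv union_single_eq_member)
  then obtain z where z: "(y, z) \<in># N" by auto
  then obtain N' where N: "N = add_mset (y, z) N'" by (metis multi_member_split)
  have "image_mset snd M = image_mset fst N'" using add.prems(1) p N by auto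
  from add.IH[OF this] obtain K where K: "image_mset fst K = image_mset fst M"
    "image_mset snd K = image_mset snd N'" "mcost f K \<le> mcost d M + mcost e N'"
    using add.prems(2) N by auto
  have "f x z \<le> d x y + e y z" using add.prems(2) p z by auto
  then show ?case using K p N by (intro exI[of _ "add_mset (x, z) K"]) auto
qed

lemma matching_dist_comp:
  assumes "size A = size B" "size B = size C"
    "\<And>x y z. x \<in># A \<Longrightarrow> y \<in># B \<Longrightarrow> z \<in># C \<Longrightarrow> f x z \<le> d x y + e y z"
  shows "matching_dist f A C \<le> matching_dist d A B + matching_dist e B C"
proof -
  obtain M where M: "M \<in> matchings A B" "matching_dist d A B = mcost d M"
    using matching_dist_attained[OF assms(1)] by blast
  obtain N where N: "N \<in> matchings B C" "matching_dist e B C = mcost e N"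
    using matching_dist_attained[OF assms(2)] by blast
  have "\<exists>K. image_mset fst K = image_mset fst M \<and> image_mset snd K = image_mset snd N \<and>
             mcost f K \<le> mcost d M + mcost e N"
    by (rule matchings_comp)
      (use M(1) N(1) assms(3) matchings_mem[OF M(1)] matchings_mem[OF N(1)] in \<open>auto simp: matchings_def\<close>)
  then obtain K where "K \<in> matchings A C" "mcost f K \<le> mcost d M + mcost e N"
    using M N by (auto simp: matchings_def)
  then show ?thesis using M N matching_dist_le[of K A C f] by linarith
qed

lemma matchings_swap:
  assumes "M \<in> matchings A B" "{#(a, x), (b, y)#} \<subseteq># M"
  shows "M - {#(a, x), (b, y)#} + {#(a, y), (b, x)#} \<in> matchings A B"
  using assms unfolding matchings_def mset_subset_eq_exists_conv by auto

text \<open>Cyclic monotonicity for two pairs: exchanging their partners gives another matching.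
  \<open>md_split\<close> uses it to exclude crossings in opposite directions.\<close>

lemma optimal_matching_swap:
  assumes "M \<in> matchings A B" "matching_dist d A B = mcost d M" "{#(a, x), (b, y)#} \<subseteq># M"
  shows "d a x + d b y \<le> d a y + d b x"
proof -
  obtain N where N: "M = N + {#(a, x), (b, y)#}"
    using assms(3) by (metis subset_mset.diff_add)
  have "mcost d M \<le> mcost d (N + {#(a, y), (b, x)#})"
    using matching_dist_le[OF matchings_swap[OF assms(1,3)], of d] assms(2) N by simp
  then show ?thesis using N by simp
qed

section \<open>Counting servers in a region\<close>

definition cnt :: "'p set \<Rightarrow> 'p multiset \<Rightarrow> nat" where
  "cnt R A = size {#x \<in># A. x \<in> R#}"

lemma cnt_simps [simp]: "cnt R {#} = 0" "cnt R (A + B) = cnt R A + cnt R B"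
  "cnt R (add_mset x A) = (if x \<in> R then Suc (cnt R A) else cnt R A)"
  by (auto simp: cnt_def)

lemma cnt_le_size: "cnt R A \<le> size A"
  by (auto simp: cnt_def)

lemma real_cnt: "real (cnt R A) = (\<Sum>x\<in>#A. if x \<in> R then 1 else 0)"
  by (induction A) auto

lemma cnt_disjoint: "set_mset A \<inter> R = {} \<Longrightarrow> cnt R A = 0"
  by (induction A) auto

lemma cnt_subset: "set_mset A \<subseteq> R \<Longrightarrow> cnt R A = size A"
  by (induction A) auto

lemma cnt_mono: "R \<subseteq> R' \<Longrightarrow> cnt R A \<le> cnt R' A"
  by (induction A) auto

lemma cnt_Un: "R \<inter> R' = {} \<Longrightarrow> cnt (R \<union> R') A = cnt R A + cnt R' A"
  by (induction A) auto

lemma mset_set_subseteq: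
  assumes "Q \<subseteq> set_mset A"
  shows "mset_set Q \<subseteq># A"
  using assms by (auto simp: subseteq_mset_def count_mset_set' Suc_le_eq)

lemma card_le_cnt:
  assumes "Q \<subseteq> set_mset A"
  shows "card Q \<le> cnt Q A"
proof -
  have "mset_set Q \<subseteq># {#x \<in># A. x \<in> Q#}"
    using assms by (intro mset_set_subseteq) auto
  from size_mset_mono[OF this] show ?thesis by (simp add: cnt_def)
qed

lemma matching_dist_cnt:
  assumes "size A = size B" "0 \<le> \<Delta>"
    "\<And>x y. x \<in># A \<Longrightarrow> y \<in># B \<Longrightarrow> y \<in> R \<Longrightarrow> x \<notin> R \<Longrightarrow> \<Delta> \<le> d x y"
    "\<And>x y. x \<in># A \<Longrightarrow> y \<in># B \<Longrightarrow> 0 \<le> d x y"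
  shows "\<Delta> * (real (cnt R B) - real (cnt R A)) \<le> matching_dist d A B"
proof -
  have "(\<Sum>x\<in>#B. \<Delta> * (if x \<in> R then 1 else 0)) - (\<Sum>x\<in>#A. \<Delta> * (if x \<in> R then 1 else 0))
    \<le> matching_dist d A B"
  proof (rule matching_dist_potential[OF assms(1)])
    show "\<Delta> * (if y \<in> R then 1 else 0) - \<Delta> * (if x \<in> R then 1 else 0) \<le> d x y"
      if "x \<in># A" "y \<in># B" for x y
      using assms(2) assms(3)[OF that] assms(4)[OF that] by auto
  qed
  then show ?thesis by (simp add: real_cnt sum_mset_distrib_left right_diff_distrib)
qed

subsection \<open>Work functions in bounded ultrametric spaces\<close>

text \<open>Distinct points at distance zero are not excluded; where separation matters it comes
  from \<open>isolated\<close>.\<close>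

locale bounded_ultrametric =
  fixes P :: "'p set" and d :: "'p \<Rightarrow> 'p \<Rightarrow> real" and D :: real
  assumes d_self: "x \<in> P \<Longrightarrow> d x x = 0"
    and d_sym: "x \<in> P \<Longrightarrow> y \<in> P \<Longrightarrow> d x y = d y x"
    and d_nonneg: "x \<in> P \<Longrightarrow> y \<in> P \<Longrightarrow> 0 \<le> d x y"
    and d_ultra: "x \<in> P \<Longrightarrow> y \<in> P \<Longrightarrow> z \<in> P \<Longrightarrow> d x z \<le> max (d x y) (d y z)"
    and d_le_D: "x \<in> P \<Longrightarrow> y \<in> P \<Longrightarrow> d x y \<le> D"
begin

abbreviation md :: "'p multiset \<Rightarrow> 'p multiset \<Rightarrow> real" where
  "md \<equiv> matching_dist d"

text \<open>Entering an isolated point costs \<open>\<delta>\<close>, and the shrunk distance is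
  what such a move costs beyond that. Subtracting a constant from all distances would break the
  triangle inequality of a general metric; \<open>d_ultra\<close> preserves it
  (\<open>shrunk_tri\<close>).\<close>

definition shrunk :: "real \<Rightarrow> 'p \<Rightarrow> 'p \<Rightarrow> real" where
  "shrunk \<delta> x y = max 0 (d x y - \<delta>)"

definition isolated :: "real \<Rightarrow> 'p set \<Rightarrow> bool" where
  "isolated \<delta> Q \<longleftrightarrow> 0 < \<delta> \<and> Q \<subseteq> P \<and> (\<forall>q\<in>Q. \<forall>x\<in>P. x \<noteq> q \<longrightarrow> \<delta> \<le> d x q)"

lemma d_tri: "x \<in> P \<Longrightarrow> y \<in> P \<Longrightarrow> z \<in> P \<Longrightarrow> d x z \<le> d x y + d y z"
  using d_ultra[of x y z] d_nonneg[of x y] d_nonneg[of y z] by linarith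

lemma configs_memD: "A \<in> configs P k \<Longrightarrow> x \<in># A \<Longrightarrow> x \<in> P"
  by (auto simp: configs_def)

lemma configs_size: "A \<in> configs P k \<Longrightarrow> size A = k"
  by (auto simp: configs_def)

lemma md_nonneg: "A \<in> configs P k \<Longrightarrow> B \<in> configs P k \<Longrightarrow> 0 \<le> md A B"
  by (rule matching_dist_nonneg) (auto simp: configs_def intro!: d_nonneg)

lemma md_self: "A \<in> configs P k \<Longrightarrow> md A A = 0"
  using matching_dist_self_le[of A d] md_nonneg[of A k A]
  by (fastforce simp: configs_def intro: d_self)

lemma md_sym: "A \<in> configs P k \<Longrightarrow> B \<in> configs P k \<Longrightarrow> md A B = md B A"
  by (intro antisym matching_dist_sym_le) (auto simp: configs_size intro: eq_refl[OF d_sym] configs_memD)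

lemma md_tri:
  "A \<in> configs P k \<Longrightarrow> B \<in> configs P k \<Longrightarrow> C \<in> configs P k \<Longrightarrow> md A C \<le> md A B + md B C"
  by (rule matching_dist_comp) (auto simp: configs_def intro!: d_tri)

lemma md_le: "A \<in> configs P k \<Longrightarrow> B \<in> configs P k \<Longrightarrow> md A B \<le> real k * D"
  using matching_dist_le_const[of A B d D] by (auto simp: configs_def intro!: d_le_D)

lemma shrunk_nonneg:
  "A \<in> configs P k \<Longrightarrow> B \<in> configs P k \<Longrightarrow> 0 \<le> matching_dist (shrunk \<delta>) A B"
  by (rule matching_dist_nonneg) (auto simp: configs_def shrunk_def)

lemma shrunk_tri:
  assumes "A \<in> configs P k" "B \<in> configs P k" "C \<in> configs P k"
  shows "matching_dist (shrunk \<delta>) A C \<le> matching_dist (shrunk \<delta>) A B + matching_dist (shrunk \<delta>) B C"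
proof (rule matching_dist_comp)
  fix x y z assume "x \<in># A" "y \<in># B" "z \<in># C"
  then have "x \<in> P" "y \<in> P" "z \<in> P" using assms configs_memD by blast+
  then have "d x z \<le> max (d x y) (d y z)" by (rule d_ultra)
  then show "shrunk \<delta> x z \<le> shrunk \<delta> x y + shrunk \<delta> y z" unfolding shrunk_def by linarith
qed (use assms in \<open>auto simp: configs_def\<close>)

lemma shrunk_self:
  assumes "A \<in> configs P k" "0 \<le> \<delta>" shows "matching_dist (shrunk \<delta>) A A = 0"
proof (rule antisym)
  show "matching_dist (shrunk \<delta>) A A \<le> 0"
    by (rule matching_dist_self_le) (use assms d_self configs_memD in \<open>auto simp: shrunk_def\<close>)
qed (use shrunk_nonneg assms in blast)

lemma md_le_shrunk:
  "A \<in> configs P k \<Longrightarrow> B \<in> configs P k \<Longrightarrow> md A B \<le> matching_dist (shrunk \<delta>) A B + real k * \<delta>"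
  using matching_dist_le_add[of A B d "shrunk \<delta>" \<delta>] by (auto simp: configs_def shrunk_def)

lemma shrunk_le_md:
  assumes "A \<in> configs P k" "B \<in> configs P k" "0 \<le> \<delta>"
  shows "matching_dist (shrunk \<delta>) A B \<le> md A B"
proof -
  have "shrunk \<delta> x y \<le> d x y + 0" if "x \<in># A" "y \<in># B" for x y
    using d_nonneg[of x y] configs_memD that assms by (fastforce simp: shrunk_def)
  then show ?thesis
    using matching_dist_le_add[of A B "shrunk \<delta>" d 0] assms by (simp add: configs_size)
qed

text \<open>Some server reaches \<open>q\<close> from a different point, so its pair has length at
  least \<open>\<delta>\<close> and shrinks by exactly \<open>\<delta>\<close>; no other pair gets
  longer by shrinking.\<close>

lemma shrunk_add_le_md:
  assumes "A \<in> configs P k" "B \<in> configs P k" "isolated \<delta> Q" "q \<in> Q" "q \<in># B" "q \<notin># A"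
  shows "matching_dist (shrunk \<delta>) A B + \<delta> \<le> md A B"
proof -
  obtain M where M: "M \<in> matchings A B" "md A B = mcost d M"
    using matching_dist_attained[of A B d] assms by (auto simp: configs_def)
  obtain a where a: "(a, q) \<in># M"
    using M(1) assms(5) by (auto simp: matchings_def)
  then obtain M' where M': "M = add_mset (a, q) M'" by (metis multi_member_split)
  have aA: "a \<in># A" using matchings_mem[OF M(1) a] by simp
  then have "a \<in> P" "a \<noteq> q" using assms(6) configs_memD[OF assms(1)] by auto
  then have "\<delta> \<le> d a q" using assms(3,4) by (auto simp: isolated_def)
  then have 1: "shrunk \<delta> a q + \<delta> = d a q" by (auto simp: shrunk_def)
  have "mcost (shrunk \<delta>) M' \<le> mcost d M'"
  proof (rule sum_mset_mono)
    fix p assume "p \<in># M'"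
    then have "fst p \<in># A" "snd p \<in># B" using matchings_mem[OF M(1)] M' by (cases p; force)+
    then have "0 \<le> d (fst p) (snd p)" using assms configs_memD d_nonneg by metis
    then show "(case p of (x, y) \<Rightarrow> shrunk \<delta> x y) \<le> (case p of (x, y) \<Rightarrow> d x y)"
      using assms(3) by (auto simp: shrunk_def isolated_def split: prod.split)
  qed
  then show ?thesis
    using 1 M M' matching_dist_le[OF M(1), of "shrunk \<delta>"] by simp
qed

lemma md_ge_isolated:
  assumes "A \<in> configs P k" "B \<in> configs P k" "isolated \<delta> Q" "q \<in> Q" "q \<in># B" "q \<notin># A"
  shows "\<delta> \<le> md A B"
  using shrunk_add_le_md[OF assms] shrunk_nonneg[OF assms(1,2), of \<delta>] by linarith

end

section \<open>Basic properties of work functions\<close>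

lemma sched_cost_snoc: "sched_cost d A (Cs @ [B, C]) = sched_cost d A (Cs @ [B]) + matching_dist d B C"
  by (induction Cs arbitrary: A) auto

text \<open>Used twice: for the servers of the algorithm, whose moves depend on the work function of
  that size, and for the \<open>h\<close> servers of the adversary, where any value of
  \<open>W\<close> bounds the optimum from above (\<open>opt_cost_le\<close>).\<close>

locale work_function = bounded_ultrametric P d D
  for P :: "'p set" and d D +
  fixes k :: nat and A0 :: "'p multiset"
  assumes k_pos: "0 < k" and A0: "A0 \<in> configs P k"
begin

abbreviation conf :: "'p multiset set" where "conf \<equiv> configs P k"

definition W :: "'p list \<Rightarrow> 'p multiset \<Rightarrow> real" where
  "W rs Z = work_fun P d A0 rs Z"

lemma size_A0: "size A0 = k" using A0 by (auto simp: configs_def)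

lemma sched_nonneg:
  assumes "A \<in> conf" "list_all2 (\<lambda>r C. C \<in> conf \<and> r \<in># C) rs Cs"
  shows "0 \<le> sched_cost d A Cs"
  using assms(2,1)
proof (induction arbitrary: A rule: list_all2_induct)
  case (Cons x xs y ys)
  then show ?case using md_nonneg[of A k y] by auto
qed auto

lemma sched_nonneg':
  assumes "serves P k rs Cs" "Z \<in> conf"
  shows "0 \<le> sched_cost d A0 (Cs @ [Z])"
proof -
  have "Z \<noteq> {#}" using assms(2) k_pos by (auto simp: configs_def)
  then obtain z where "z \<in># Z" by blast
  then have "list_all2 (\<lambda>r C. C \<in> conf \<and> r \<in># C) (rs @ [z]) (Cs @ [Z])"
    using assms by (auto simp: serves_def intro: list_all2_appendI)
  then show ?thesis using sched_nonneg A0 by blast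
qed

lemma W_le: "serves P k rs Cs \<Longrightarrow> Z \<in> conf \<Longrightarrow> W rs Z \<le> sched_cost d A0 (Cs @ [Z])"
  unfolding W_def work_fun_def size_A0
  by (rule cInf_lower) (auto intro!: bdd_belowI[of _ 0] sched_nonneg')

lemma serves_ex:
  assumes "set rs \<subseteq> P" shows "\<exists>Cs. serves P k rs Cs"
proof
  show "serves P k rs (map (replicate_mset k) rs)"
    using assms k_pos unfolding serves_def
    by (auto simp: list_all2_map2 list_all2_same configs_def subset_iff)
qed

lemma W_ge:
  assumes "set rs \<subseteq> P" "\<And>Cs. serves P k rs Cs \<Longrightarrow> c \<le> sched_cost d A0 (Cs @ [Z])"
  shows "c \<le> W rs Z"
  unfolding W_def work_fun_def size_A0
  by (rule cInf_greatest) (use serves_ex[OF assms(1)] assms(2) in auto)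

lemma W_nil: "W [] Z = md A0 Z"
  unfolding W_def work_fun_def by (auto simp: serves_def)

text \<open>With \<open>W_step_ge\<close> this is the usual recursion for work functions, split into
  two inequalities so that nothing has to be known about whether the infimum over \<open>V\<close>
  is attained.\<close>

lemma W_step_le:
  assumes "set rs \<subseteq> P" "V \<in> conf" "r \<in># V" "Z \<in> conf"
  shows "W (rs @ [r]) Z \<le> W rs V + md V Z"
proof -
  have "W (rs @ [r]) Z - md V Z \<le> W rs V"
  proof (rule W_ge[OF assms(1)])
    fix Cs assume "serves P k rs Cs"
    then have "serves P k (rs @ [r]) (Cs @ [V])"
      using assms by (auto simp: serves_def intro: list_all2_appendI)
    from W_le[OF this assms(4)] show "W (rs @ [r]) Z - md V Z \<le> sched_cost d A0 (Cs @ [V])"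
      by (simp add: sched_cost_snoc)
  qed
  then show ?thesis by simp
qed

lemma W_step_ge:
  assumes "set (rs @ [r]) \<subseteq> P" "\<And>V. V \<in> conf \<Longrightarrow> r \<in># V \<Longrightarrow> c \<le> W rs V + md V Z"
  shows "c \<le> W (rs @ [r]) Z"
proof (rule W_ge[OF assms(1)])
  fix Cs' assume "serves P k (rs @ [r]) Cs'"
  then obtain Cs V where Cs: "Cs' = Cs @ [V]" "serves P k rs Cs" "V \<in> conf" "r \<in># V"
    unfolding serves_def by (auto simp: list_all2_append1 list_all2_Cons1)
  show "c \<le> sched_cost d A0 (Cs' @ [Z])"
    using assms(2)[OF Cs(3,4)] W_le[OF Cs(2,3)] Cs(1) by (simp add: sched_cost_snoc)
qed

lemma W_lip:
  assumes "set rs \<subseteq> P" "Y \<in> conf" "Z \<in> conf"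
  shows "W rs Z \<le> W rs Y + md Y Z"
  using assms(1)
proof (cases rs rule: rev_cases)
  case Nil
  then show ?thesis using md_tri[OF A0 assms(2,3)] by (simp add: W_nil)
next
  case (snoc qs r)
  have "W rs Z - md Y Z \<le> W rs Y"
    unfolding snoc
  proof (rule W_step_ge)
    fix V assume V: "V \<in> conf" "r \<in># V"
    show "W (qs @ [r]) Z - md Y Z \<le> W qs V + md V Y"
      using W_step_le[OF _ V assms(3), of qs] md_tri[OF V(1) assms(2,3)] assms(1) snoc by auto
  qed (use assms snoc in auto)
  then show ?thesis by simp
qed

lemma W_mono1:
  assumes "set (rs @ [r]) \<subseteq> P" "Z \<in> conf"
  shows "W rs Z \<le> W (rs @ [r]) Z"
  by (rule W_step_ge) (use assms W_lip in auto)

lemma W_mono: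
  assumes "set (rs @ \<rho>) \<subseteq> P" "Z \<in> conf"
  shows "W rs Z \<le> W (rs @ \<rho>) Z"
  using assms(1)
proof (induction \<rho> rule: rev_induct)
  case (snoc r \<rho>)
  then show ?case using W_mono1[of "rs @ \<rho>" r Z] assms(2) by auto
qed auto

text \<open>A configuration occupying all points of \<open>\<rho>\<close> serves them without
  moving. Together with \<open>W_lip\<close> this is the source of the upper bounds on work
  functions below.\<close>

lemma W_cover:
  assumes "set (rs @ \<rho>) \<subseteq> P" "Z \<in> conf" "set \<rho> \<subseteq> set_mset Z"
  shows "W (rs @ \<rho>) Z = W rs Z"
  using assms(1,3)
proof (induction \<rho> rule: rev_induct)
  case (snoc r \<rho>)
  then show ?case
    using W_mono1[of "rs @ \<rho>" r Z] W_step_le[of "rs @ \<rho>" Z r Z] assms(2) md_self[OF assms(2)] by auto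
qed auto

lemma W_via:
  assumes "set (rs @ \<rho>) \<subseteq> P" "V \<in> conf" "set \<rho> \<subseteq> set_mset V" "Z \<in> conf"
  shows "W (rs @ \<rho>) Z \<le> W rs V + md V Z"
  using W_lip[OF assms(1,2,4)] W_cover[OF assms(1-3)] by simp

lemma opt_cost_le:
  assumes "set rs \<subseteq> P" "Z \<in> conf"
  shows "opt_cost P d A0 rs \<le> W rs Z"
proof (rule W_ge[OF assms(1)])
  fix Cs assume Cs: "serves P k rs Cs"
  have nonneg: "0 \<le> sched_cost d A0 Cs'" if "serves P k rs Cs'" for Cs'
    using that sched_nonneg[OF A0] by (auto simp: serves_def)
  have "opt_cost P d A0 rs \<le> sched_cost d A0 Cs"
    unfolding opt_cost_def size_A0
    by (rule cInf_lower) (use Cs nonneg in \<open>auto intro!: bdd_belowI[of _ 0]\<close>)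
  moreover have "sched_cost d A0 Cs \<le> sched_cost d A0 (Cs @ [Z])"
  proof (cases Cs rule: rev_cases)
    case (snoc Ds V)
    then have "V \<in> conf" using Cs unfolding serves_def by (auto simp: list_all2_append2 list_all2_Cons2)
    then show ?thesis using snoc md_nonneg[of V k Z] assms(2) by (simp add: sched_cost_snoc)
  qed (use md_nonneg[OF A0 assms(2)] in auto)
  ultimately show "opt_cost P d A0 rs \<le> sched_cost d A0 (Cs @ [Z])" by simp
qed

lemma opt_cost_nonneg:
  assumes "set rs \<subseteq> P"
  shows "0 \<le> opt_cost P d A0 rs"
  unfolding opt_cost_def size_A0
  by (rule cInf_greatest)
     (use serves_ex[OF assms] sched_nonneg[OF A0] in \<open>auto simp: serves_def\<close>)

text \<open>
  A configuration that misses a point \<open>q\<close> of \<open>Q\<close> must pay for entering \<open>q\<close>, and in an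
  ultrametric such a detour makes no progress: it is a surplus over the shrunk distance.
\<close>

lemma W_round_prefix:
  assumes "set (rs @ ps) \<subseteq> P" "isolated \<delta> Q" "set ps \<subseteq> Q" "Z \<in> conf"
    and lb: "\<And>V. V \<in> conf \<Longrightarrow> min (gf V) (gs V) \<le> W rs V"
    and gf: "\<And>U V. U \<in> conf \<Longrightarrow> V \<in> conf \<Longrightarrow> gf V \<le> gf U + md U V"
    and gs: "\<And>U V. U \<in> conf \<Longrightarrow> V \<in> conf \<Longrightarrow> gs V \<le> gs U + matching_dist (shrunk \<delta>) U V"
    and c: "c \<le> gf Z" "c \<le> gs Z + \<delta>"
      "\<And>V. V \<in> conf \<Longrightarrow> set ps \<subseteq> set_mset V \<Longrightarrow> c \<le> W rs V + md V Z"
  shows "c \<le> W (rs @ ps) Z"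
  using assms(1,3,4) c
\<comment> \<open>The bound \<open>c\<close> is generalized along with \<open>Z\<close>: removing
  the last request replaces \<open>Z\<close> by \<open>V\<close> and lowers the bound by
  \<open>md V Z\<close>.\<close>
proof (induction ps arbitrary: Z c rule: rev_induct)
  case Nil
  then show ?case using md_self[of Z k] by fastforce
next
  case (snoc p ps)
  have "c \<le> W ((rs @ ps) @ [p]) Z"
  proof (rule W_step_ge)
    fix V assume V: "V \<in> conf" "p \<in># V"
    have sh: "matching_dist (shrunk \<delta>) V Z \<le> md V Z"
      by (rule shrunk_le_md[OF V(1) snoc.prems(3)]) (use assms(2) in \<open>auto simp: isolated_def\<close>)
    have "c - md V Z \<le> W (rs @ ps) V"
    proof (rule snoc.IH)
      show "c - md V Z \<le> gf V" using gf[OF V(1) snoc.prems(3)] snoc.prems(4) by linarith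
      show "c - md V Z \<le> gs V + \<delta>" using gs[OF V(1) snoc.prems(3)] snoc.prems(5) sh by linarith
      fix U assume U: "U \<in> conf" "set ps \<subseteq> set_mset U"
      show "c - md V Z \<le> W rs U + md U V"
      proof (cases "p \<in># U")
        case True
        then have "c \<le> W rs U + md U Z" using snoc.prems(6)[OF U(1)] U(2) by auto
        then show ?thesis using md_tri[OF U(1) V(1) snoc.prems(3)] by linarith
      next
        \<comment> \<open>Here \<open>U\<close> misses \<open>p\<close>, so reaching
          \<open>V\<close> costs \<open>\<delta>\<close> beyond the shrunk distance. If
          \<open>gs\<close> is the bound that holds at \<open>U\<close>, this lifts it by
          \<open>\<delta>\<close>; if it is \<open>gf\<close>, its Lipschitz property
          suffices.\<close>
        case False
        have e: "matching_dist (shrunk \<delta>) U V + \<delta> \<le> md U V"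
          by (rule shrunk_add_le_md[OF U(1) V(1) assms(2)]) (use False V snoc.prems in auto)
        show ?thesis
          using lb[OF U(1)] gf[OF U(1) V(1)] gs[OF U(1) V(1)] e
            gf[OF V(1) snoc.prems(3)] gs[OF V(1) snoc.prems(3)] sh snoc.prems(4,5)
          by (auto simp: min_def split: if_splits)
      qed
    qed (use snoc.prems V in auto)
    then show "c \<le> W (rs @ ps) V + md V Z" by simp
  qed (use snoc.prems in auto)
  then show ?case by simp
qed

section \<open>Repeated rounds of requests and saturation\<close>

definition rounds :: "nat \<Rightarrow> 'p list \<Rightarrow> 'p list" where
  "rounds n qs = concat (replicate n qs)"

lemma set_rounds: "set (rounds n qs) \<subseteq> set qs"
  by (auto simp: rounds_def)

lemma length_rounds: "length (rounds n qs) = n * length qs"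
  by (auto simp: rounds_def length_concat sum_list_replicate)

text \<open>Each round raises the second bound by \<open>\<delta>\<close> and leaves
  \<open>gf\<close> as a cap, which by \<open>cov\<close> is a true bound at every configuration
  covering \<open>qs\<close>. After enough rounds only the cap is left.\<close>

lemma W_rounds:
  assumes "set rs \<subseteq> P" "isolated \<delta> (set qs)" "Z \<in> conf"
    and lb: "\<And>V. V \<in> conf \<Longrightarrow> min (gf V) (gs V) \<le> W rs V"
    and gf: "\<And>U V. U \<in> conf \<Longrightarrow> V \<in> conf \<Longrightarrow> gf V \<le> gf U + md U V"
    and gs: "\<And>U V. U \<in> conf \<Longrightarrow> V \<in> conf \<Longrightarrow> gs V \<le> gs U + matching_dist (shrunk \<delta>) U V"
    and cov: "\<And>V. V \<in> conf \<Longrightarrow> set qs \<subseteq> set_mset V \<Longrightarrow> gf V \<le> W rs V"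
  shows "min (gf Z) (gs Z + real n * \<delta>) \<le> W (rs @ rounds n qs) Z"
  using assms(3)
proof (induction n arbitrary: Z)
  case 0
  then show ?case using lb by (auto simp: rounds_def)
next
  case (Suc n)
  let ?rs = "rs @ rounds n qs"
  have sub: "set ?rs \<subseteq> P" "set qs \<subseteq> P"
    using assms(1,2) set_rounds[of n qs] by (auto simp: isolated_def)
  have eq: "rs @ rounds (Suc n) qs = ?rs @ qs"
    by (simp add: rounds_def flip: replicate_append_same)
  show ?case
    unfolding eq
  proof (rule W_round_prefix[where gf = gf and gs = "\<lambda>Z. gs Z + real n * \<delta>" and Q = "set qs" and \<delta> = \<delta>])
    fix V assume V: "V \<in> conf" "set qs \<subseteq> set_mset V"
    have "gf V \<le> W ?rs V"
      using cov[OF V] W_mono[OF sub(1) V(1)] by linarith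
    then show "min (gf Z) (gs Z + real (Suc n) * \<delta>) \<le> W ?rs V + md V Z"
      using gf[OF V(1) Suc.prems] by linarith
  next
    show "gs V + real n * \<delta> \<le> gs U + real n * \<delta> + matching_dist (shrunk \<delta>) U V"
      if "U \<in> conf" "V \<in> conf" for U V
      using gs[OF that] by simp
  next
    show "min (gf Z) (gs Z + real (Suc n) * \<delta>) \<le> gs Z + real n * \<delta> + \<delta>"
      by (simp add: distrib_right)
  qed (use sub assms(2) Suc gf in auto)
qed

text \<open>The work function is determined by its values on the configurations covering
  \<open>Q\<close>: it is the infimum of \<open>W rs V + md V Z\<close> over them, one direction
  being \<open>W_lip\<close>. Quantifying over lower bounds \<open>c\<close> avoids the infimum. If
  \<open>Q\<close> has \<open>k\<close> points, this is a cone with apex \<open>mset_set Q\<close>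
  (\<open>sat_full_iff\<close>).\<close>

definition sat :: "'p set \<Rightarrow> 'p list \<Rightarrow> bool" where
  "sat Q rs \<longleftrightarrow> (\<forall>Z\<in>conf. \<forall>c.
     (\<forall>V\<in>conf. Q \<subseteq> set_mset V \<longrightarrow> c \<le> W rs V + md V Z) \<longrightarrow> c \<le> W rs Z)"

lemma satD:
  assumes "sat Q rs" "Z \<in> conf" "\<And>V. V \<in> conf \<Longrightarrow> Q \<subseteq> set_mset V \<Longrightarrow> c \<le> W rs V + md V Z"
  shows "c \<le> W rs Z"
  using assms unfolding sat_def by blast

lemma config_supset_ex:
  assumes "finite Q" "Q \<subseteq> P" "card Q \<le> k"
  shows "\<exists>V\<in>conf. Q \<subseteq> set_mset V"
proof -
  have "A0 \<noteq> {#}" using size_A0 k_pos by auto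
  then obtain a where a: "a \<in># A0" by blast
  have "a \<in> P" using A0 a configs_memD by blast
  then show ?thesis
    by (intro bexI[of _ "mset_set Q + replicate_mset (k - card Q) a"])
       (use assms in \<open>auto simp: configs_def\<close>)
qed

lemma sat_rounds:
  assumes "set rs \<subseteq> P" "isolated \<delta> (set qs)" "card (set qs) \<le> k" "2 * real k * D \<le> real n * \<delta>"
  shows "sat (set qs) (rs @ rounds n qs)"
  unfolding sat_def
proof (intro ballI allI impI)
  fix Z c assume Z: "Z \<in> conf"
    and c: "\<forall>V\<in>conf. set qs \<subseteq> set_mset V \<longrightarrow> c \<le> W (rs @ rounds n qs) V + md V Z"
  have sub: "set (rs @ rounds n qs) \<subseteq> P"
    using assms(1,2) set_rounds[of n qs] by (auto simp: isolated_def)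
  have c': "c \<le> W rs V + md V Z" if "V \<in> conf" "set qs \<subseteq> set_mset V" for V
    using c that W_cover[OF sub that(1)] set_rounds[of n qs] by auto
  obtain V0 where V0: "V0 \<in> conf" "set qs \<subseteq> set_mset V0"
    using config_supset_ex[of "set qs"] assms by (auto simp: isolated_def)
  \<comment> \<open>The constant \<open>\<beta>\<close> lies below \<open>W rs\<close> everywhere
    and so is a bound of the second kind. It is at most \<open>2 * k * D\<close> below
    \<open>c\<close>, which is the height the rounds have to climb.\<close>
  define \<beta> where "\<beta> = W rs V0 - real k * D"
  have "min (c - md Z Z) (\<beta> + real n * \<delta>) \<le> W (rs @ rounds n qs) Z"
  proof (rule W_rounds[where gf = "\<lambda>V. c - md V Z" and gs = "\<lambda>_. \<beta>"])
    fix V assume V: "V \<in> conf"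
    have "\<beta> \<le> W rs V" unfolding \<beta>_def
      using W_lip[OF assms(1) V V0(1)] md_le[OF V V0(1)] by linarith
    then show "min (c - md V Z) \<beta> \<le> W rs V" by simp
  next
    show "c - md V Z \<le> c - md U Z + md U V" if "U \<in> conf" "V \<in> conf" for U V
      using md_tri[OF that Z] by simp
  next
    show "\<beta> \<le> \<beta> + matching_dist (shrunk \<delta>) U V" if "U \<in> conf" "V \<in> conf" for U V
      using shrunk_nonneg[OF that] by simp
  next
    show "c - md V Z \<le> W rs V" if "V \<in> conf" "set qs \<subseteq> set_mset V" for V
      using c'[OF that] by simp
  qed (use assms Z in auto)
  moreover have "c \<le> \<beta> + real n * \<delta>"
    unfolding \<beta>_def using c'[OF V0] md_le[OF V0(1) Z] assms(4) by linarith
  ultimately show "c \<le> W (rs @ rounds n qs) Z" using md_self[OF Z] by simp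
qed

lemma sat_stable:
  assumes "sat Q rs" "set (rs @ \<rho>) \<subseteq> P" "set \<rho> \<subseteq> Q" "Z \<in> conf"
  shows "W (rs @ \<rho>) Z = W rs Z"
proof (rule antisym)
  show "W (rs @ \<rho>) Z \<le> W rs Z"
    by (rule satD[OF assms(1,4)]) (use W_via assms in blast)
qed (use W_mono assms in auto)

lemma sat_append:
  assumes "sat Q rs" "set (rs @ \<rho>) \<subseteq> P" "set \<rho> \<subseteq> Q"
  shows "sat Q (rs @ \<rho>)"
  unfolding sat_def
proof (intro ballI allI impI)
  fix Z c assume *: "Z \<in> conf" "\<forall>V\<in>conf. Q \<subseteq> set_mset V \<longrightarrow> c \<le> W (rs @ \<rho>) V + md V Z"
  show "c \<le> W (rs @ \<rho>) Z"
    unfolding sat_stable[OF assms *(1)]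
    by (rule satD[OF assms(1) *(1)]) (use * sat_stable[OF assms] in auto)
qed

lemma full_config:
  assumes "finite Q" "card Q = k" "V \<in> conf" "Q \<subseteq> set_mset V"
  shows "V = mset_set Q"
proof -
  have "mset_set Q \<subseteq># V" using assms mset_set_subseteq by blast
  moreover have "size (mset_set Q) = size V" using assms by (simp add: configs_def)
  ultimately show ?thesis by (metis mset_subset_size nless_le subset_mset.order_iff_strict)
qed

lemma sat_full_iff:
  assumes "finite Q" "card Q = k" "Q \<subseteq> P" "set rs \<subseteq> P"
  shows "sat Q rs \<longleftrightarrow> (\<forall>Z\<in>conf. W rs Z = W rs (mset_set Q) + md (mset_set Q) Z)"
proof -
  have Q: "mset_set Q \<in> conf" using assms by (auto simp: configs_def)
  have "sat Q rs \<longleftrightarrow> (\<forall>Z\<in>conf. W rs (mset_set Q) + md (mset_set Q) Z \<le> W rs Z)"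
    unfolding sat_def
  proof (intro ball_cong refl iffI allI impI)
    fix Z c assume "Z \<in> conf" "W rs (mset_set Q) + md (mset_set Q) Z \<le> W rs Z"
      "\<forall>V\<in>conf. Q \<subseteq> set_mset V \<longrightarrow> c \<le> W rs V + md V Z"
    then show "c \<le> W rs Z" using Q assms(1) by fastforce
  next
    fix Z assume "Z \<in> conf" "\<forall>c. (\<forall>V\<in>conf. Q \<subseteq> set_mset V \<longrightarrow> c \<le> W rs V + md V Z) \<longrightarrow> c \<le> W rs Z"
    then show "W rs (mset_set Q) + md (mset_set Q) Z \<le> W rs Z"
      using full_config[OF assms(1,2)] by auto
  qed
  then show ?thesis using W_lip[OF assms(4) Q] by (auto intro: antisym)
qed

text \<open>Repairs a cone that is off by at most \<open>e\<close>. The rounds have to make up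
  \<open>e\<close> and the \<open>k * \<delta>\<close> lost by passing to shrunk distances, instead
  of the \<open>2 * k * D\<close> in \<open>sat_rounds\<close>; this matters because the adversary
  pays for these rounds.\<close>

lemma sharpen_rounds:
  assumes "set rs \<subseteq> P" "isolated \<delta> (set qs)" "card (set qs) = k"
    and lb: "\<And>Z. Z \<in> conf \<Longrightarrow> W rs (mset_set (set qs)) + md (mset_set (set qs)) Z - e \<le> W rs Z"
    and n: "e + real k * \<delta> \<le> real n * \<delta>"
  shows "sat (set qs) (rs @ rounds n qs)"
proof -
  let ?C = "mset_set (set qs)"
  have sub: "set (rs @ rounds n qs) \<subseteq> P" "set qs \<subseteq> P"
    using assms(1,2) set_rounds[of n qs] by (auto simp: isolated_def)
  have C: "?C \<in> conf" using sub assms(3) by (auto simp: configs_def)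
  have "W (rs @ rounds n qs) Z = W (rs @ rounds n qs) ?C + md ?C Z" if Z: "Z \<in> conf" for Z
  proof (rule antisym)
    show "W (rs @ rounds n qs) Z \<le> W (rs @ rounds n qs) ?C + md ?C Z"
      by (rule W_lip[OF sub(1) C Z])
    have cov: "W (rs @ rounds n qs) ?C = W rs ?C"
      by (rule W_cover[OF sub(1) C]) (use set_rounds[of n qs] in auto)
    have "min (W rs ?C + md ?C Z) (W rs ?C + matching_dist (shrunk \<delta>) ?C Z - e + real n * \<delta>)
      \<le> W (rs @ rounds n qs) Z"
    proof (rule W_rounds[where gf = "\<lambda>Z. W rs ?C + md ?C Z"
          and gs = "\<lambda>Z. W rs ?C + matching_dist (shrunk \<delta>) ?C Z - e"])
      fix V assume V: "V \<in> conf"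
      have "matching_dist (shrunk \<delta>) ?C V \<le> md ?C V"
        by (rule shrunk_le_md[OF C V]) (use assms(2) in \<open>auto simp: isolated_def\<close>)
      then show "min (W rs ?C + md ?C V) (W rs ?C + matching_dist (shrunk \<delta>) ?C V - e) \<le> W rs V"
        using lb[OF V] by linarith
    next
      show "W rs ?C + md ?C V \<le> W rs ?C + md ?C U + md U V" if "U \<in> conf" "V \<in> conf" for U V
        using md_tri[OF C that] by simp
      show "W rs ?C + matching_dist (shrunk \<delta>) ?C V - e
        \<le> W rs ?C + matching_dist (shrunk \<delta>) ?C U - e + matching_dist (shrunk \<delta>) U V"
        if "U \<in> conf" "V \<in> conf" for U V
        using shrunk_tri[OF C that] by simp
    next
      fix V assume V: "V \<in> conf" "set qs \<subseteq> set_mset V"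
      then have "V = ?C" using full_config assms(3) by blast
      then show "W rs ?C + md ?C V \<le> W rs V" using md_self[OF C] by simp
    qed (use assms Z in auto)
    then show "W (rs @ rounds n qs) ?C + md ?C Z \<le> W (rs @ rounds n qs) Z"
      unfolding cov using md_le_shrunk[OF C Z, of \<delta>] n by linarith
  qed
  then show ?thesis using sat_full_iff[OF _ assms(3) sub(2) sub(1)] by auto
qed

text \<open>
  With \<open>j\<close> servers on the \<open>j + 1\<close> points of \<open>Q\<close>, at most one request in \<open>j\<close> costs \<open>\<delta>\<close>.
  \<open>H\<close> is the set of holes whose work function value is still at the current minimal level.
\<close>

lemma W_one_hole:
  assumes "finite Q" "card Q = Suc j" "0 < j" "size Z + j = k" "set_mset Z \<subseteq> P" "Q \<subseteq> P"
    and \<delta>: "0 \<le> \<delta>" "\<And>x y. x \<in> Q \<Longrightarrow> y \<in> Q \<Longrightarrow> d x y \<le> \<delta>"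
    and "set rs \<subseteq> P" "set ns \<subseteq> Q" "q0 \<in> Q" "W rs (Z + mset_set (Q - {q0})) \<le> b" "q \<in> Q"
  shows "W (rs @ ns) (Z + mset_set (Q - {q})) \<le> b + \<delta> * (real (length ns) / real j + 3)"
proof -
  define Y where "Y q = Z + mset_set (Q - {q})" for q
  have Y: "Y q \<in> conf" if "q \<in> Q" for q
    using assms(1,2,4-6) that by (auto simp: Y_def configs_def)
  have Yd: "md (Y p) (Y q) \<le> \<delta>" if "p \<in> Q" "q \<in> Q" for p q
  proof (cases "p = q")
    case True
    then show ?thesis using md_self[OF Y[OF that(1)]] \<delta>(1) by simp
  next
    case False
    define E where "E = Z + mset_set (Q - {p, q})"
    have "Y p = E + {#q#}" "Y q = E + {#p#}"
    proof -
      define F where "F = Q - {p, q}"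
      have "Q - {p} = insert q F" "Q - {q} = insert p F" "finite F" "p \<notin> F" "q \<notin> F"
        using that False assms(1) by (auto simp: F_def)
      then show "Y p = E + {#q#}" "Y q = E + {#p#}" by (simp_all add: Y_def E_def flip: F_def)
    qed
    moreover have "md (E + {#q#}) (E + {#p#}) \<le> md E E + md {#q#} {#p#}"
      by (rule matching_dist_union) auto
    moreover have "md E E \<le> 0"
      by (rule matching_dist_self_le) (use assms(1,5,6) d_self in \<open>auto simp: E_def\<close>)
    moreover have "md {#q#} {#p#} \<le> \<delta>"
      using matching_dist_le_const[of "{#q#}" "{#p#}" d \<delta>] \<delta>(2) that by auto
    ultimately show ?thesis by simp
  qed
  \<comment> \<open>\<open>l\<close> counts the levels passed, each of height
    \<open>\<delta>\<close>. A level starts with at least \<open>j\<close> holes in \<open>H\<close>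
    and a request removes at most one of them, so a level lasts at least \<open>j\<close> requests;
    the last conjunct records this. The extra \<open>\<delta>\<close> next to \<open>b\<close> is
    for moving from the hole \<open>q0\<close> to any other hole.\<close>
  have "\<exists>l H. H \<subseteq> Q \<and> H \<noteq> {} \<and> (\<forall>q\<in>H. W (rs @ ns) (Y q) \<le> b + \<delta> + real l * \<delta>) \<and>
      (\<forall>q\<in>Q. W (rs @ ns) (Y q) \<le> b + \<delta> + real l * \<delta> + \<delta>) \<and> l * j + (Suc j - card H) \<le> Suc (length ns)"
    using assms(10)
  proof (induction ns rule: rev_induct)
    case Nil
    have "W rs (Y q) \<le> b + \<delta>" if "q \<in> Q" for q
      using W_lip[OF assms(9) Y[OF assms(11)] Y[OF that]] Yd[OF assms(11) that] assms(12)
      by (simp add: Y_def)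
    then have "\<forall>q\<in>Q. W rs (Y q) \<le> b + \<delta> + real 0 * \<delta>"
      "\<forall>q\<in>Q. W rs (Y q) \<le> b + \<delta> + real 0 * \<delta> + \<delta>"
      using \<delta>(1) by fastforce+
    moreover have "Q \<noteq> {}" "0 * j + (Suc j - card Q) \<le> Suc (length [])" using assms(2,11) by auto
    ultimately show ?case
      unfolding append_Nil2 by (intro exI[of _ 0] exI[of _ Q] conjI subset_refl)
  next
    case (snoc r ns)
    then obtain l H where H: "H \<subseteq> Q" "H \<noteq> {}" "\<forall>q\<in>H. W (rs @ ns) (Y q) \<le> b + \<delta> + real l * \<delta>"
      "\<forall>q\<in>Q. W (rs @ ns) (Y q) \<le> b + \<delta> + real l * \<delta> + \<delta>" "l * j + (Suc j - card H) \<le> Suc (length ns)"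
      by auto
    have sub: "set (rs @ ns) \<subseteq> P" "r \<in> Q" "set ((rs @ ns) @ [r]) \<subseteq> P"
      using snoc.prems assms(6,9) by auto
    have finH: "finite H" using H(1) assms(1) finite_subset by blast
    \<comment> \<open>A configuration whose hole is not \<open>r\<close> covers the request, so one
      request changes the value of one hole only.\<close>
    have same: "W (rs @ ns @ [r]) (Y q) = W (rs @ ns) (Y q)" if "q \<in> Q" "q \<noteq> r" for q
    proof -
      have rY: "set [r] \<subseteq> set_mset (Y q)" using sub(2) that assms(1) by (auto simp: Y_def)
      show ?thesis using W_cover[OF sub(3) Y[OF that(1)] rY] by simp
    qed
    have r: "W (rs @ ns @ [r]) (Y r) \<le> W (rs @ ns) (Y q) + \<delta>" if "q \<in> Q" "q \<noteq> r" for q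
    proof -
      have rY: "set [r] \<subseteq> set_mset (Y q)" using sub(2) that assms(1) by (auto simp: Y_def)
      have "W ((rs @ ns) @ [r]) (Y r) \<le> W (rs @ ns) (Y q) + md (Y q) (Y r)"
        by (rule W_via[OF _ Y[OF that(1)] rY Y[OF sub(2)]]) (use sub(3) in simp)
      then show ?thesis using Yd[OF that(1) sub(2)] by simp
    qed
    show ?case
    proof (cases "H = {r}")
      case False
      then obtain q' where q': "q' \<in> H" "q' \<noteq> r" using H(2) by blast
      have "W (rs @ ns) (Y q') \<le> b + \<delta> + real l * \<delta>" using H(3) q'(1) by blast
      then have "W (rs @ ns @ [r]) (Y r) \<le> b + \<delta> + real l * \<delta> + \<delta>"
        using r[of q'] q' H(1) by fastforce
      then have "\<forall>q\<in>Q. W (rs @ ns @ [r]) (Y q) \<le> b + \<delta> + real l * \<delta> + \<delta>"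
      proof (intro ballI)
        fix q assume "q \<in> Q" "W (rs @ ns @ [r]) (Y r) \<le> b + \<delta> + real l * \<delta> + \<delta>"
        then show "W (rs @ ns @ [r]) (Y q) \<le> b + \<delta> + real l * \<delta> + \<delta>"
          using same[of q] H(4) by (cases "q = r") auto
      qed
      moreover have "\<forall>q\<in>H - {r}. W (rs @ ns @ [r]) (Y q) \<le> b + \<delta> + real l * \<delta>"
      proof (intro ballI)
        fix q assume "q \<in> H - {r}"
        then show "W (rs @ ns @ [r]) (Y q) \<le> b + \<delta> + real l * \<delta>"
          using same[of q] H(1,3) by auto
      qed
      moreover have "card H \<le> Suc (card (H - {r}))" using finH card_Diff_singleton_if[of H r] by auto
      then have "l * j + (Suc j - card (H - {r})) \<le> Suc (length (ns @ [r]))" using H(5) by simp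
      moreover have "H - {r} \<subseteq> Q" "H - {r} \<noteq> {}" using H(1) q' by auto
      ultimately show ?thesis by (intro exI[of _ l] exI[of _ "H - {r}"] conjI)
    next
      case True
      have 1: "card (Q - {r}) = j" using assms(2) sub(2) assms(1) by simp
      then have ne: "Q - {r} \<noteq> {}" using assms(3) by (metis card.empty less_irrefl)
      then obtain q' where q': "q' \<in> Q" "q' \<noteq> r" by blast
      have c1: "W (rs @ ns @ [r]) (Y r) \<le> b + \<delta> + real (Suc l) * \<delta> + \<delta>"
      proof -
        have "W (rs @ ns) (Y q') \<le> b + \<delta> + real l * \<delta> + \<delta>" using H(4) q'(1) by blast
        then show ?thesis using r[OF q'] by (simp add: distrib_right)
      qed
      have c2: "W (rs @ ns @ [r]) (Y q) \<le> b + \<delta> + real (Suc l) * \<delta>" if "q \<in> Q" "q \<noteq> r" for q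
      proof -
        have "W (rs @ ns) (Y q) \<le> b + \<delta> + real l * \<delta> + \<delta>" using H(4) that(1) by blast
        then show ?thesis using same[OF that] by (simp add: distrib_right)
      qed
      have "\<forall>q\<in>Q. W (rs @ ns @ [r]) (Y q) \<le> b + \<delta> + real (Suc l) * \<delta> + \<delta>"
        "\<forall>q\<in>Q - {r}. W (rs @ ns @ [r]) (Y q) \<le> b + \<delta> + real (Suc l) * \<delta>"
      proof -
        show "\<forall>q\<in>Q. W (rs @ ns @ [r]) (Y q) \<le> b + \<delta> + real (Suc l) * \<delta> + \<delta>"
        proof
          fix q assume "q \<in> Q"
          then show "W (rs @ ns @ [r]) (Y q) \<le> b + \<delta> + real (Suc l) * \<delta> + \<delta>"
            using c1 c2[of q] \<delta>(1) by (cases "q = r") auto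
        qed
        show "\<forall>q\<in>Q - {r}. W (rs @ ns @ [r]) (Y q) \<le> b + \<delta> + real (Suc l) * \<delta>"
          using c2 by auto
      qed
      moreover have "Suc l * j + (Suc j - card (Q - {r})) \<le> Suc (length (ns @ [r]))"
        using H(5) True 1 by simp
      ultimately show ?thesis using ne by (intro exI[of _ "Suc l"] exI[of _ "Q - {r}"] conjI Diff_subset)
    qed
  qed
  then obtain l and H :: "'p set" where lH: "\<forall>q\<in>Q. W (rs @ ns) (Y q) \<le> b + \<delta> + real l * \<delta> + \<delta>"
    "l * j + (Suc j - card H) \<le> Suc (length ns)" by blast
  have *: "W (rs @ ns) (Y q) \<le> b + \<delta> + real l * \<delta> + \<delta>" using lH(1) assms(13) by (rule bspec)
  have "real (l * j) \<le> real (Suc (length ns))" using lH(2) by (intro of_nat_mono) simp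
  then have "real l * real j \<le> real (length ns) + 1" by simp
  then have "real l \<le> (real (length ns) + 1) / real j" using assms(3) by (simp add: pos_le_divide_eq)
  also have "\<dots> \<le> real (length ns) / real j + 1" using assms(3) by (simp add: add_divide_distrib)
  finally have "\<delta> * real l \<le> \<delta> * (real (length ns) / real j + 1)" using \<delta>(1) mult_left_mono by blast
  with * show ?thesis by (simp add: Y_def algebra_simps)
qed

text \<open>Applying \<open>g\<close> to every configuration of a schedule keeps it serving
  \<open>\<rho>\<close> and does not make it more expensive.\<close>

lemma W_retract:
  assumes "set (rs @ \<rho>) \<subseteq> P" "\<And>x. x \<in> P \<Longrightarrow> g x \<in> P"
    "\<And>x y. x \<in> P \<Longrightarrow> y \<in> P \<Longrightarrow> d (g x) (g y) \<le> d x y" "\<And>r. r \<in> set \<rho> \<Longrightarrow> g r = r"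
    "\<And>Z. Z \<in> conf \<Longrightarrow> W rs (image_mset g Z) \<le> W rs Z" "Z \<in> conf"
  shows "W (rs @ \<rho>) (image_mset g Z) \<le> W (rs @ \<rho>) Z"
  using assms(1,4,6)
proof (induction \<rho> arbitrary: Z rule: rev_induct)
  case (snoc r \<rho>)
  have g: "image_mset g Z \<in> conf" if "Z \<in> conf" for Z
    using that assms(2) by (auto simp: configs_def)
  have "W ((rs @ \<rho>) @ [r]) (image_mset g Z) \<le> W ((rs @ \<rho>) @ [r]) Z"
  proof (rule W_step_ge)
    fix V assume V: "V \<in> conf" "r \<in># V"
    have "r \<in># image_mset g V" using V(2) snoc.prems(2)[of r] by force
    then have "W ((rs @ \<rho>) @ [r]) (image_mset g Z) \<le> W (rs @ \<rho>) (image_mset g V) + md (image_mset g V) (image_mset g Z)"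
      using snoc.prems by (intro W_step_le g V) auto
    moreover have "W (rs @ \<rho>) (image_mset g V) \<le> W (rs @ \<rho>) V"
      by (rule snoc.IH) (use snoc.prems V in auto)
    moreover have "md (image_mset g V) (image_mset g Z) \<le> md V Z"
    proof (rule matching_dist_image_le)
      show "size V = size Z" using V(1) snoc.prems(3) by (simp add: configs_def)
      show "d (g x) (g y) \<le> d x y" if "x \<in># V" "y \<in># Z" for x y
        using assms(3) configs_memD[OF V(1) that(1)] configs_memD[OF snoc.prems(3) that(2)] by simp
    qed
    ultimately show "W ((rs @ \<rho>) @ [r]) (image_mset g Z) \<le> W (rs @ \<rho>) V + md V Z" by linarith
  qed (use snoc.prems in auto)
  then show ?case by simp
qed (use assms in auto)

end

section \<open>The Work Function Algorithm\<close>

locale wfa = bounded_ultrametric P d D for P :: "'p set" and d D +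
  fixes k :: nat and alg :: "'p list \<Rightarrow> 'p multiset"
  assumes k_pos: "0 < k" and wfa: "is_wfa P d k alg"
begin

sublocale work_function P d D k "alg []"
  by unfold_locales (use k_pos wfa in \<open>auto simp: is_wfa_def\<close>)

abbreviation cost :: "'p list \<Rightarrow> real" where "cost \<equiv> alg_cost d alg"

lemma alg_conf: "set rs \<subseteq> P \<Longrightarrow> alg rs \<in> conf"
proof (induction rs rule: rev_induct)
  case (snoc r rs)
  then show ?case using wfa unfolding is_wfa_def is_arg_min_def
    by (cases "r \<in># alg rs") auto
qed (use A0 in auto)

lemma alg_stay: "set (rs @ [r]) \<subseteq> P \<Longrightarrow> r \<in># alg rs \<Longrightarrow> alg (rs @ [r]) = alg rs"
  using wfa unfolding is_wfa_def by auto

lemma alg_serves: "set (rs @ [r]) \<subseteq> P \<Longrightarrow> r \<in># alg (rs @ [r])"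
  using wfa unfolding is_wfa_def is_arg_min_def by (cases "r \<in># alg rs") auto

text \<open>Holds also for a request that is already covered: the algorithm then stays, and by
  \<open>W_lip\<close> staying is minimal.\<close>

lemma alg_min:
  assumes "set (rs @ [r]) \<subseteq> P" "Y \<in> conf" "r \<in># Y"
  shows "W (rs @ [r]) (alg (rs @ [r])) + md (alg rs) (alg (rs @ [r]))
    \<le> W (rs @ [r]) Y + md (alg rs) Y"
proof (cases "r \<in># alg rs")
  case True
  have A: "alg rs \<in> conf" using alg_conf assms by auto
  show ?thesis
    using alg_stay[OF assms(1) True] md_self[OF A] W_lip[OF assms(1,2) A] md_sym[OF A assms(2)] by simp
next
  case False
  then have "is_arg_min (\<lambda>X. W (rs @ [r]) X + md (alg rs) X) (\<lambda>X. X \<in> conf \<and> r \<in># X) (alg (rs @ [r]))"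
    using wfa assms(1) unfolding is_wfa_def W_def by auto
  then show ?thesis using assms(2,3) by (auto simp: is_arg_min_linorder)
qed

lemma cost_snoc: "cost (rs @ [r]) = cost rs + md (alg rs) (alg (rs @ [r]))"
  unfolding alg_cost_def by (auto intro!: sum.cong)

lemma cost_append:
  assumes "set (rs @ \<rho>) \<subseteq> P"
  shows "cost rs + md (alg rs) (alg (rs @ \<rho>)) \<le> cost (rs @ \<rho>)"
  using assms
proof (induction \<rho> rule: rev_induct)
  case Nil
  then show ?case using md_self[OF alg_conf] by auto
next
  case (snoc r \<rho>)
  then show ?case
    using cost_snoc[of "rs @ \<rho>" r] md_tri[of "alg rs" k "alg (rs @ \<rho>)" "alg (rs @ \<rho> @ [r])"] alg_conf
    by auto
qed

text \<open>
  Once the work function is saturated on \<open>Q\<close>, requests in \<open>Q\<close> no longer change it, so every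
  move lowers its value at the current configuration by the distance moved.
\<close>

lemma descent:
  assumes "sat Q rs" "set rs \<subseteq> P" "isolated \<delta> Q" "finite Q" "card Q \<le> k"
  shows "\<exists>\<rho>. set \<rho> \<subseteq> Q \<and> length \<rho> \<le> k \<and> Q \<subseteq> set_mset (alg (rs @ \<rho>))"
proof (rule ccontr)
  assume no: "\<not> ?thesis"
  have QP: "Q \<subseteq> P" using assms(3) by (auto simp: isolated_def)
  \<comment> \<open>Each request at an uncovered point lowers the value by at least
    \<open>\<delta>\<close> more than the shrunk distance moved. By \<open>W_lip\<close> the total
    drop is at most the shrunk distance plus \<open>k * \<delta>\<close>, so \<open>k + 1\<close>
    such requests are impossible. The bound on the length limits what the adversary pays in
    \<open>full_phase\<close>.\<close>
  have "\<exists>\<rho>. set \<rho> \<subseteq> Q \<and> length \<rho> = n \<and>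
      W rs (alg (rs @ \<rho>)) + real n * \<delta> + matching_dist (shrunk \<delta>) (alg rs) (alg (rs @ \<rho>)) \<le> W rs (alg rs)"
    if "n \<le> Suc k" for n
    using that
  proof (induction n)
    case 0
    have "0 \<le> \<delta>" using assms(3) by (auto simp: isolated_def)
    then show ?case using shrunk_self[OF alg_conf[OF assms(2)]] by (intro exI[of _ "[]"]) auto
  next
    case (Suc n)
    then obtain \<rho> where \<rho>: "set \<rho> \<subseteq> Q" "length \<rho> = n"
      "W rs (alg (rs @ \<rho>)) + real n * \<delta> + matching_dist (shrunk \<delta>) (alg rs) (alg (rs @ \<rho>)) \<le> W rs (alg rs)"
      by auto
    then obtain r where r: "r \<in> Q" "r \<notin># alg (rs @ \<rho>)" using no Suc.prems by fastforce
    let ?A = "alg (rs @ \<rho>)" and ?X = "alg (rs @ \<rho> @ [r])"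
    have sub: "set (rs @ \<rho>) \<subseteq> P" "set ((rs @ \<rho>) @ [r]) \<subseteq> P" using \<rho> r QP assms(2) by auto
    then have A: "?A \<in> conf" "?X \<in> conf" "alg rs \<in> conf" using alg_conf assms(2) by auto
    have Wn: "W (rs @ \<rho> @ [r]) V = W rs V" if "V \<in> conf" for V
      using sat_stable[OF assms(1) _ _ that, of "\<rho> @ [r]"] sub \<rho> r by auto
    have "W rs ?X + md ?A ?X \<le> W rs ?A"
    proof (rule satD[OF assms(1) A(1)])
      fix V assume V: "V \<in> conf" "Q \<subseteq> set_mset V"
      show "W rs ?X + md ?A ?X \<le> W rs V + md V ?A"
        using alg_min[OF sub(2) V(1)] V r Wn[OF V(1)] Wn[OF A(2)] md_sym[OF A(1) V(1)] by auto
    qed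
    moreover have "matching_dist (shrunk \<delta>) ?A ?X + \<delta> \<le> md ?A ?X"
      using shrunk_add_le_md[OF A(1,2) assms(3) r(1)] alg_serves[OF sub(2)] r(2) by auto
    moreover have "matching_dist (shrunk \<delta>) (alg rs) ?X
      \<le> matching_dist (shrunk \<delta>) (alg rs) ?A + matching_dist (shrunk \<delta>) ?A ?X"
      by (rule shrunk_tri[OF A(3,1,2)])
    ultimately have "W rs ?X + real (Suc n) * \<delta> + matching_dist (shrunk \<delta>) (alg rs) ?X \<le> W rs (alg rs)"
      using \<rho>(3) by (simp add: distrib_right)
    then show ?case using \<rho> r by (intro exI[of _ "\<rho> @ [r]"]) auto
  qed
  then obtain \<rho> where \<rho>: "set \<rho> \<subseteq> Q" "length \<rho> = Suc k"
    "W rs (alg (rs @ \<rho>)) + real (Suc k) * \<delta> + matching_dist (shrunk \<delta>) (alg rs) (alg (rs @ \<rho>)) \<le> W rs (alg rs)"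
    by blast
  have "set (rs @ \<rho>) \<subseteq> P" using \<rho> QP assms(2) by auto
  then have A: "alg (rs @ \<rho>) \<in> conf" "alg rs \<in> conf" using alg_conf assms(2) by auto
  have "real (Suc k) * \<delta> \<le> real k * \<delta>"
    using \<rho>(3) W_lip[OF assms(2) A] md_sym[OF A] md_le_shrunk[OF A(2,1), of \<delta>] by linarith
  then show False using assms(3) by (auto simp: isolated_def distrib_right)
qed

end

section \<open>Matchings between clusters\<close>

lemma submultiset_ex:
  assumes "n \<le> size M" shows "\<exists>N. N \<subseteq># M \<and> size N = n"
proof -
  obtain xs where xs: "mset xs = M" by (meson ex_mset)
  have "mset (take n xs) \<subseteq># M"
    using xs by (metis append_take_drop_id mset_append mset_subset_eq_add_left)
  then show ?thesis using assms xs by (intro exI[of _ "mset (take n xs)"]) auto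
qed

lemma filter_mset_split: "{#x \<in># A. x \<in> R#} + {#x \<in># A. x \<notin> R#} = A"
  by simp

lemma size_filter_cnt: "size {#x \<in># A. x \<in> R#} = cnt R A" "size {#x \<in># A. x \<notin> R#} = size A - cnt R A"
proof -
  show 1: "size {#x \<in># A. x \<in> R#} = cnt R A" by (simp add: cnt_def)
  have "size A = size {#x \<in># A. x \<in> R#} + size {#x \<in># A. x \<notin> R#}"
    by (subst filter_mset_split[of R A, symmetric]) (simp only: size_union)
  with 1 show "size {#x \<in># A. x \<notin> R#} = size A - cnt R A" by simp
qed

context bounded_ultrametric
begin

text \<open>The surplus of \<open>B\<close> in \<open>U\<close> is matched to servers of
  \<open>A\<close> outside \<open>U\<close>; everything else is matched inside its own
  cluster.\<close>

lemma md_two_clusters: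
  assumes "size A = size B" "set_mset A \<subseteq> U \<union> V" "set_mset B \<subseteq> U \<union> V"
    and \<eta>: "\<And>x y. x \<in> U \<Longrightarrow> y \<in> U \<Longrightarrow> d x y \<le> \<eta>" "\<And>x y. x \<in> V \<Longrightarrow> y \<in> V \<Longrightarrow> d x y \<le> \<eta>"
    and \<Delta>: "\<And>x y. x \<in> U \<union> V \<Longrightarrow> y \<in> U \<union> V \<Longrightarrow> d x y \<le> \<Delta>"
    and "cnt U A \<le> cnt U B" "0 \<le> \<eta>"
  shows "md A B \<le> (real (cnt U B) - real (cnt U A)) * \<Delta> + real (size A) * \<eta>"
proof -
  let ?AU = "{#x \<in># A. x \<in> U#}" and ?AV = "{#x \<in># A. x \<notin> U#}"
  let ?BU = "{#x \<in># B. x \<in> U#}" and ?BV = "{#x \<in># B. x \<notin> U#}"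
  let ?q = "cnt U B - cnt U A"
  have "?q \<le> size ?AV" using assms(1) cnt_le_size[of U B] by (simp add: size_filter_cnt)
  then obtain A1 where A1: "A1 \<subseteq># ?AV" "size A1 = ?q" using submultiset_ex by blast
  obtain B1 where B1: "B1 \<subseteq># ?BU" "size B1 = ?q"
    using submultiset_ex[of ?q ?BU] by (auto simp: size_filter_cnt)
  obtain A2 where A2: "?AV = A1 + A2" using A1(1) by (metis subset_mset.le_iff_add)
  obtain B2 where B2: "?BU = B1 + B2" using B1(1) by (metis subset_mset.le_iff_add)
  have sB2: "size B2 = cnt U A"
    using arg_cong[OF B2, of size] B1(2) assms(7) by (simp add: size_filter_cnt)
  have sA2: "size A2 = size ?BV"
    using arg_cong[OF A2, of size] A1(2) assms(1,7) cnt_le_size[of U B] by (simp add: size_filter_cnt)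
  have A: "A = A1 + (?AU + A2)" using filter_mset_split[of U A] A2 by (metis union_commute union_lcomm)
  have B: "B = B1 + (B2 + ?BV)" using filter_mset_split[of U B] B2 by (metis union_assoc)
  have in1: "x \<in> U \<union> V" if "x \<in># A1" for x using that A assms(2) by (metis UnCI set_mset_union subsetD)
  have in2: "x \<in> U \<union> V" if "x \<in># B1" for x using that B assms(3) by (metis UnCI set_mset_union subsetD)
  have in3: "x \<in> U" if "x \<in># B2" for x
    using that B2 by (metis (mono_tags, lifting) mem_Collect_eq set_mset_filter set_mset_union UnCI)
  have in4: "x \<in> V" if "x \<in># A2" for x
  proof -
    have "x \<in># ?AV" using that unfolding A2 by simp
    then show ?thesis using assms(2) by auto
  qed
  have "md A B \<le> md A1 B1 + (md ?AU B2 + md A2 ?BV)"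
    by (subst A, subst B) (use A1 B1 sB2 sA2 in \<open>intro order_trans[OF matching_dist_union] add_left_mono matching_dist_union; simp add: size_filter_cnt\<close>)
  moreover have "md A1 B1 \<le> real (size A1) * \<Delta>"
    by (rule matching_dist_le_const) (use A1 B1 \<Delta> in1 in2 in auto)
  moreover have "md ?AU B2 \<le> real (size ?AU) * \<eta>"
    by (rule matching_dist_le_const) (use sB2 \<eta>(1) in3 in \<open>auto simp: size_filter_cnt\<close>)
  moreover have "md A2 ?BV \<le> real (size A2) * \<eta>"
    by (rule matching_dist_le_const) (use sA2 \<eta>(2) in4 assms(3) in auto)
  moreover have "real (size ?AU) * \<eta> + real (size A2) * \<eta> \<le> real (size A) * \<eta>"
  proof -
    have "size ?AU + size A2 \<le> size A" using arg_cong[OF A, of size] unfolding size_union by linarith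
    then have "real (size ?AU) + real (size A2) \<le> real (size A)" by linarith
    then show ?thesis using assms(8) by (metis distrib_right mult_right_mono)
  qed
  moreover have "real (size A1) = real (cnt U B) - real (cnt U A)" using A1(2) assms(7) by simp
  ultimately show ?thesis by simp
qed

text \<open>Equal counts mean equally many pairs entering and leaving \<open>R\<close>. One of each
  could be rematched at cost at most \<open>D + \<rho>\<close> instead of \<open>2 * D\<close>, so
  an optimal matching has neither.\<close>

lemma md_split:
  assumes "A \<in> configs P n" "B \<in> configs P n" "cnt R A = cnt R B"
    and "\<And>x y. x \<in> R \<Longrightarrow> y \<in> P \<Longrightarrow> y \<notin> R \<Longrightarrow> d x y = D"
    and "\<And>x y. x \<in> R \<Longrightarrow> y \<in> R \<Longrightarrow> d x y \<le> \<rho>" "\<rho> < D"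
  shows "md {#x \<in># A. x \<in> R#} {#x \<in># B. x \<in> R#} + md {#x \<in># A. x \<notin> R#} {#x \<in># B. x \<notin> R#} \<le> md A B"
proof -
  have sz: "size A = size B" using assms by (simp add: configs_def)
  obtain M where M: "M \<in> matchings A B" "md A B = mcost d M"
    using matching_dist_attained[OF sz] by blast
  have Mf: "image_mset fst M = A" "image_mset snd M = B" using M(1) by (auto simp: matchings_def)
  have inP: "fst p \<in> P \<and> snd p \<in> P" if "p \<in># M" for p
    using that matchings_mem[OF M(1), of "fst p" "snd p"] assms(1,2) configs_memD by auto
  let ?in = "{#p \<in># M. fst p \<notin> R \<and> snd p \<in> R#}" and ?out = "{#p \<in># M. fst p \<in> R \<and> snd p \<notin> R#}"
  let ?RR = "{#p \<in># M. fst p \<in> R \<and> snd p \<in> R#}" and ?OO = "{#p \<in># M. fst p \<notin> R \<and> snd p \<notin> R#}"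
  have cA: "cnt R A = size {#p \<in># M. fst p \<in> R#}" and cB: "cnt R B = size {#p \<in># M. snd p \<in> R#}"
    unfolding cnt_def Mf[symmetric] by (simp_all add: filter_mset_image_mset)
  have 1: "size {#p \<in># M. fst p \<in> R#} = size ?RR + size ?out"
    by (subst multiset_partition[of _ "\<lambda>p. snd p \<in> R"]) (simp add: filter_filter_mset conj_commute)
  have 2: "size {#p \<in># M. snd p \<in> R#} = size ?RR + size ?in"
    by (subst multiset_partition[of _ "\<lambda>p. fst p \<in> R"]) (simp add: filter_filter_mset conj_commute)
  have eq: "size ?in = size ?out" using assms(3) cA cB 1 2 by linarith
  have none: "?in = {#} \<and> ?out = {#}"
  proof (rule ccontr)
    assume "\<not> ?thesis"
    then have "?in \<noteq> {#}" "?out \<noteq> {#}" using eq by (simp_all only: size_eq_0_iff_empty[symmetric] conj_absorb not_False_eq_True)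
    then obtain p q where pq: "p \<in># ?in" "q \<in># ?out" by (meson multiset_nonemptyE)
    obtain b x where p: "p = (b, x)" by (cases p)
    obtain c y where q: "q = (c, y)" by (cases q)
    have R: "b \<notin> R" "x \<in> R" "c \<in> R" "y \<notin> R" "(b, x) \<in># M" "(c, y) \<in># M" using pq p q by auto
    have inP4: "b \<in> P" "x \<in> P" "c \<in> P" "y \<in> P" using inP[OF R(5)] inP[OF R(6)] by auto
    obtain M' where M': "M = add_mset (b, x) M'" using R(5) by (meson multi_member_split)
    then have "(c, y) \<in># M'" using R by auto
    then have "{#(b, x), (c, y)#} \<subseteq># M" by (simp add: M')
    from optimal_matching_swap[OF M this] have "d b x + d c y \<le> d b y + d c x" .
    moreover have "d b x = D" using assms(4)[OF R(2) inP4(1) R(1)] d_sym inP4 by simp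
    moreover have "d c y = D" using assms(4)[OF R(3) inP4(4) R(4)] .
    moreover have "d b y \<le> D" using d_le_D inP4 by simp
    moreover have "d c x \<le> \<rho>" using assms(5) R by simp
    ultimately show False using assms(6) by linarith
  qed
  have fstsnd: "(fst p \<in> R) = (snd p \<in> R)" if "p \<in># M" for p
  proof -
    have "p \<notin># ?in" "p \<notin># ?out" using none by (simp_all only: set_mset_empty empty_iff not_False_eq_True)
    then show ?thesis using that by auto
  qed
  have fs: "(x \<in> R) = (y \<in> R)" if "(x, y) \<in># M" for x y using fstsnd[OF that] by simp
  let ?MR = "{#p \<in># M. fst p \<in> R#}" and ?MO = "{#p \<in># M. fst p \<notin> R#}"
  have "?MR \<in> matchings {#x \<in># A. x \<in> R#} {#x \<in># B. x \<in> R#}"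
    unfolding matchings_def Mf[symmetric]
    by (auto simp: filter_mset_image_mset dest: fs intro!: arg_cong[where f = "image_mset snd"] filter_mset_cong)
  moreover have "?MO \<in> matchings {#x \<in># A. x \<notin> R#} {#x \<in># B. x \<notin> R#}"
    unfolding matchings_def Mf[symmetric]
    by (auto simp: filter_mset_image_mset dest: fs intro!: arg_cong[where f = "image_mset snd"] filter_mset_cong)
  moreover have "mcost d M = mcost d ?MR + mcost d ?MO"
    by (subst multiset_partition[of M "\<lambda>p. fst p \<in> R"]) (simp only: image_mset_union sum_mset.union)
  ultimately show ?thesis using matching_dist_le[of ?MR _ _ d] matching_dist_le[of ?MO _ _ d] M(2) by fastforce
qed

end

subsection \<open>Spaces with two sides\<close>

text \<open>
  \<open>S a b\<close> is the star number \<open>b\<close> on side \<open>a\<close>; leaves of a star have mutual distance \<open>\<delta>\<close>,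
  the two stars of a side have distance \<open>m\<close>, and all points outside a side have distance \<open>D\<close>
  to it, including the points that belong to neither side.
\<close>

locale two_sided_space = bounded_ultrametric P d D
  for P :: "'p set" and d D +
  fixes S :: "bool \<Rightarrow> bool \<Rightarrow> 'p set" and h \<kappa> \<mu> :: nat and m \<delta> :: real
  assumes h_pos: "0 < h" and S_sub: "S a b \<subseteq> P" and card_S: "card (S a b) = h"
    and S_sides: "S a b \<inter> S (\<not> a) c = {}"
    and \<delta>_pos: "0 < \<delta>" and m_def: "m = real \<kappa> * \<delta>" and D_def: "D = real \<mu> * m"
    and \<kappa>_ge: "h + 5 \<le> \<kappa>" and \<mu>_ge: "4 * h + 4 \<le> \<mu>"
    and d_star: "x \<in> S a b \<Longrightarrow> y \<in> S a b \<Longrightarrow> x \<noteq> y \<Longrightarrow> d x y = \<delta>"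
    and d_stars: "x \<in> S a b \<Longrightarrow> y \<in> S a (\<not> b) \<Longrightarrow> d x y = m"
    and d_sides: "x \<in> S a b \<Longrightarrow> y \<in> P \<Longrightarrow> y \<notin> S a True \<Longrightarrow> y \<notin> S a False \<Longrightarrow> d x y = D"
begin

definition side :: "bool \<Rightarrow> 'p set" where "side a = S a True \<union> S a False"

lemma side_eq: "side a = S a b \<union> S a (\<not> b)"
  unfolding side_def by (cases b) auto

lemma S_side: "S a b \<subseteq> side a" by (auto simp: side_eq[of a b])

lemma side_sub: "side a \<subseteq> P" using S_sub by (auto simp: side_def)

lemma sides_disj: "side a \<inter> side (\<not> a) = {}"
  using S_sides by (fastforce simp: side_def)

lemma m_pos: "0 < m" using \<delta>_pos \<kappa>_ge by (simp add: m_def)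
lemma \<delta>_le_m: "\<delta> \<le> m" using \<delta>_pos \<kappa>_ge by (simp add: m_def)
lemma D_ge: "(4 * real h + 4) * m \<le> D"
proof -
  have "4 * real h + 4 \<le> real \<mu>" using \<mu>_ge by linarith
  then show ?thesis unfolding D_def using m_pos by simp
qed
lemma m_less_D: "m < D"
proof -
  have "0 \<le> 4 * real h * m" using m_pos by simp
  moreover have "4 * real h * m + 4 * m \<le> D" using D_ge by (simp add: distrib_right)
  ultimately show ?thesis using m_pos by linarith
qed
lemma m_le_D: "m \<le> D" using m_less_D by simp

lemma D_pos: "0 < D" using m_pos m_le_D by simp

lemma finite_S: "finite (S a b)" using card_S h_pos by (metis card_ge_0_finite)

lemma finite_side: "finite (side a)" using finite_S by (simp add: side_def)

lemma S_disj: "S a b \<inter> S a (\<not> b) = {}"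
proof (rule equals0I)
  fix x assume "x \<in> S a b \<inter> S a (\<not> b)"
  then show False using d_stars[of x a b x] d_self S_sub[of a b] m_pos by auto
qed

lemma card_side: "card (side a) = 2 * h"
  unfolding side_eq[of a True] card_Un_disjoint[OF finite_S finite_S S_disj] card_S by simp

lemma d_in_star: "x \<in> S a b \<Longrightarrow> y \<in> S a b \<Longrightarrow> d x y \<le> \<delta>"
  using d_star[of x a b y] d_self S_sub[of a b] \<delta>_pos by (cases "x = y") auto

lemma d_in_side: assumes "x \<in> side a" "y \<in> side a" shows "d x y \<le> m"
proof -
  obtain b where b: "x \<in> S a b" using assms(1) by (auto simp: side_def)
  then show ?thesis using d_in_star[OF b, of y] d_stars[OF b, of y] \<delta>_le_m assms(2) side_eq[of a b] by force
qed

lemma d_out: "x \<in> side a \<Longrightarrow> y \<in> P \<Longrightarrow> y \<notin> side a \<Longrightarrow> d x y = D"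
  using d_sides unfolding side_def by auto

lemma d_out': "x \<in> side a \<Longrightarrow> y \<in> P \<Longrightarrow> y \<notin> side a \<Longrightarrow> d y x = D"
  using d_out d_sym side_sub by (metis subsetD)

lemma isolated_side: assumes "Q \<subseteq> side a" shows "isolated \<delta> Q"
  unfolding isolated_def
proof (intro conjI ballI impI)
  fix q x assume qx: "q \<in> Q" "x \<in> P" "x \<noteq> q"
  then obtain b where b: "q \<in> S a b" using assms by (auto simp: side_def)
  consider "x \<in> S a b" | "x \<in> S a (\<not> b)" | "x \<notin> side a" using side_eq[of a b] by auto
  then show "\<delta> \<le> d x q"
  proof cases
    case 1 then show ?thesis using d_star[OF 1 b] qx by simp
  next
    case 2 then show ?thesis using d_stars[of x a "\<not> b" q] b \<delta>_le_m by simp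
  next
    case 3 then show ?thesis using d_out'[of q a x] qx assms \<delta>_le_m m_le_D by auto
  qed
qed (use assms side_sub \<delta>_pos in auto)

lemma star_sep: assumes "y \<in> S a b" "x \<in> P" "x \<notin> S a b" shows "m \<le> d x y"
proof (cases "x \<in> side a")
  case True
  then have "x \<in> S a (\<not> b)" using assms(3) side_eq[of a b] by auto
  then show ?thesis using d_stars[of x a "\<not> b" y] assms by simp
next
  case False
  then show ?thesis using d_out'[of y a x] assms S_side m_le_D by (metis subsetD)
qed

lemma md_star_cnt:
  assumes "A \<in> configs P n" "B \<in> configs P n"
  shows "m * (real (cnt (S a b) B) - real (cnt (S a b) A)) \<le> md A B"
proof (rule matching_dist_cnt)
  show "size A = size B" "0 \<le> m" using assms m_pos by (auto simp: configs_def)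
next
  fix x y assume "x \<in># A" "y \<in># B"
  then have "x \<in> P" "y \<in> P" using assms configs_memD by auto
  then show "0 \<le> d x y" "y \<in> S a b \<Longrightarrow> x \<notin> S a b \<Longrightarrow> m \<le> d x y"
    using d_nonneg star_sep by auto
qed

lemma md_side_cnt:
  assumes "A \<in> configs P n" "B \<in> configs P n"
  shows "D * (real (cnt (side a) B) - real (cnt (side a) A)) \<le> md A B"
proof (rule matching_dist_cnt)
  show "size A = size B" "0 \<le> D" using assms D_pos by (auto simp: configs_def)
next
  fix x y assume "x \<in># A" "y \<in># B"
  then have "x \<in> P" "y \<in> P" using assms configs_memD by auto
  then show "0 \<le> d x y" "y \<in> side a \<Longrightarrow> x \<notin> side a \<Longrightarrow> D \<le> d x y"
    using d_nonneg d_out'[of y a x] by auto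
qed

text \<open>The three bounds make the weighted count 1-Lipschitz: crossing the border of the side
  changes it by \<open>\<alpha>\<close> or \<open>\<alpha> + \<beta>\<close>, changing the star by
  \<open>\<beta>\<close>. \<open>sat_linear_bound\<close> propagates linear lower bounds on the work
  function in this way.\<close>

lemma md_linear:
  assumes "A \<in> configs P n" "B \<in> configs P n" "\<bar>\<alpha>\<bar> \<le> D" "\<bar>\<alpha> + \<beta>\<bar> \<le> D" "\<bar>\<beta>\<bar> \<le> m"
  shows "\<alpha> * (real (cnt (side a) B) - real (cnt (side a) A))
    + \<beta> * (real (cnt (S a b) B) - real (cnt (S a b) A)) \<le> md A B"
proof -
  define f where "f x = \<alpha> * (if x \<in> side a then 1 else 0) + \<beta> * (if x \<in> S a b then 1 else 0)" for x
  have "f y - f x \<le> d x y" if "x \<in> P" "y \<in> P" for x y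
  proof -
    have *: "x \<in> S a b \<Longrightarrow> x \<in> side a" "y \<in> S a b \<Longrightarrow> y \<in> side a" using S_side by auto
    consider "x \<notin> side a" "y \<notin> side a" | "x \<in> side a" "y \<notin> side a" | "x \<notin> side a" "y \<in> side a"
      | "x \<in> S a b" "y \<in> S a b" | "x \<in> S a (\<not> b)" "y \<in> S a (\<not> b)"
      | "x \<in> S a b" "y \<in> S a (\<not> b)" | "x \<in> S a (\<not> b)" "y \<in> S a b"
      using side_eq[of a b] by auto
    then show ?thesis
    proof cases
      case 1 then show ?thesis using * d_nonneg[OF that] by (auto simp: f_def)
    next
      case 2 then show ?thesis using * d_out[of x a y] that assms by (auto simp: f_def)
    next
      case 3 then show ?thesis using * d_out'[of y a x] that assms by (auto simp: f_def)
    next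
      case 4 then show ?thesis using * d_nonneg[OF that] by (auto simp: f_def)
    next
      case 5 then show ?thesis using S_side[of a "\<not> b"] S_disj[of a b] d_nonneg[OF that] by (auto simp: f_def)
    next
      case 6 then show ?thesis
        using S_side[of a "\<not> b"] S_side[of a b] S_disj[of a b] d_stars[OF 6] assms by (auto simp: f_def)
    next
      case 7 then show ?thesis
        using S_side[of a "\<not> b"] S_side[of a b] S_disj[of a b] d_stars[of x a "\<not> b" y] assms by (auto simp: f_def)
    qed
  qed
  then have "(\<Sum>x\<in>#B. f x) - (\<Sum>x\<in>#A. f x) \<le> md A B"
    by (intro matching_dist_potential) (use assms configs_memD in \<open>auto simp: configs_def\<close>)
  moreover have "(\<Sum>x\<in>#A. f x) = \<alpha> * real (cnt (side a) A) + \<beta> * real (cnt (S a b) A)" for A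
    by (simp add: f_def real_cnt sum_mset.distrib sum_mset_distrib_left)
  ultimately show ?thesis by (simp add: algebra_simps)
qed

lemma md_sides_le:
  assumes "size A = size B" "set_mset A \<subseteq> side a \<union> side (\<not> a)" "set_mset B \<subseteq> side a \<union> side (\<not> a)"
    "cnt (side a) A \<le> cnt (side a) B"
  shows "md A B \<le> (real (cnt (side a) B) - real (cnt (side a) A)) * D + real (size A) * m"
  by (rule md_two_clusters[where V = "side (\<not> a)"])
     (use assms d_in_side m_pos d_le_D side_sub in \<open>auto simp: subset_iff\<close>)

lemma md_stars_le:
  assumes "size A = size B" "set_mset A \<subseteq> side a" "set_mset B \<subseteq> side a"
    "cnt (S a b) A \<le> cnt (S a b) B"
  shows "md A B \<le> (real (cnt (S a b) B) - real (cnt (S a b) A)) * m + real (size A) * \<delta>"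
  by (rule md_two_clusters[where V = "S a (\<not> b)"])
     (use assms d_in_star \<delta>_pos d_in_side in \<open>auto simp flip: side_eq[of a b]\<close>)

end

subsection \<open>One phase of the request sequence\<close>

context wfa
begin

text \<open>Combines two bounds on one move, \<open>\<delta>\<close> for the missed request and
  \<open>\<Delta>\<close> per entering server. The server that serves the request may be one that
  enters, so only \<open>\<Delta> - \<delta>\<close> per entering server is added. Being linear in
  the counts, the sum telescopes over many requests.\<close>

lemma md_step_ge:
  assumes "set (rs @ [r]) \<subseteq> P" "isolated \<delta> Q" "r \<in> Q" "r \<notin># alg rs" "\<delta> \<le> \<Delta>"
    and sep: "\<And>x y. x \<in> P \<Longrightarrow> x \<notin> U \<Longrightarrow> y \<in> U \<Longrightarrow> \<Delta> \<le> d x y"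
  shows "\<delta> + (\<Delta> - \<delta>) * (real (cnt U (alg (rs @ [r]))) - real (cnt U (alg rs)))
    \<le> md (alg rs) (alg (rs @ [r]))"
proof -
  let ?A = "alg rs" and ?X = "alg (rs @ [r])"
  have conf: "?A \<in> conf" "?X \<in> conf" using alg_conf assms(1) by auto
  have \<delta>: "0 < \<delta>" using assms(2) by (simp add: isolated_def)
  have 1: "\<delta> \<le> md ?A ?X"
    by (rule md_ge_isolated[OF conf assms(2,3)]) (use alg_serves[OF assms(1)] assms(4) in auto)
  have 2: "\<Delta> * (real (cnt U ?X) - real (cnt U ?A)) \<le> md ?A ?X"
  proof (rule matching_dist_cnt)
    show "size ?A = size ?X" "0 \<le> \<Delta>" using conf \<delta> assms(5) by (auto simp: configs_def)
    fix x y assume "x \<in># ?A" "y \<in># ?X"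
    then have "x \<in> P" "y \<in> P" using conf configs_memD by auto
    then show "y \<in> U \<Longrightarrow> x \<notin> U \<Longrightarrow> \<Delta> \<le> d x y" "0 \<le> d x y" using sep d_nonneg by auto
  qed
  show ?thesis
  proof (cases "cnt U ?A < cnt U ?X")
    case True
    then have "\<delta> * 1 \<le> \<delta> * (real (cnt U ?X) - real (cnt U ?A))" using \<delta> by (intro mult_left_mono) auto
    then show ?thesis using 2 by (simp add: left_diff_distrib)
  next
    case False
    then have "(\<Delta> - \<delta>) * (real (cnt U ?X) - real (cnt U ?A)) \<le> 0"
      using assms(5) by (intro mult_nonneg_nonpos) auto
    then show ?thesis using 1 by linarith
  qed
qed

text \<open>
  In stage \<open>j\<close> the requests stay within the first \<open>j + 1\<close> points of \<open>ss\<close>; as long as the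
  algorithm has at most \<open>j\<close> servers in \<open>U\<close>, one of these points is uncovered.
\<close>

lemma stages:
  assumes rs: "set rs \<subseteq> P" and ss: "set ss \<subseteq> U" "distinct ss" "length ss = h" "isolated \<delta> (set ss)"
    and "\<delta> \<le> \<Delta>" and sep: "\<And>x y. x \<in> P \<Longrightarrow> x \<notin> U \<Longrightarrow> y \<in> U \<Longrightarrow> \<Delta> \<le> d x y"
    and start: "cnt U (alg rs) = 0"
    and step: "\<And>j \<rho> ns r. 1 \<le> j \<Longrightarrow> j < h \<Longrightarrow> set \<rho> \<subseteq> set (take j ss) \<Longrightarrow>
      set ns \<subseteq> set (take (Suc j) ss) \<Longrightarrow> length ns < nn j \<Longrightarrow> r \<in> set (take (Suc j) ss) \<Longrightarrow>
      cnt U (alg (rs @ \<rho> @ ns)) \<le> j \<Longrightarrow> cnt U (alg (rs @ \<rho> @ ns @ [r])) \<le> j"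
    and "1 \<le> J" "J \<le> h"
  shows "\<exists>\<rho>. set \<rho> \<subseteq> set (take J ss) \<and> cnt U (alg (rs @ \<rho>)) < J \<and>
    cost rs + \<delta> * real (\<Sum>j=1..<J. nn j) + (\<Delta> - \<delta>) * real (cnt U (alg (rs @ \<rho>))) \<le> cost (rs @ \<rho>)"
  using \<open>1 \<le> J\<close> \<open>J \<le> h\<close>
proof (induction J rule: dec_induct)
  case base
  then show ?case using start by (intro exI[of _ "[]"]) auto
next
  case (step J)
  then obtain \<rho> where \<rho>: "set \<rho> \<subseteq> set (take J ss)" "cnt U (alg (rs @ \<rho>)) < J"
    "cost rs + \<delta> * real (\<Sum>j=1..<J. nn j) + (\<Delta> - \<delta>) * real (cnt U (alg (rs @ \<rho>))) \<le> cost (rs @ \<rho>)"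
    by auto
  let ?Q = "set (take (Suc J) ss)"
  have Qss: "?Q \<subseteq> set ss" by (rule set_take_subset)
  have QP: "?Q \<subseteq> P" "set ss \<subseteq> P" using Qss ss(4) by (auto simp: isolated_def)
  have cardQ: "card ?Q = Suc J"
    using ss(2,3) step.prems by (simp add: distinct_card)
  have \<rho>P: "set \<rho> \<subseteq> P" using \<rho>(1) QP(2) set_take_subset[of J ss] by blast
  have "\<exists>ns. length ns = n \<and> set ns \<subseteq> ?Q \<and> cnt U (alg (rs @ \<rho> @ ns)) \<le> J \<and>
      cost (rs @ \<rho>) + \<delta> * real n + (\<Delta> - \<delta>) * (real (cnt U (alg (rs @ \<rho> @ ns))) - real (cnt U (alg (rs @ \<rho>))))
      \<le> cost (rs @ \<rho> @ ns)" if "n \<le> nn J" for n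
    using that
  proof (induction n)
    case 0
    then show ?case using \<rho>(2) by (intro exI[of _ "[]"]) auto
  next
    case (Suc n)
    then obtain ns where ns: "length ns = n" "set ns \<subseteq> ?Q" "cnt U (alg (rs @ \<rho> @ ns)) \<le> J"
      "cost (rs @ \<rho>) + \<delta> * real n + (\<Delta> - \<delta>) * (real (cnt U (alg (rs @ \<rho> @ ns))) - real (cnt U (alg (rs @ \<rho>))))
      \<le> cost (rs @ \<rho> @ ns)" by auto
    let ?A = "alg (rs @ \<rho> @ ns)"
    have "\<not> ?Q \<subseteq> set_mset ?A"
    proof
      assume "?Q \<subseteq> set_mset ?A"
      then have "card ?Q \<le> cnt U ?A"
        using card_le_cnt[of ?Q ?A] cnt_mono[of ?Q U ?A] Qss ss(1) by force
      then show False using cardQ ns(3) by simp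
    qed
    then obtain r where r: "r \<in> ?Q" "r \<notin># ?A" by blast
    have sub: "set ((rs @ \<rho> @ ns) @ [r]) \<subseteq> P" using rs \<rho>P ns(2) r(1) QP(1) by auto
    have c: "cnt U (alg (rs @ \<rho> @ ns @ [r])) \<le> J"
      by (rule assms(9)) (use step \<rho>(1) ns r Suc.prems in auto)
    have "\<delta> + (\<Delta> - \<delta>) * (real (cnt U (alg ((rs @ \<rho> @ ns) @ [r]))) - real (cnt U ?A))
      \<le> md ?A (alg ((rs @ \<rho> @ ns) @ [r]))"
      by (rule md_step_ge[OF sub ss(4) _ r(2) assms(6) sep]) (use r(1) Qss in auto)
    moreover have "cost ((rs @ \<rho> @ ns) @ [r]) = cost (rs @ \<rho> @ ns) + md ?A (alg ((rs @ \<rho> @ ns) @ [r]))"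
      by (rule cost_snoc)
    ultimately show ?case using ns r c
      by (intro exI[of _ "ns @ [r]"]) (auto simp: algebra_simps)
  qed
  from this[OF order_refl] obtain ns where ns: "length ns = nn J" "set ns \<subseteq> ?Q"
    "cnt U (alg (rs @ \<rho> @ ns)) \<le> J"
    "cost (rs @ \<rho>) + \<delta> * real (nn J) + (\<Delta> - \<delta>) * (real (cnt U (alg (rs @ \<rho> @ ns))) - real (cnt U (alg (rs @ \<rho>))))
      \<le> cost (rs @ \<rho> @ ns)" by blast
  have "set (take J ss) \<subseteq> ?Q" by (rule set_take_subset_set_take) simp
  then have "set (\<rho> @ ns) \<subseteq> ?Q" using \<rho>(1) ns(2) by auto
  moreover have "cost rs + \<delta> * real (\<Sum>j=1..<Suc J. nn j) + (\<Delta> - \<delta>) * real (cnt U (alg (rs @ \<rho> @ ns)))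
    \<le> cost (rs @ \<rho> @ ns)"
    using \<rho>(3) ns(4) step.hyps by (simp add: sum.atLeastLessThan_Suc algebra_simps)
  ultimately show ?case using ns(3) by (intro exI[of _ "\<rho> @ ns"]) auto
qed

text \<open>No useful bound on the number of rounds is kept. That is harmless on a star, where the
  adversary can keep all \<open>h\<close> points occupied, and in the preparation before the first
  phase, whose cost is a constant.\<close>

lemma saturate_and_cover:
  assumes "set rs \<subseteq> P" "isolated \<delta> (set qs)" "card (set qs) \<le> k"
  shows "\<exists>\<rho>. set \<rho> \<subseteq> set qs \<and> sat (set qs) (rs @ \<rho>) \<and> set qs \<subseteq> set_mset (alg (rs @ \<rho>))"
proof -
  have "0 < \<delta>" "set qs \<subseteq> P" using assms(2) by (auto simp: isolated_def)
  then obtain n where n: "2 * real k * D < real n * \<delta>" using ex_less_of_nat_mult by blast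
  let ?\<rho> = "rounds n qs"
  have s: "sat (set qs) (rs @ ?\<rho>)" using sat_rounds[OF assms] n by simp
  have sub: "set (rs @ ?\<rho>) \<subseteq> P" using assms(1) set_rounds[of n qs] \<open>set qs \<subseteq> P\<close> by auto
  obtain \<rho>' where \<rho>': "set \<rho>' \<subseteq> set qs" "set qs \<subseteq> set_mset (alg ((rs @ ?\<rho>) @ \<rho>'))"
    using descent[OF s sub assms(2) _ assms(3)] by auto
  have "sat (set qs) ((rs @ ?\<rho>) @ \<rho>')"
    by (rule sat_append[OF s]) (use sub \<rho>' \<open>set qs \<subseteq> P\<close> in auto)
  then show ?thesis using \<rho>' set_rounds[of n qs] by (intro exI[of _ "?\<rho> @ \<rho>'"]) auto
qed

text \<open>The stages end with fewer than \<open>h\<close> servers in \<open>U\<close>. The closing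
  saturation puts servers on all \<open>h\<close> points, so those still missing are charged
  \<open>\<Delta>\<close> each as they enter.\<close>

lemma fill:
  assumes rs: "set rs \<subseteq> P" and ss: "set ss \<subseteq> U" "distinct ss" "length ss = h" "isolated \<delta> (set ss)"
    and "1 \<le> h" "h \<le> k"
    and "\<delta> \<le> \<Delta>" and sep: "\<And>x y. x \<in> P \<Longrightarrow> x \<notin> U \<Longrightarrow> y \<in> U \<Longrightarrow> \<Delta> \<le> d x y"
    and start: "cnt U (alg rs) = 0"
    and step: "\<And>j \<rho> ns r. 1 \<le> j \<Longrightarrow> j < h \<Longrightarrow> set \<rho> \<subseteq> set (take j ss) \<Longrightarrow>
      set ns \<subseteq> set (take (Suc j) ss) \<Longrightarrow> length ns < nn j \<Longrightarrow> r \<in> set (take (Suc j) ss) \<Longrightarrow>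
      cnt U (alg (rs @ \<rho> @ ns)) \<le> j \<Longrightarrow> cnt U (alg (rs @ \<rho> @ ns @ [r])) \<le> j"
  shows "\<exists>\<rho>. set \<rho> \<subseteq> set ss \<and> sat (set ss) (rs @ \<rho>) \<and> set ss \<subseteq> set_mset (alg (rs @ \<rho>)) \<and>
    cost rs + \<delta> * real (\<Sum>j=1..<h. nn j) + (\<Delta> - \<delta>) * real h \<le> cost (rs @ \<rho>)"
proof -
  obtain \<rho> where \<rho>: "set \<rho> \<subseteq> set (take h ss)" "cnt U (alg (rs @ \<rho>)) < h"
    "cost rs + \<delta> * real (\<Sum>j=1..<h. nn j) + (\<Delta> - \<delta>) * real (cnt U (alg (rs @ \<rho>))) \<le> cost (rs @ \<rho>)"
    using stages[OF rs ss \<open>\<delta> \<le> \<Delta>\<close> sep start step \<open>1 \<le> h\<close> order_refl, of nn] by blast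
  have \<delta>: "0 < \<delta>" and ssP: "set ss \<subseteq> P" using ss(4) by (auto simp: isolated_def)
  have \<rho>ss: "set \<rho> \<subseteq> set ss" using \<rho>(1) ss(3) by simp
  have sub: "set (rs @ \<rho>) \<subseteq> P" using rs \<rho>ss ssP by auto
  have card: "card (set ss) = h" using ss(2,3) by (simp add: distinct_card)
  obtain \<rho>' where \<rho>': "set \<rho>' \<subseteq> set ss" "sat (set ss) ((rs @ \<rho>) @ \<rho>')"
    "set ss \<subseteq> set_mset (alg ((rs @ \<rho>) @ \<rho>'))"
    using saturate_and_cover[OF sub ss(4)] card \<open>h \<le> k\<close> by auto
  let ?A = "alg (rs @ \<rho>)" and ?X = "alg ((rs @ \<rho>) @ \<rho>')"
  have sub': "set ((rs @ \<rho>) @ \<rho>') \<subseteq> P" using sub \<rho>' ssP by auto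
  then have conf: "?A \<in> conf" "?X \<in> conf" using alg_conf by auto
  have hX: "h \<le> cnt U ?X" using card_le_cnt[OF \<rho>'(3)] card cnt_mono[OF ss(1), of ?X] by simp
  have "\<Delta> * (real (cnt U ?X) - real (cnt U ?A)) \<le> md ?A ?X"
  proof (rule matching_dist_cnt)
    show "size ?A = size ?X" "0 \<le> \<Delta>" using conf \<delta> \<open>\<delta> \<le> \<Delta>\<close> by (auto simp: configs_def)
    fix x y assume "x \<in># ?A" "y \<in># ?X"
    then have "x \<in> P" "y \<in> P" using conf configs_memD by auto
    then show "y \<in> U \<Longrightarrow> x \<notin> U \<Longrightarrow> \<Delta> \<le> d x y" "0 \<le> d x y" using sep d_nonneg by auto
  qed
  moreover have "(\<Delta> - \<delta>) * (real h - real (cnt U ?A)) \<le> \<Delta> * (real (cnt U ?X) - real (cnt U ?A))"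
    using hX \<rho>(2) \<delta> \<open>\<delta> \<le> \<Delta>\<close> by (intro mult_mono) auto
  moreover have "cost (rs @ \<rho>) + md ?A ?X \<le> cost ((rs @ \<rho>) @ \<rho>')" by (rule cost_append[OF sub'])
  ultimately have "cost rs + \<delta> * real (\<Sum>j=1..<h. nn j) + (\<Delta> - \<delta>) * real h \<le> cost ((rs @ \<rho>) @ \<rho>')"
    using \<rho>(3) by (simp add: right_diff_distrib)
  then show ?thesis using \<rho>' \<rho>ss by (intro exI[of _ "\<rho> @ \<rho>'"]) auto
qed

end

section \<open>The state at the start of a phase\<close>

locale phase = two_sided_space P d D S h \<kappa> \<mu> m \<delta> + wfa P d D "2 * h" alg
  for P :: "'p set" and d D S h \<kappa> \<mu> m \<delta> alg +
  fixes a :: bool and rs0 :: "'p list"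
  assumes sub0: "set rs0 \<subseteq> P" and cone: "sat (side a) rs0" and start: "alg rs0 = mset_set (side a)"
begin

abbreviation L where "L \<equiv> side a"
abbreviation R where "R \<equiv> side (\<not> a)"
abbreviation T where "T \<equiv> S (\<not> a)"
abbreviation C where "C \<equiv> mset_set L"

definition w0 :: real where "w0 = W rs0 C"

lemma C_conf: "C \<in> conf"
  using side_sub card_side finite_side by (auto simp: configs_def)

lemma W_rs0: "Z \<in> conf \<Longrightarrow> W rs0 Z = w0 + md C Z"
  using cone sat_full_iff[OF finite_side card_side side_sub sub0] unfolding w0_def by blast

lemma LR_disj: "L \<inter> R = {}" by (rule sides_disj)

lemma LR_sub: "L \<union> R \<subseteq> P" using side_sub by auto

lemma sub_R: "set \<rho> \<subseteq> R \<Longrightarrow> set (rs0 @ \<rho>) \<subseteq> P" using sub0 side_sub by fastforce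

lemma T_R: "T b \<subseteq> R" by (rule S_side)

lemma d_outside: "x \<in> L \<union> R \<Longrightarrow> y \<in> P \<Longrightarrow> y \<notin> L \<union> R \<Longrightarrow> d x y = D"
  using d_out by blast

lemma cnt_R_C: "cnt R C = 0"
  by (rule cnt_disjoint) (use LR_disj finite_side in auto)

text \<open>
  Collapsing everything outside the two sides to one point of them is a contraction, so the
  algorithm never gains from leaving the two sides.
\<close>

lemma alg_two_sides:
  assumes "set \<rho> \<subseteq> R"
  shows "set_mset (alg (rs0 @ \<rho>)) \<subseteq> L \<union> R"
  using assms
proof (induction \<rho> rule: rev_induct)
  case Nil
  then show ?case using start finite_side by auto
next
  case (snoc r \<rho>)
  let ?A = "alg (rs0 @ \<rho>)" and ?X = "alg ((rs0 @ \<rho>) @ [r])"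
  have A: "set_mset ?A \<subseteq> L \<union> R" using snoc by auto
  have sub: "set ((rs0 @ \<rho>) @ [r]) \<subseteq> P" using sub_R[OF snoc.prems] by simp
  have conf: "?A \<in> conf" "?X \<in> conf" using alg_conf sub by auto
  have "x \<in> L \<union> R" if x: "x \<in># ?X" for x
  proof (rule ccontr)
    assume out: "x \<notin> L \<union> R"
    obtain M where M: "M \<in> matchings ?A ?X" "md ?A ?X = mcost d M"
      using matching_dist_attained[of ?A ?X d] conf by (auto simp: configs_def)
    have "x \<in># image_mset snd M" using M(1) x by (simp add: matchings_def)
    then obtain c where c: "(c, x) \<in># M" by auto
    then obtain N where N: "M = add_mset (c, x) N" by (meson multi_member_split)
    have cA: "c \<in> L \<union> R" using matchings_mem[OF M(1) c] A by auto
    \<comment> \<open>Collapsing to the partner \<open>c\<close> of \<open>x\<close> in an optimal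
      matching saves the whole distance \<open>D\<close> of this pair and lengthens no other, so
      \<open>image_mset g ?X\<close> would beat \<open>?X\<close>.\<close>
    define g where "g p = (if p \<in> L \<union> R then p else c)" for p
    have gP: "g p \<in> P" if "p \<in> P" for p using cA LR_sub that by (auto simp: g_def)
    have dg: "d (g p) (g q) \<le> d p q" if "p \<in> P" "q \<in> P" for p q
    proof -
      consider "p \<in> L \<union> R" "q \<in> L \<union> R" | "p \<in> L \<union> R" "q \<notin> L \<union> R" | "p \<notin> L \<union> R" "q \<in> L \<union> R"
        | "p \<notin> L \<union> R" "q \<notin> L \<union> R" by blast
      then show ?thesis
      proof cases
        case 1 then show ?thesis by (simp add: g_def)
      next
        case 2
        then have "g p = p" "g q = c" by (auto simp: g_def)
        then show ?thesis using d_outside[OF 2(1) that(2) 2(2)] d_le_D[of p c] that cA LR_sub by auto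
      next
        case 3
        then have "g p = c" "g q = q" by (auto simp: g_def)
        then show ?thesis
          using d_outside[OF 3(2) that(1) 3(1)] d_le_D[of c q] d_sym[OF that] that cA LR_sub by auto
      next
        case 4
        then have "g p = c" "g q = c" by (auto simp: g_def)
        then show ?thesis using d_nonneg[OF that] d_self cA LR_sub by auto
      qed
    qed
    have gfix: "image_mset g B = B" if "set_mset B \<subseteq> L \<union> R" for B
      using that by (induction B) (auto simp: g_def)
    have gX: "image_mset g ?X \<in> conf" using conf(2) gP by (auto simp: configs_def)
    have gr: "r \<in># image_mset g ?X"
      using alg_serves[OF sub] snoc.prems by (force simp: g_def)
    have "W (rs0 @ \<rho> @ [r]) (image_mset g ?X) \<le> W (rs0 @ \<rho> @ [r]) ?X"
    proof (rule W_retract[OF _ gP dg])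
      show "W rs0 (image_mset g Z) \<le> W rs0 Z" if Z: "Z \<in> conf" for Z
      proof -
        have "image_mset g Z \<in> conf" using Z gP by (auto simp: configs_def)
        moreover have "md (image_mset g C) (image_mset g Z) \<le> md C Z"
        proof (rule matching_dist_image_le)
          show "size C = size Z" using C_conf Z by (simp add: configs_def)
          show "d (g p) (g q) \<le> d p q" if "p \<in># C" "q \<in># Z" for p q
            using dg configs_memD[OF C_conf that(1)] configs_memD[OF Z that(2)] by blast
        qed
        ultimately show ?thesis using W_rs0 Z gfix[of C] finite_side by simp
      qed
      show "g p = p" if "p \<in> set (\<rho> @ [r])" for p using that snoc.prems by (auto simp: g_def)
    qed (use sub conf in auto)
    then have "md ?A ?X \<le> md ?A (image_mset g ?X)"
      using alg_min[OF sub gX gr] by simp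
    also have "\<dots> \<le> mcost d (image_mset (\<lambda>(p, q). (p, g q)) M)"
    proof (rule matching_dist_le)
      have eqs: "?A = image_mset fst M" "?X = image_mset snd M"
        using M(1) by (simp_all add: matchings_def)
      show "image_mset (\<lambda>(p, q). (p, g q)) M \<in> matchings ?A (image_mset g ?X)"
        unfolding eqs matchings_def
        by (simp add: image_mset.compositionality comp_def case_prod_unfold)
    qed
    also have "\<dots> = d c c + (\<Sum>(p, q)\<in>#N. d p (g q))"
      using out by (simp add: N g_def image_mset.compositionality comp_def case_prod_unfold)
    also have "\<dots> \<le> (\<Sum>(p, q)\<in>#N. d p q)"
    proof -
      have "d c c = 0" using cA LR_sub d_self by auto
      moreover have "(\<Sum>(p, q)\<in>#N. d p (g q)) \<le> (\<Sum>(p, q)\<in>#N. d p q)"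
      proof (rule sum_mset_mono)
        fix z assume "z \<in># N"
        then have z: "(fst z, snd z) \<in># M" using N by simp
        have "fst z \<in> L \<union> R" "snd z \<in> P"
          using matchings_mem[OF M(1) z] A configs_memD[OF conf(2)] by auto
        then show "(case z of (p, q) \<Rightarrow> d p (g q)) \<le> (case z of (p, q) \<Rightarrow> d p q)"
          using dg[of "fst z" "snd z"] LR_sub by (auto simp: g_def split: prod.split)
      qed
      ultimately show ?thesis by simp
    qed
    also have "\<dots> < mcost d M"
      using d_outside[OF cA _ out] configs_memD[OF conf(2) x] D_pos N by simp
    finally show False using M(2) by simp
  qed
  then show ?case by auto
qed

end

section \<open>Lengths of the stages\<close>

context two_sided_space
begin

text \<open>The multiplier of \<open>j\<close> is \<open>2 * D / \<delta>\<close> less a reserve of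
  \<open>(2 * h + 4) * m / \<delta>\<close>: \<open>2 * h * m\<close> pays for rearranging servers
  within the sides, \<open>3 * \<delta>\<close> is the error of \<open>W_one_hole\<close>, and the
  rest makes \<open>first_len_bound\<close> strict. By \<open>\<mu>_ge\<close> the subtraction does
  not truncate.\<close>

definition first_len :: "nat \<Rightarrow> nat" where
  "first_len j = j * (\<kappa> * (2 * \<mu> - (2 * h + 4)))"

text \<open>The same count one scale lower: \<open>2 * m / \<delta>\<close> per server, less
  \<open>h\<close> for rearranging within the stars, \<open>3\<close> for \<open>W_one_hole\<close>
  and \<open>1\<close> for strictness.\<close>

definition next_len :: "nat \<Rightarrow> nat" where
  "next_len j = j * (2 * \<kappa> - (h + 4))"

lemma first_len_bound:
  assumes "n < first_len j" "1 \<le> j"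
  shows "\<delta> * (real (Suc n) / real j + 3) + 2 * h * m < 2 * D"
proof -
  have "real (Suc n) \<le> real (j * (\<kappa> * (2 * \<mu> - (2 * h + 4))))"
    using assms(1) unfolding first_len_def by (metis Suc_leI of_nat_le_iff)
  also have "\<dots> = real j * (real \<kappa> * (2 * real \<mu> - (2 * real h + 4)))"
    using \<mu>_ge by (simp add: of_nat_diff)
  finally have "real (Suc n) / real j \<le> real \<kappa> * (2 * real \<mu> - (2 * real h + 4))"
    using assms(2) by (simp add: pos_divide_le_eq mult.commute)
  then have "\<delta> * (real (Suc n) / real j) \<le> \<delta> * (real \<kappa> * (2 * real \<mu> - (2 * real h + 4)))"
    using \<delta>_pos by (intro mult_left_mono) auto
  also have "\<dots> = 2 * D - (2 * real h + 4) * m" by (simp add: D_def m_def algebra_simps)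
  finally show ?thesis using \<delta>_le_m m_pos by (simp add: algebra_simps)
qed

lemma next_len_bound:
  assumes "n < next_len j" "1 \<le> j"
  shows "\<delta> * (real (Suc n) / real j + 3) + h * \<delta> < 2 * m"
proof -
  have "real (Suc n) \<le> real (j * (2 * \<kappa> - (h + 4)))"
    using assms(1) unfolding next_len_def by (metis Suc_leI of_nat_le_iff)
  also have "\<dots> = real j * (2 * real \<kappa> - (real h + 4))"
    using \<kappa>_ge by (simp add: of_nat_diff)
  finally have "real (Suc n) / real j \<le> 2 * real \<kappa> - (real h + 4)"
    using assms(2) by (simp add: pos_divide_le_eq mult.commute)
  then have "\<delta> * (real (Suc n) / real j) \<le> \<delta> * (2 * real \<kappa> - (real h + 4))"
    using \<delta>_pos by (intro mult_left_mono) auto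
  also have "\<dots> = 2 * m - (real h + 4) * \<delta>" by (simp add: m_def algebra_simps)
  finally show ?thesis using \<delta>_pos by (simp add: algebra_simps)
qed

end

section \<open>Linear bounds on the work function during a phase\<close>

context phase
begin

lemma cnt_R_split: "cnt R Z = cnt (T b) Z + cnt (T (\<not> b)) Z"
  using cnt_Un[OF S_disj] side_eq by metis

lemma cnt_T_ge: "T b \<subseteq> set_mset V \<Longrightarrow> h \<le> cnt (T b) V"
  using card_le_cnt[of "T b" V] card_S by simp

lemma T_conf: "size Z = h \<Longrightarrow> set_mset Z \<subseteq> P \<Longrightarrow> mset_set (T b) + Z \<in> conf"
  using S_sub card_S finite_S by (auto simp: configs_def)

lemma md_switch: "md (mset_set (T b)) (mset_set (T (\<not> b))) \<le> real h * m"
proof -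
  have "d x y \<le> m" if "x \<in># mset_set (T b)" "y \<in># mset_set (T (\<not> b))" for x y
    using that d_stars finite_S by (metis elem_mset_set order_refl)
  then show ?thesis
    using matching_dist_le_const[of "mset_set (T b)" "mset_set (T (\<not> b))" d m] card_S by simp
qed

lemma md_refl_le: "set_mset Z \<subseteq> P \<Longrightarrow> md Z Z \<le> 0"
  by (rule matching_dist_self_le) (use d_self in auto)

text \<open>With \<open>t = m * \<tau>\<close> the first bound is
  \<open>(h + i) * D + (h - i) * t\<close> above \<open>w0\<close> at
  \<open>cnt R Z = h + i\<close>: each of the \<open>i\<close> extra servers in \<open>R\<close>
  saves \<open>m\<close> per alternation. The second also charges \<open>m\<close> for each of the
  \<open>h\<close> servers missing in the current star; when the other star is requested it turns
  into the first bound for \<open>\<tau> + 1\<close>. The third handles configurations with fewer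
  than \<open>h\<close> servers in \<open>R\<close>, which had to bring servers back at cost
  \<open>D\<close>. The last clause is the upper bound at the witnesses.\<close>

definition bnd :: "nat \<Rightarrow> bool \<Rightarrow> 'p list \<Rightarrow> bool" where
  "bnd \<tau> b rs \<longleftrightarrow> sat (T b) rs \<and>
    (\<forall>Z\<in>conf.
      w0 + 2 * h * (m * \<tau>) + (D - m * \<tau>) * cnt R Z \<le> W rs Z \<and>
      w0 + 2 * h * (m * \<tau>) + m * h + ((D - m * \<tau>) * cnt R Z - m * cnt (T b) Z) \<le> W rs Z \<and>
      w0 + 2 * h * D + h * (m * \<tau>) - D * cnt R Z \<le> W rs Z) \<and>
    (\<forall>Z. set_mset Z \<subseteq> L \<longrightarrow> size Z = h \<longrightarrow>
      W rs (mset_set (T b) + Z) \<le> w0 + h * D + h * (m * \<tau>) + h * m)"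

text \<open>By saturation a linear bound has to be checked only for configurations covering the
  current star, and those have the same value as before the requests in the star.\<close>

lemma sat_linear_bound:
  assumes "sat (T b) (rs @ \<rho>)" "set rs \<subseteq> P" "set \<rho> \<subseteq> T b" "Z \<in> conf"
    "\<bar>\<alpha>\<bar> \<le> D" "\<bar>\<alpha> + \<beta>\<bar> \<le> D" "\<bar>\<beta>\<bar> \<le> m"
    "\<And>V. V \<in> conf \<Longrightarrow> T b \<subseteq> set_mset V \<Longrightarrow> c + \<alpha> * cnt R V + \<beta> * cnt (T b) V \<le> W rs V"
  shows "c + \<alpha> * cnt R Z + \<beta> * cnt (T b) Z \<le> W (rs @ \<rho>) Z"
proof (rule satD[OF assms(1,4)])
  fix V assume V: "V \<in> conf" "T b \<subseteq> set_mset V"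
  have "set (rs @ \<rho>) \<subseteq> P" using assms(2,3) S_sub by fastforce
  then have "W (rs @ \<rho>) V = W rs V" using V assms(3) by (intro W_cover) auto
  then show "c + \<alpha> * cnt R Z + \<beta> * cnt (T b) Z \<le> W (rs @ \<rho>) V + md V Z"
    using assms(8)[OF V] md_linear[OF V(1) assms(4-7), of "\<not> a" b] by (simp add: algebra_simps)
qed

lemma bnd_first:
  assumes "sat (T b) (rs0 @ \<rho>)" "set \<rho> \<subseteq> T b"
  shows "bnd 0 b (rs0 @ \<rho>)"
proof -
  have lb: "w0 + D * cnt R V \<le> W rs0 V" if "V \<in> conf" for V
    using W_rs0[OF that] md_side_cnt[OF C_conf that, of "\<not> a"] cnt_R_C by simp
  have cnt: "real h \<le> real (cnt (T b) V)" "real h \<le> real (cnt R V)" if "T b \<subseteq> set_mset V" for V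
    using cnt_T_ge[OF that] cnt_R_split[of V b] by auto
  have 1: "w0 + D * cnt R Z + (0::real) * cnt (T b) Z \<le> W (rs0 @ \<rho>) Z" if "Z \<in> conf" for Z
    by (rule sat_linear_bound[OF assms(1) sub0 assms(2) that])
      (use lb D_pos m_pos in auto)
  have 2: "(w0 + m * h) + D * cnt R Z + (- m) * cnt (T b) Z \<le> W (rs0 @ \<rho>) Z" if "Z \<in> conf" for Z
  proof (rule sat_linear_bound[OF assms(1) sub0 assms(2) that])
    fix V assume V: "V \<in> conf" "T b \<subseteq> set_mset V"
    have "m * h \<le> m * cnt (T b) V" using cnt(1)[OF V(2)] m_pos by (intro mult_left_mono) auto
    then show "(w0 + m * h) + D * cnt R V + (- m) * cnt (T b) V \<le> W rs0 V" using lb[OF V(1)] by linarith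
  qed (use D_pos m_pos m_le_D in auto)
  have 3: "(w0 + 2 * h * D) + (- D) * cnt R Z + (0::real) * cnt (T b) Z \<le> W (rs0 @ \<rho>) Z" if "Z \<in> conf" for Z
  proof (rule sat_linear_bound[OF assms(1) sub0 assms(2) that])
    fix V assume V: "V \<in> conf" "T b \<subseteq> set_mset V"
    have "D * h \<le> D * cnt R V" using cnt(2)[OF V(2)] D_pos by (intro mult_left_mono) auto
    then show "(w0 + 2 * h * D) + (- D) * cnt R V + (0::real) * cnt (T b) V \<le> W rs0 V"
      using lb[OF V(1)] by (simp add: algebra_simps)
  qed (use D_pos m_pos in auto)
  have 4: "W (rs0 @ \<rho>) (mset_set (T b) + Z) \<le> w0 + h * D + h * m" if Z: "set_mset Z \<subseteq> L" "size Z = h" for Z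
  proof -
    let ?Y = "mset_set (T b) + Z"
    have ZP: "set_mset Z \<subseteq> P" using Z LR_sub by auto
    have Y: "?Y \<in> conf" using T_conf Z ZP by simp
    have "W (rs0 @ \<rho>) ?Y = W rs0 ?Y"
      using sub_R[of \<rho>] assms(2) T_R[of b] Y finite_S by (intro W_cover) auto
    moreover have "md C ?Y \<le> h * D + h * m"
    proof -
      have "size C = 2 * h" using C_conf by (simp add: configs_def)
      then obtain C1 where C1: "C1 \<subseteq># C" "size C1 = h" using submultiset_ex[of h C] by auto
      then obtain C2 where C2: "C = C1 + C2" by (metis subset_mset.le_iff_add)
      have "size C2 = h" using arg_cong[OF C2, of size] C1(2) \<open>size C = 2 * h\<close> by simp
      have inL: "set_mset C1 \<subseteq> L" "set_mset C2 \<subseteq> L"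
        using C2 finite_side by (metis Un_upper1 Un_upper2 finite_set_mset_mset_set set_mset_union)+
      have "md C ?Y \<le> md C1 (mset_set (T b)) + md C2 Z"
        unfolding C2 by (rule matching_dist_union) (use C1 \<open>size C2 = h\<close> Z card_S in auto)
      moreover have "md C1 (mset_set (T b)) \<le> size C1 * D"
      proof (rule matching_dist_le_const)
        show "d x y \<le> D" if "x \<in># C1" "y \<in># mset_set (T b)" for x y
          using that inL LR_sub S_sub[of "\<not> a" b] finite_S by (intro d_le_D) auto
      qed (use C1 card_S in auto)
      moreover have "md C2 Z \<le> size C2 * m"
      proof (rule matching_dist_le_const)
        show "d x y \<le> m" if "x \<in># C2" "y \<in># Z" for x y
          using that inL Z d_in_side[of x a y] by blast
      qed (use \<open>size C2 = h\<close> Z in auto)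
      ultimately show ?thesis using C1 \<open>size C2 = h\<close> by simp
    qed
    ultimately show ?thesis using W_rs0[OF Y] by simp
  qed
  show ?thesis
    unfolding bnd_def using assms(1) 1 2 3 4 by (auto simp: algebra_simps)
qed

lemma m_\<tau>_le: "\<tau> + n \<le> 2 * \<mu> \<Longrightarrow> m * \<tau> + m * n \<le> 2 * D"
proof -
  assume "\<tau> + n \<le> 2 * \<mu>"
  then have "real \<tau> + real n \<le> 2 * real \<mu>" by linarith
  then have "m * (real \<tau> + real n) \<le> m * (2 * real \<mu>)" using m_pos by (intro mult_left_mono) auto
  then show ?thesis by (simp add: D_def algebra_simps)
qed

lemma bnd_step:
  assumes bnd: "bnd \<tau> b rs" and rs: "set rs \<subseteq> P" and \<rho>: "set \<rho> \<subseteq> T (\<not> b)"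
    and sat: "sat (T (\<not> b)) (rs @ \<rho>)" and \<tau>: "\<tau> + 2 \<le> 2 * \<mu>"
  shows "bnd (Suc \<tau>) (\<not> b) (rs @ \<rho>)"
proof -
  define t where "t = m * real (Suc \<tau>)"
  have t: "t = m * \<tau> + m" by (simp add: t_def algebra_simps)
  have t0: "0 \<le> m * \<tau>" "0 \<le> t" "t + m \<le> 2 * D" using m_pos m_\<tau>_le[OF \<tau>] by (auto simp: t_def algebra_simps)
  have lb: "w0 + 2 * h * t + (D - t) * cnt R V \<le> W rs V" and cnt: "real h \<le> real (cnt (T (\<not> b)) V)" "real h \<le> real (cnt R V)"
    if V: "V \<in> conf" "T (\<not> b) \<subseteq> set_mset V" for V
  proof -
    show c: "real h \<le> real (cnt (T (\<not> b)) V)" "real h \<le> real (cnt R V)"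
      using cnt_T_ge[OF V(2)] cnt_R_split[of V "\<not> b"] by auto
    \<comment> \<open>\<open>V\<close> covers the other star, so \<open>h\<close> of its servers in
      \<open>R\<close> are not in star \<open>b\<close>. With this the second bound for
      \<open>\<tau>\<close> becomes the first bound for \<open>\<tau> + 1\<close>.\<close>
    have "real (cnt (T b) V) \<le> real (cnt R V) - real h" using c cnt_R_split[of V b] by auto
    then have "m * cnt (T b) V \<le> m * (real (cnt R V) - real h)" using m_pos by (intro mult_left_mono) auto
    moreover have "w0 + 2 * h * (m * \<tau>) + m * h + ((D - m * \<tau>) * cnt R V - m * cnt (T b) V) \<le> W rs V"
      using bnd V(1) unfolding bnd_def by blast
    ultimately show "w0 + 2 * h * t + (D - t) * cnt R V \<le> W rs V"
      unfolding t by (simp add: algebra_simps)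
  qed
  have 1: "(w0 + 2 * h * t) + (D - t) * cnt R Z + (0::real) * cnt (T (\<not> b)) Z \<le> W (rs @ \<rho>) Z" if "Z \<in> conf" for Z
    by (rule sat_linear_bound[OF sat rs \<rho> that]) (use lb t0 m_pos in auto)
  have 2: "(w0 + 2 * h * t + m * h) + (D - t) * cnt R Z + (- m) * cnt (T (\<not> b)) Z \<le> W (rs @ \<rho>) Z"
    if "Z \<in> conf" for Z
  proof (rule sat_linear_bound[OF sat rs \<rho> that])
    fix V assume V: "V \<in> conf" "T (\<not> b) \<subseteq> set_mset V"
    have "m * h \<le> m * cnt (T (\<not> b)) V" using cnt(1)[OF V] m_pos by (intro mult_left_mono) auto
    then show "(w0 + 2 * h * t + m * h) + (D - t) * cnt R V + (- m) * cnt (T (\<not> b)) V \<le> W rs V"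
      using lb[OF V] by linarith
  next
    show "\<bar>D - t\<bar> \<le> D" "\<bar>D - t + - m\<bar> \<le> D" "\<bar>- m\<bar> \<le> m" using t0 m_pos by linarith+
  qed
  have 3: "(w0 + 2 * h * D + h * t) + (- D) * cnt R Z + (0::real) * cnt (T (\<not> b)) Z \<le> W (rs @ \<rho>) Z" if "Z \<in> conf" for Z
  proof (rule sat_linear_bound[OF sat rs \<rho> that])
    fix V assume V: "V \<in> conf" "T (\<not> b) \<subseteq> set_mset V"
    \<comment> \<open>The first and the third bound agree at \<open>cnt R V = h\<close>. Their
      slopes differ by \<open>2 * D - t\<close>, which is nonnegative up to \<open>2 * \<mu>\<close>
      alternations.\<close>
    have "0 \<le> (real (cnt R V) - h) * (2 * D - t)" using cnt(2)[OF V] t0 m_pos by (intro mult_nonneg_nonneg) auto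
    then show "(w0 + 2 * h * D + h * t) + (- D) * cnt R V + (0::real) * cnt (T (\<not> b)) V \<le> W rs V"
      using lb[OF V] by (simp add: algebra_simps)
  qed (use D_pos m_pos in auto)
  have 4: "W (rs @ \<rho>) (mset_set (T (\<not> b)) + Z) \<le> w0 + h * D + h * t + h * m"
    if Z: "set_mset Z \<subseteq> L" "size Z = h" for Z
  proof -
    let ?Y = "\<lambda>b. mset_set (T b) + Z"
    have ZP: "set_mset Z \<subseteq> P" using Z LR_sub by auto
    have Y: "?Y b \<in> conf" for b using T_conf Z ZP by simp
    have sub: "set (rs @ \<rho>) \<subseteq> P" using rs \<rho> S_sub by fastforce
    have "W (rs @ \<rho>) (?Y (\<not> b)) = W rs (?Y (\<not> b))"
      using sub \<rho> Y finite_S by (intro W_cover) auto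
    also have "\<dots> \<le> W rs (?Y b) + md (?Y b) (?Y (\<not> b))" by (rule W_lip[OF rs Y Y])
    also have "md (?Y b) (?Y (\<not> b)) \<le> md (mset_set (T b)) (mset_set (T (\<not> b))) + md Z Z"
      by (rule matching_dist_union) (auto simp: card_S)
    also have "W rs (?Y b) \<le> w0 + h * D + h * (m * \<tau>) + h * m" using bnd Z unfolding bnd_def by blast
    finally show ?thesis using md_switch[of b] md_refl_le[OF ZP] by (simp add: t algebra_simps)
  qed
  show ?thesis
    unfolding bnd_def t_def[symmetric] using sat 1 2 3 4 by (auto simp: algebra_simps)
qed

lemma bnd_sat: "bnd \<tau> b rs \<Longrightarrow> sat (T b) rs"
  unfolding bnd_def by blast

section \<open>Filling the first star\<close>

lemma prefix_hole:
  assumes "distinct ss" "length ss = h" "j < h"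
  shows "set (take (Suc j) ss) - {ss ! j} = set (take j ss)" "ss ! j \<in> set (take (Suc j) ss)"
    "card (set (take (Suc j) ss)) = Suc j" "card (set (take j ss)) = j"
proof -
  have "take (Suc j) ss = take j ss @ [ss ! j]" using assms by (simp add: take_Suc_conv_app_nth)
  moreover have "distinct (take (Suc j) ss)" using assms by simp
  ultimately show "set (take (Suc j) ss) - {ss ! j} = set (take j ss)" "ss ! j \<in> set (take (Suc j) ss)" by auto
  show "card (set (take (Suc j) ss)) = Suc j" "card (set (take j ss)) = j"
    using assms by (simp_all add: distinct_card)
qed

lemma C_part:
  assumes "n \<le> 2 * h"
  obtains Z Z' where "C = Z + Z'" "size Z = 2 * h - n" "size Z' = n" "set_mset Z \<subseteq> L" "set_mset Z' \<subseteq> L"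
proof -
  have sC: "size C = 2 * h" using C_conf by (simp add: configs_def)
  obtain Z where Z: "Z \<subseteq># C" "size Z = 2 * h - n" using submultiset_ex[of "2 * h - n" C] sC by auto
  obtain Z' where C: "C = Z + Z'" using Z(1) by (metis subset_mset.le_iff_add)
  moreover have "size Z' = n" using arg_cong[OF C, of size] sC Z(2) assms by simp
  moreover have "set_mset Z \<subseteq> L" "set_mset Z' \<subseteq> L"
    using C finite_side by (metis Un_upper1 Un_upper2 finite_set_mset_mset_set set_mset_union)+
  ultimately show thesis using that Z(2) by blast
qed

lemma md_C_le:
  assumes "C = Z + Z'" "size Z' = card Q" "Q \<subseteq> P" "finite Q" "set_mset Z \<subseteq> L" "set_mset Z' \<subseteq> L"
  shows "md C (Z + mset_set Q) \<le> card Q * D"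
proof -
  have "md C (Z + mset_set Q) \<le> md Z Z + md Z' (mset_set Q)"
    unfolding assms(1) by (rule matching_dist_union) (use assms in auto)
  moreover have "md Z Z \<le> 0" by (rule md_refl_le) (use assms LR_sub in auto)
  moreover have "md Z' (mset_set Q) \<le> size Z' * D"
  proof (rule matching_dist_le_const)
    show "d x y \<le> D" if "x \<in># Z'" "y \<in># mset_set Q" for x y
      using that assms(3,4,6) LR_sub by (intro d_le_D) auto
  qed (use assms in auto)
  ultimately show ?thesis using assms(2) by simp
qed

lemma W_first_lower: "set \<rho> \<subseteq> R \<Longrightarrow> Z \<in> conf \<Longrightarrow> w0 + D * cnt R Z \<le> W (rs0 @ \<rho>) Z"
  using W_mono[of rs0 \<rho> Z] sub_R[of \<rho>] W_rs0[of Z] md_side_cnt[OF C_conf, of Z "\<not> a"] cnt_R_C by fastforce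

text \<open>The witness \<open>?Y\<close> has \<open>j\<close> servers in the star and its hole away
  from \<open>r\<close>. If the chosen configuration has \<open>x\<close> servers in
  \<open>R\<close> and the present one \<open>y\<close>, the choice costs at least
  \<open>x * D\<close> in the work function and \<open>(x - y) * D\<close> in movement, the witness
  at most \<open>j * D\<close> and \<open>(j - y) * D\<close> up to errors. So \<open>x > j\<close>
  would need errors of at least \<open>2 * D\<close>, more than the stage has accumulated.\<close>

lemma first_step:
  assumes ss: "set ss = T b" "distinct ss" "length ss = h"
    and j: "1 \<le> j" "j < h" and \<rho>: "set \<rho> \<subseteq> set (take j ss)" and ns: "set ns \<subseteq> set (take (Suc j) ss)"
    and len: "length ns < first_len j" and r: "r \<in> set (take (Suc j) ss)"
    and A: "cnt R (alg (rs0 @ \<rho> @ ns)) \<le> j"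
  shows "cnt R (alg (rs0 @ \<rho> @ ns @ [r])) \<le> j"
proof (rule ccontr)
  assume no: "\<not> ?thesis"
  let ?rs = "rs0 @ \<rho> @ ns"
  let ?A = "alg ?rs" and ?X = "alg (?rs @ [r])"
  let ?Q = "set (take (Suc j) ss)"
  note hole = prefix_hole[OF ss(2,3) j(2)]
  have QT: "?Q \<subseteq> T b" "set (take j ss) \<subseteq> T b" using set_take_subset[of "Suc j" ss] set_take_subset[of j ss] ss(1) by simp_all
  have QP: "?Q \<subseteq> P" using QT S_sub by blast
  have dQ: "d x y \<le> \<delta>" if "x \<in> ?Q" "y \<in> ?Q" for x y
    using d_in_star[of x "\<not> a" b y] QT(1) that by blast
  have \<rho>R: "set (\<rho> @ ns) \<subseteq> R" "set (\<rho> @ ns @ [r]) \<subseteq> R" using \<rho> ns r QT T_R[of b] by auto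
  have sub: "set (?rs @ [r]) \<subseteq> P" "set (rs0 @ \<rho>) \<subseteq> P" using sub_R[OF \<rho>R(2)] by auto
  have conf: "?A \<in> conf" "?X \<in> conf" using alg_conf sub by auto
  have "card (?Q - {r}) = j" using hole(3) r by simp
  then have "?Q - {r} \<noteq> {}" using j by (metis card.empty not_one_le_zero)
  then obtain q where q: "q \<in> ?Q" "q \<noteq> r" by blast
  obtain Z Z' where Z: "C = Z + Z'" "size Z = 2 * h - j" "size Z' = j" "set_mset Z \<subseteq> L" "set_mset Z' \<subseteq> L"
    using C_part[of j] j by auto
  let ?Y = "Z + mset_set (?Q - {q})"
  have ZP: "set_mset Z \<subseteq> P" using Z LR_sub by auto
  have cQ: "card (?Q - {q}) = j" using hole(3) q(1) by simp
  have Y: "?Y \<in> conf" "r \<in># ?Y" using Z(2) ZP QP cQ j q r by (auto simp: configs_def)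
  have cY: "cnt R ?Y = j"
  proof -
    have "cnt R Z = 0" using cnt_disjoint[of Z R] Z(4) LR_disj by blast
    moreover have "cnt R (mset_set (?Q - {q})) = size (mset_set (?Q - {q}))"
      by (rule cnt_subset) (use QT(1) T_R[of b] in auto)
    ultimately show ?thesis using cQ by simp
  qed
  \<comment> \<open>Before stage \<open>j\<close> only the first \<open>j\<close> points were
    requested, so the configuration with its hole at the new point \<open>ss ! j\<close> has not yet
    become more expensive.\<close>
  have "W (rs0 @ \<rho>) (Z + mset_set (?Q - {ss ! j})) \<le> w0 + j * D"
  proof -
    let ?Y0 = "Z + mset_set (set (take j ss))"
    have Y0: "?Y0 \<in> conf"
      using Z(2) ZP QT(2) S_sub[of "\<not> a" b] hole(4) j by (auto simp: configs_def)
    have "W (rs0 @ \<rho>) ?Y0 = W rs0 ?Y0" by (rule W_cover[OF sub(2) Y0]) (use \<rho> in auto)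
    moreover have "md C ?Y0 \<le> card (set (take j ss)) * D"
      by (rule md_C_le[OF Z(1)]) (use Z hole(4) QT(2) S_sub[of "\<not> a" b] in auto)
    ultimately show ?thesis using W_rs0[OF Y0] hole(1,4) by simp
  qed
  moreover define \<epsilon> where "\<epsilon> = \<delta> * (real (length (ns @ [r])) / real j + 3)"
  ultimately have "W ((rs0 @ \<rho>) @ (ns @ [r])) ?Y \<le> w0 + j * D + \<epsilon>"
    unfolding \<epsilon>_def by (intro W_one_hole[OF _ hole(3) _ _ ZP QP])
      (use j Z(2) \<delta>_pos dQ sub ns r hole(2) q(1) in \<open>auto simp: subset_iff\<close>)
  moreover have "md ?A ?Y \<le> (real j - real (cnt R ?A)) * D + size ?A * m"
  proof -
    have "md ?A ?Y \<le> (real (cnt R ?Y) - real (cnt R ?A)) * D + size ?A * m"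
    proof (rule md_sides_le[where a = "\<not> a"])
      show "size ?A = size ?Y" using conf(1) Y(1) by (simp add: configs_def)
      show "set_mset ?A \<subseteq> R \<union> side (\<not> \<not> a)" using alg_two_sides[OF \<rho>R(1)] by auto
      show "set_mset ?Y \<subseteq> R \<union> side (\<not> \<not> a)" using Z(4) QT(1) T_R[of b] by auto
      show "cnt R ?A \<le> cnt R ?Y" unfolding cY using A by simp
    qed
    then show ?thesis unfolding cY .
  qed
  moreover have "D * (real (cnt R ?X) - real (cnt R ?A)) \<le> md ?A ?X" by (rule md_side_cnt[OF conf])
  moreover have "w0 + D * cnt R ?X \<le> W (?rs @ [r]) ?X" using W_first_lower[OF \<rho>R(2) conf(2)] by simp
  moreover have "W (?rs @ [r]) ?X + md ?A ?X \<le> W (?rs @ [r]) ?Y + md ?A ?Y" by (rule alg_min[OF sub(1) Y])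
  moreover have "size ?A = 2 * h" using conf by (simp add: configs_def)
  ultimately have "2 * (D * cnt R ?X) \<le> 2 * (D * j) + \<epsilon> + 2 * h * m"
    unfolding append_assoc by (simp add: left_diff_distrib right_diff_distrib mult.commute)
  moreover have "D * real (Suc j) \<le> D * cnt R ?X" using no D_pos by (intro mult_left_mono) auto
  ultimately have "2 * D \<le> \<epsilon> + 2 * h * m" by (simp add: distrib_left)
  then show False using first_len_bound[OF len j(1)] by (simp add: \<epsilon>_def)
qed

text \<open>Needed for the closing saturation of \<open>fill\<close>, which
  \<open>first_step\<close> does not control. The witness occupies the whole star, so its value does
  not rise at all and the comparison works for any number of requests.\<close>

lemma first_stay:
  assumes "set \<rho> \<subseteq> T b"
  shows "cnt R (alg (rs0 @ \<rho>)) \<le> h"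
  using assms
proof (induction \<rho> rule: rev_induct)
  case Nil
  then show ?case using start cnt_R_C by simp
next
  case (snoc r \<rho>)
  show ?case
  proof (rule ccontr)
    assume no: "\<not> ?thesis"
    let ?rs = "rs0 @ \<rho>"
    let ?A = "alg ?rs" and ?X = "alg (?rs @ [r])"
    have \<rho>R: "set \<rho> \<subseteq> R" "set (\<rho> @ [r]) \<subseteq> R" using snoc.prems T_R[of b] by auto
    have sub: "set (?rs @ [r]) \<subseteq> P" using sub_R[OF \<rho>R(2)] by simp
    have conf: "?A \<in> conf" "?X \<in> conf" using alg_conf sub by auto
    obtain Z Z' where Z: "C = Z + Z'" "size Z = 2 * h - h" "size Z' = h" "set_mset Z \<subseteq> L" "set_mset Z' \<subseteq> L"
      using C_part[of h] by auto
    let ?Y = "Z + mset_set (T b)"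
    have ZP: "set_mset Z \<subseteq> P" using Z LR_sub by auto
    have Y: "?Y \<in> conf" "r \<in># ?Y"
      using Z(2) ZP S_sub[of "\<not> a" b] card_S finite_S snoc.prems by (auto simp: configs_def)
    have cY: "cnt R ?Y = h"
      using cnt_disjoint[of Z R] Z(4) LR_disj cnt_subset[of "mset_set (T b)" R] T_R[of b] finite_S card_S by auto
    have "W (rs0 @ (\<rho> @ [r])) ?Y = W rs0 ?Y"
      by (rule W_cover[OF _ Y(1)]) (use sub snoc.prems finite_S in auto)
    moreover have "md C ?Y \<le> card (T b) * D"
      by (rule md_C_le[OF Z(1)]) (use Z card_S S_sub finite_S in auto)
    moreover have "md ?A ?Y \<le> (real h - real (cnt R ?A)) * D + size ?A * m"
      unfolding cY[symmetric]
    proof (rule md_sides_le[where a = "\<not> a"])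
      show "size ?A = size ?Y" using conf(1) Y(1) by (simp add: configs_def)
      show "set_mset ?A \<subseteq> R \<union> side (\<not> \<not> a)" using alg_two_sides[OF \<rho>R(1)] by auto
      show "set_mset ?Y \<subseteq> R \<union> side (\<not> \<not> a)" using Z(4) T_R[of b] finite_S by auto
      show "cnt R ?A \<le> cnt R ?Y" using snoc cY by simp
    qed
    moreover have "D * (real (cnt R ?X) - real (cnt R ?A)) \<le> md ?A ?X" by (rule md_side_cnt[OF conf])
    moreover have "w0 + D * cnt R ?X \<le> W (?rs @ [r]) ?X" using W_first_lower[OF \<rho>R(2) conf(2)] by simp
    moreover have "W (?rs @ [r]) ?X + md ?A ?X \<le> W (?rs @ [r]) ?Y + md ?A ?Y" by (rule alg_min[OF sub Y])
    moreover have "size ?A = 2 * h" using conf by (simp add: configs_def)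
    ultimately have "2 * (D * cnt R ?X) \<le> 2 * (D * h) + 2 * h * m"
      using W_rs0[OF Y(1)] cY card_S by (simp add: algebra_simps)
    moreover have "D * real (Suc h) \<le> D * cnt R ?X" using no D_pos by (intro mult_left_mono) auto
    ultimately have "D \<le> real h * m" by (simp add: algebra_simps)
    moreover have "0 \<le> real h * m" using m_pos by simp
    moreover have "4 * (real h * m) + 4 * m \<le> D" using D_ge by (simp add: algebra_simps)
    ultimately show False using m_pos by linarith
  qed
qed

definition good :: "nat \<Rightarrow> bool \<Rightarrow> 'p list \<Rightarrow> bool" where
  "good \<tau> b rs \<longleftrightarrow> (\<exists>\<rho>. rs = rs0 @ \<rho> \<and> set \<rho> \<subseteq> R) \<and> bnd \<tau> b rs \<and>
     T b \<subseteq> set_mset (alg rs) \<and> cnt R (alg rs) = h"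

lemma first_fill:
  "\<exists>\<rho>. set \<rho> \<subseteq> T b \<and> good 0 b (rs0 @ \<rho>) \<and>
     cost rs0 + \<delta> * real (\<Sum>j=1..<h. first_len j) + (D - \<delta>) * real h \<le> cost (rs0 @ \<rho>)"
proof -
  obtain ss where ss: "set ss = T b" "distinct ss" using finite_distinct_list[OF finite_S] by blast
  then have len: "length ss = h" using card_S distinct_card by metis
  have "\<exists>\<rho>. set \<rho> \<subseteq> set ss \<and> sat (set ss) (rs0 @ \<rho>) \<and> set ss \<subseteq> set_mset (alg (rs0 @ \<rho>)) \<and>
    cost rs0 + \<delta> * real (\<Sum>j=1..<h. first_len j) + (D - \<delta>) * real h \<le> cost (rs0 @ \<rho>)"
  proof (rule fill[where U = R])
    show "isolated \<delta> (set ss)" using isolated_side T_R ss by metis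
    show "cnt R (alg rs0) = 0" using start cnt_R_C by simp
    show "D \<le> d x y" if "x \<in> P" "x \<notin> R" "y \<in> R" for x y using d_out'[OF that(3,1,2)] by simp
    show "\<delta> \<le> D" using \<delta>_le_m m_le_D by simp
    show "set ss \<subseteq> R" using T_R ss by simp
  qed (use sub0 ss len h_pos first_step in auto)
  then obtain \<rho> where \<rho>: "set \<rho> \<subseteq> T b" "sat (T b) (rs0 @ \<rho>)" "T b \<subseteq> set_mset (alg (rs0 @ \<rho>))"
    "cost rs0 + \<delta> * real (\<Sum>j=1..<h. first_len j) + (D - \<delta>) * real h \<le> cost (rs0 @ \<rho>)"
    unfolding ss(1) by blast
  have "cnt R (alg (rs0 @ \<rho>)) = h"
    using first_stay[OF \<rho>(1)] cnt_T_ge[OF \<rho>(3)] cnt_R_split[of "alg (rs0 @ \<rho>)" b] by simp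
  then show ?thesis
    using \<rho> bnd_first[OF \<rho>(2,1)] T_R[of b] unfolding good_def by blast
qed

end

section \<open>Alternation between the two stars\<close>

context phase
begin

abbreviation inR :: "'p multiset \<Rightarrow> 'p multiset" where "inR A \<equiv> {#x \<in># A. x \<in> R#}"
abbreviation outR :: "'p multiset \<Rightarrow> 'p multiset" where "outR A \<equiv> {#x \<in># A. x \<notin> R#}"

lemma in_out_R: "inR A + outR A = A" by (rule filter_mset_split)

lemma md_split_R:
  "A \<in> conf \<Longrightarrow> B \<in> conf \<Longrightarrow> cnt R A = cnt R B \<Longrightarrow> md (inR A) (inR B) + md (outR A) (outR B) \<le> md A B"
  by (rule md_split) (use d_out d_in_side m_less_D in auto)

lemma outR_half:
  assumes "A \<in> conf" "set_mset A \<subseteq> L \<union> R" "cnt R A = h"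
  shows "size (outR A) = h" "set_mset (outR A) \<subseteq> L" "size (inR A) = h"
  using assms by (auto simp: size_filter_cnt configs_def)

lemma cnt_T_inR: "cnt (T b) (inR A) = cnt (T b) A"
proof -
  have "{#x \<in># A. x \<in> R \<and> x \<in> T b#} = {#x \<in># A. x \<in> T b#}"
    by (rule filter_mset_cong) (use T_R[of b] in auto)
  then show ?thesis by (simp add: cnt_def filter_filter_mset)
qed

lemma md_inR_ge:
  assumes "A \<in> conf" "B \<in> conf" "cnt R A = cnt R B"
  shows "m * (real (cnt (T b) B) - real (cnt (T b) A)) \<le> md (inR A) (inR B)"
proof -
  have "inR A \<in> configs P (cnt R A)" "inR B \<in> configs P (cnt R A)"
    using assms side_sub by (auto simp: configs_def size_filter_cnt)
  from md_star_cnt[OF this, of "\<not> a" b] show ?thesis by (simp add: cnt_T_inR)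
qed

lemma good_sub: "good \<tau> b rs \<Longrightarrow> set rs \<subseteq> P"
  unfolding good_def using sub_R by blast

lemma good_two_sides:
  assumes "good \<tau> b rs" "set \<rho> \<subseteq> R"
  shows "set_mset (alg (rs @ \<rho>)) \<subseteq> L \<union> R"
proof -
  obtain \<rho>0 where "rs = rs0 @ \<rho>0" "set \<rho>0 \<subseteq> R" using assms(1) unfolding good_def by blast
  then show ?thesis using alg_two_sides[of "\<rho>0 @ \<rho>"] assms(2) by simp
qed

lemma slack:
  assumes "\<tau> + 3 * h + 1 \<le> 2 * \<mu>"
  shows "m * \<tau> + 3 * (h * m) + m \<le> 2 * D"
  using m_\<tau>_le[of \<tau> "3 * h + 1"] assms by (simp add: algebra_simps)

lemma hm_D: "3 * (h * m) < 2 * D"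
proof -
  have "0 \<le> real h * m" using m_pos by simp
  moreover have "4 * (real h * m) + 4 * m \<le> D" using D_ge by (simp add: algebra_simps)
  ultimately show ?thesis using m_pos by linarith
qed

lemma bnd_lower:
  assumes "bnd \<tau> b rs" "Z \<in> conf"
  shows "w0 + 2 * h * (m * \<tau>) + (D - m * \<tau>) * cnt R Z \<le> W rs Z"
    "w0 + 2 * h * D + h * (m * \<tau>) - D * cnt R Z \<le> W rs Z"
  using assms unfolding bnd_def by blast+

lemma bnd_upper:
  assumes "bnd \<tau> b rs" "set_mset Z \<subseteq> L" "size Z = h"
  shows "W rs (mset_set (T b) + Z) \<le> w0 + h * D + h * (m * \<tau>) + h * m"
  using assms unfolding bnd_def by blast

text \<open>The comparison carries an error of \<open>3 * h * m\<close>: one \<open>h * m\<close>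
  from the upper bound in \<open>bnd\<close>, one for the witness changing the star, one for moving
  the algorithm's servers in \<open>R\<close> onto the star. An extra server in \<open>R\<close>
  costs \<open>2 * D - m * \<tau>\<close> more than it saves, a withdrawn one \<open>2 * D\<close>.
  The hypothesis on \<open>\<tau>\<close> keeps the first above the error.\<close>

lemma good_stay:
  assumes good: "good \<tau> b rs" and \<tau>: "\<tau> + 3 * h + 1 \<le> 2 * \<mu>" and "set \<rho> \<subseteq> T (\<not> b)"
  shows "cnt R (alg (rs @ \<rho>)) = h"
  using assms(3)
proof (induction \<rho> rule: rev_induct)
  case Nil
  then show ?case using good by (simp add: good_def)
next
  case (snoc r \<rho>)
  let ?rs = "rs @ \<rho>"
  let ?A = "alg ?rs" and ?X = "alg (?rs @ [r])"
  have bnd: "bnd \<tau> b rs" using good by (simp add: good_def)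
  have \<rho>R: "set \<rho> \<subseteq> R" using snoc.prems T_R[of "\<not> b"] by auto
  have sub: "set (?rs @ [r]) \<subseteq> P" "set rs \<subseteq> P"
    using good_sub[OF good] snoc.prems S_sub[of "\<not> a" "\<not> b"] by auto
  have conf: "?A \<in> conf" "?X \<in> conf" using alg_conf sub by auto
  have cA: "cnt R ?A = h" using snoc by auto
  note half = outR_half[OF conf(1) good_two_sides[OF good \<rho>R] cA]
  have oP: "set_mset (outR ?A) \<subseteq> P" using half(2) LR_sub by auto
  define Y where "Y b = mset_set (T b) + outR ?A" for b
  have Y: "Y b \<in> conf" for b unfolding Y_def using T_conf half(1) oP by simp
  have "W (rs @ (\<rho> @ [r])) (Y (\<not> b)) = W rs (Y (\<not> b))"
    by (rule W_cover[OF _ Y]) (use sub snoc.prems finite_S in \<open>auto simp: Y_def\<close>)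
  moreover have "W rs (Y (\<not> b)) \<le> W rs (Y b) + md (Y b) (Y (\<not> b))" by (rule W_lip[OF sub(2) Y Y])
  moreover have "md (Y b) (Y (\<not> b)) \<le> md (mset_set (T b)) (mset_set (T (\<not> b))) + md (outR ?A) (outR ?A)"
    unfolding Y_def by (rule matching_dist_union) (auto simp: card_S)
  moreover have "W rs (Y b) \<le> w0 + h * D + h * (m * \<tau>) + h * m"
    unfolding Y_def by (rule bnd_upper[OF bnd half(2,1)])
  moreover have "md ?A (Y (\<not> b)) \<le> md (inR ?A) (mset_set (T (\<not> b))) + md (outR ?A) (outR ?A)"
    unfolding Y_def using matching_dist_union[of "inR ?A" "mset_set (T (\<not> b))" "outR ?A" "outR ?A" d]
    by (simp only: in_out_R half(3)) (simp add: card_S)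
  moreover have "md (inR ?A) (mset_set (T (\<not> b))) \<le> h * m"
  proof -
    have "d x y \<le> m" if "x \<in># inR ?A" "y \<in># mset_set (T (\<not> b))" for x y
      using that T_R[of "\<not> b"] finite_S d_in_side[of x "\<not> a" y] by auto
    then show ?thesis
      using matching_dist_le_const[of "inR ?A" "mset_set (T (\<not> b))" d m] half(3) card_S by simp
  qed
  moreover have "md (outR ?A) (outR ?A) \<le> 0" by (rule md_refl_le[OF oP])
  moreover have "W (?rs @ [r]) ?X + md ?A ?X \<le> W (?rs @ [r]) (Y (\<not> b)) + md ?A (Y (\<not> b))"
    by (rule alg_min[OF sub(1) Y]) (use snoc.prems finite_S in \<open>auto simp: Y_def\<close>)
  moreover have "W rs ?X \<le> W (?rs @ [r]) ?X" using W_mono[of rs "\<rho> @ [r]" ?X] sub conf by simp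
  ultimately have up: "W rs ?X + md ?A ?X \<le> w0 + h * D + h * (m * \<tau>) + 3 * (h * m)"
    using md_switch[of b] by simp
  show ?case
  proof (rule ccontr)
    assume "cnt R (alg (rs @ \<rho> @ [r])) \<noteq> h"
    then consider "h < cnt R ?X" | "cnt R ?X < h" by fastforce
    then show False
    proof cases
      case 1
      define q where "q = real (cnt R ?X) - real h"
      have q: "1 \<le> q" "real (cnt R ?X) = real h + q" using 1 by (auto simp: q_def)
      have "D * q \<le> md ?A ?X" using md_side_cnt[OF conf, of "\<not> a"] cA q by simp
      moreover have "w0 + 2 * h * (m * \<tau>) + (D - m * \<tau>) * (real h + q) \<le> W rs ?X"
        using bnd_lower(1)[OF bnd conf(2)] q(2) by simp
      ultimately have "q * (2 * D - m * \<tau>) \<le> 3 * (h * m)" using up by (simp add: algebra_simps)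
      moreover have "1 * (2 * D - m * \<tau>) \<le> q * (2 * D - m * \<tau>)"
      proof (rule mult_right_mono[OF q(1)])
        have "0 \<le> real h * m" using m_pos by simp
        then show "0 \<le> 2 * D - m * \<tau>" using slack[OF \<tau>] m_pos by linarith
      qed
      ultimately have "2 * D - m * \<tau> \<le> 3 * (h * m)" by simp
      then show False using slack[OF \<tau>] m_pos by linarith
    next
      case 2
      define q where "q = real h - real (cnt R ?X)"
      have q: "1 \<le> q" "real (cnt R ?X) = real h - q" using 2 by (auto simp: q_def)
      have "D * q \<le> md ?A ?X"
        using md_side_cnt[OF conf(2,1), of "\<not> a"] md_sym[OF conf] cA q by simp
      moreover have "w0 + 2 * h * D + h * (m * \<tau>) - D * (real h - q) \<le> W rs ?X"
        using bnd_lower(2)[OF bnd conf(2)] q(2) by simp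
      ultimately have "2 * (q * D) \<le> 3 * (h * m)" using up by (simp add: algebra_simps)
      moreover have "1 * D \<le> q * D" using q(1) D_pos by (intro mult_right_mono) auto
      ultimately show False using hm_D by linarith
    qed
  qed
qed

text \<open>
  Configurations that already have more than \<open>h\<close> servers on the side \<open>R\<close> are excluded
  here by the slack in the bounds at scale \<open>D\<close>.
\<close>

lemma W_lift:
  assumes good: "good \<tau> b rs" and \<tau>: "\<tau> + 3 * h + 1 \<le> 2 * \<mu>"
    and X: "X \<in> conf" "set_mset X \<subseteq> L \<union> R" "cnt R X = h"
  shows "W rs (mset_set (T b) + outR X) + m * cnt (T (\<not> b)) X \<le> W rs X"
proof -
  have bnd: "bnd \<tau> b rs" and rs: "set rs \<subseteq> P" using good good_sub by (auto simp: good_def)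
  note half = outR_half[OF X]
  let ?Y = "mset_set (T b) + outR X"
  have Y: "?Y \<in> conf" using T_conf half LR_sub by auto
  have sX: "cnt (T (\<not> b)) X \<le> h" using cnt_R_split[of X b] X(3) by simp
  show ?thesis
  proof (rule satD[OF bnd_sat[OF bnd] X(1)])
    fix V assume V: "V \<in> conf" "T b \<subseteq> set_mset V"
    have cV: "h \<le> cnt (T b) V" "cnt R V = cnt (T b) V + cnt (T (\<not> b)) V"
      using cnt_T_ge[OF V(2)] cnt_R_split by auto
    show "W rs ?Y + m * cnt (T (\<not> b)) X \<le> W rs V + md V X"
    proof (cases "cnt R V = h")
      case True
      \<comment> \<open>\<open>V\<close> covers the star with exactly \<open>h\<close> servers in
        \<open>R\<close>, so inside \<open>R\<close> it has nothing else.\<close>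
      have "inR V = mset_set (T b)"
      proof -
        have "mset_set (T b) \<subseteq># inR V" using V(2) T_R[of b] by (intro mset_set_subseteq) auto
        moreover have "size (mset_set (T b)) = size (inR V)" using True card_S by (simp add: size_filter_cnt)
        ultimately show ?thesis by (metis mset_subset_size nless_le subset_mset.order_iff_strict)
      qed
      then have Veq: "V = mset_set (T b) + outR V" using in_out_R[of V] by metis
      have "md (inR V) (inR X) + md (outR V) (outR X) \<le> md V X"
        by (rule md_split_R[OF V(1) X(1)]) (use True X in simp)
      moreover have "m * (real (cnt (T (\<not> b)) X) - real (cnt (T (\<not> b)) V)) \<le> md (inR V) (inR X)"
        by (rule md_inR_ge[OF V(1) X(1)]) (use True X in simp)
      moreover have "cnt (T (\<not> b)) V = 0" using True cV by simp
      moreover have "W rs ?Y \<le> W rs V + md V ?Y" by (rule W_lip[OF rs V(1) Y])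
      moreover have "md V ?Y \<le> md (mset_set (T b)) (mset_set (T b)) + md (outR V) (outR X)"
        by (subst Veq, rule matching_dist_union)
          (use V(1) True half(1) in \<open>auto simp: size_filter_cnt configs_def\<close>)
      moreover have "md (mset_set (T b)) (mset_set (T b)) \<le> 0"
        by (rule md_refl_le) (use S_sub finite_S in auto)
      ultimately show ?thesis by simp
    next
      case False
      define q where "q = real (cnt R V) - real h"
      have q: "1 \<le> q" "real (cnt R V) = real h + q" using False cV by (auto simp: q_def)
      have "D * q \<le> md V X"
        using md_side_cnt[OF X(1) V(1), of "\<not> a"] md_sym[OF V(1) X(1)] X(3) q by simp
      moreover have "w0 + 2 * h * (m * \<tau>) + (D - m * \<tau>) * (real h + q) \<le> W rs V"
        using bnd_lower(1)[OF bnd V(1)] q(2) by simp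
      moreover have "W rs ?Y \<le> w0 + h * D + h * (m * \<tau>) + h * m" by (rule bnd_upper[OF bnd half(2,1)])
      moreover have "m * cnt (T (\<not> b)) X \<le> m * h" using sX m_pos by (intro mult_left_mono) auto
      moreover have "1 * (2 * D - m * \<tau>) \<le> q * (2 * D - m * \<tau>)"
      proof (rule mult_right_mono[OF q(1)])
        have "0 \<le> real h * m" using m_pos by simp
        then show "0 \<le> 2 * D - m * \<tau>" using slack[OF \<tau>] m_pos by linarith
      qed
      moreover have "2 * (real h * m) \<le> 2 * D - m * \<tau>"
      proof -
        have "0 \<le> real h * m" using m_pos by simp
        then show ?thesis using slack[OF \<tau>] m_pos by linarith
      qed
      ultimately show ?thesis by (simp add: algebra_simps)
    qed
  qed
qed

text \<open>The argument of \<open>first_step\<close> one scale lower. The reference value is that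
  of \<open>?B\<close>, which keeps the algorithm's servers outside \<open>R\<close>.
  \<open>W_lift\<close> measures the chosen configuration against the analogous one with its own
  outside part, and \<open>md_split_R\<close> lets the distance between the two outside parts
  cancel.\<close>

lemma next_step:
  assumes good: "good \<tau> b rs" and \<tau>: "\<tau> + 3 * h + 1 \<le> 2 * \<mu>"
    and ss: "set ss = T (\<not> b)" "distinct ss" "length ss = h"
    and j: "1 \<le> j" "j < h" and \<rho>: "set \<rho> \<subseteq> set (take j ss)" and ns: "set ns \<subseteq> set (take (Suc j) ss)"
    and len: "length ns < next_len j" and r: "r \<in> set (take (Suc j) ss)"
    and A: "cnt (T (\<not> b)) (alg (rs @ \<rho> @ ns)) \<le> j"
  shows "cnt (T (\<not> b)) (alg (rs @ \<rho> @ ns @ [r])) \<le> j"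
proof (rule ccontr)
  assume no: "\<not> ?thesis"
  let ?rs = "rs @ \<rho> @ ns"
  let ?A = "alg ?rs" and ?X = "alg (?rs @ [r])" and ?T = "T (\<not> b)"
  let ?Q = "set (take (Suc j) ss)"
  note hole = prefix_hole[OF ss(2,3) j(2)]
  have QT: "?Q \<subseteq> ?T" "set (take j ss) \<subseteq> ?T"
    using set_take_subset[of "Suc j" ss] set_take_subset[of j ss] ss(1) by simp_all
  have TP: "?T \<subseteq> P" by (rule S_sub)
  have QP: "?Q \<subseteq> P" using QT TP by blast
  have dQ: "d x y \<le> \<delta>" if "x \<in> ?Q" "y \<in> ?Q" for x y
    using d_in_star[of x "\<not> a" "\<not> b" y] QT(1) that by blast
  have \<rho>T: "set (\<rho> @ ns) \<subseteq> ?T" "set (\<rho> @ ns @ [r]) \<subseteq> ?T" using \<rho> ns r QT by auto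
  then have \<rho>R: "set (\<rho> @ ns) \<subseteq> R" "set (\<rho> @ ns @ [r]) \<subseteq> R" using T_R[of "\<not> b"] by auto
  have rs: "set rs \<subseteq> P" by (rule good_sub[OF good])
  have sub: "set (?rs @ [r]) \<subseteq> P" "set (rs @ \<rho>) \<subseteq> P" using rs \<rho>T TP by auto
  have conf: "?A \<in> conf" "?X \<in> conf" using alg_conf sub by auto
  have cR: "cnt R ?A = h" "cnt R ?X = h"
    using good_stay[OF good \<tau> \<rho>T(1)] good_stay[OF good \<tau> \<rho>T(2)] by simp_all
  have two: "set_mset ?A \<subseteq> L \<union> R" "set_mset ?X \<subseteq> L \<union> R"
    using good_two_sides[OF good \<rho>R(1)] good_two_sides[OF good \<rho>R(2)] by simp_all
  note hA = outR_half[OF conf(1) two(1) cR(1)]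
  note hX = outR_half[OF conf(2) two(2) cR(2)]
  have oP: "set_mset (outR ?A) \<subseteq> P" "set_mset (outR ?X) \<subseteq> P" using hA(2) hX(2) LR_sub by auto
  let ?B = "mset_set (T b) + outR ?A"
  have B: "?B \<in> conf" using T_conf hA(1) oP(1) by simp
  \<comment> \<open>One \<open>m * cnt ?T ?X\<close> comes from \<open>W_lift\<close>, the other
    from the move.\<close>
  have lower: "W rs ?B + (2 * (m * cnt ?T ?X) - m * cnt ?T ?A) \<le> W (?rs @ [r]) ?X + md ?A ?X"
  proof -
    let ?B' = "mset_set (T b) + outR ?X"
    have B': "?B' \<in> conf" using T_conf hX(1) oP(2) by simp
    have "W rs ?X \<le> W (?rs @ [r]) ?X" using W_mono[of rs "\<rho> @ ns @ [r]" ?X] sub conf by simp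
    moreover have "W rs ?B' + m * cnt ?T ?X \<le> W rs ?X" by (rule W_lift[OF good \<tau> conf(2) two(2) cR(2)])
    moreover have "W rs ?B \<le> W rs ?B' + md ?B' ?B" by (rule W_lip[OF rs B' B])
    moreover have "md ?B' ?B \<le> md (mset_set (T b)) (mset_set (T b)) + md (outR ?X) (outR ?A)"
      by (rule matching_dist_union) (use hA(1) hX(1) in auto)
    moreover have "md (mset_set (T b)) (mset_set (T b)) \<le> 0"
      by (rule md_refl_le) (use S_sub finite_S in auto)
    moreover have "md (outR ?X) (outR ?A) = md (outR ?A) (outR ?X)"
      by (rule md_sym[where k = h]) (use hA(1) hX(1) oP in \<open>auto simp: configs_def\<close>)
    moreover have "md (inR ?A) (inR ?X) + md (outR ?A) (outR ?X) \<le> md ?A ?X"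
      by (rule md_split_R[OF conf]) (use cR in simp)
    moreover have "m * (real (cnt ?T ?X) - real (cnt ?T ?A)) \<le> md (inR ?A) (inR ?X)"
      by (rule md_inR_ge[OF conf]) (use cR in simp)
    ultimately show ?thesis by (simp add: right_diff_distrib)
  qed
  have "card (?Q - {r}) = j" using hole(3) r by simp
  then have "?Q - {r} \<noteq> {}" using j by (metis card.empty not_one_le_zero)
  then obtain q where q: "q \<in> ?Q" "q \<noteq> r" by blast
  \<comment> \<open>The witness leaves \<open>h - j\<close> servers on star \<open>b\<close>, has
    \<open>j\<close> in the new star, and agrees with the algorithm outside
    \<open>R\<close>.\<close>
  have "h - j \<le> size (mset_set (T b))" using card_S by simp
  then obtain Z where Z: "Z \<subseteq># mset_set (T b)" "size Z = h - j" using submultiset_ex by blast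
  then obtain Z' where Z': "mset_set (T b) = Z + Z'" by (metis subset_mset.le_iff_add)
  have sZ': "size Z' = j" using arg_cong[OF Z', of size] Z(2) j card_S by simp
  have ZT: "set_mset Z \<subseteq> T b" "set_mset Z' \<subseteq> T b"
    using Z' finite_S by (metis Un_upper1 Un_upper2 finite_set_mset_mset_set set_mset_union)+
  then have ZP: "set_mset Z \<subseteq> P" "set_mset Z' \<subseteq> P" using S_sub by blast+
  let ?Z = "outR ?A + Z"
  have cQ: "card (?Q - {q}) = j" using hole(3) q(1) by simp
  let ?Y = "?Z + mset_set (?Q - {q})"
  have sZZ: "size ?Z + j = 2 * h" "set_mset ?Z \<subseteq> P" using hA(1) Z(2) j ZP oP by auto
  have Y: "?Y \<in> conf" "r \<in># ?Y" using sZZ QP cQ q r by (auto simp: configs_def)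
  have "W (rs @ \<rho>) (?Z + mset_set (?Q - {ss ! j})) \<le> W rs ?B + j * m"
  proof -
    let ?Y0 = "?Z + mset_set (set (take j ss))"
    have Y0: "?Y0 \<in> conf" using sZZ QT(2) TP hole(4) by (auto simp: configs_def)
    have "W (rs @ \<rho>) ?Y0 = W rs ?Y0" by (rule W_cover[OF sub(2) Y0]) (use \<rho> in auto)
    also have "\<dots> \<le> W rs ?B + md ?B ?Y0" by (rule W_lip[OF rs B Y0])
    also have "md ?B ?Y0 \<le> j * m"
    proof -
      have "md (?Z + Z') ?Y0 \<le> md ?Z ?Z + md Z' (mset_set (set (take j ss)))"
        by (rule matching_dist_union) (use sZ' hole(4) in auto)
      moreover have "md ?B ?Y0 = md (?Z + Z') ?Y0" unfolding Z' by (simp only: ac_simps)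
      moreover have "md ?Z ?Z \<le> 0" by (rule md_refl_le[OF sZZ(2)])
      moreover have "md Z' (mset_set (set (take j ss))) \<le> size Z' * m"
      proof (rule matching_dist_le_const)
        show "d x y \<le> m" if "x \<in># Z'" "y \<in># mset_set (set (take j ss))" for x y
          using that ZT(2) QT(2) T_R[of b] T_R[of "\<not> b"] by (intro d_in_side[of _ "\<not> a"]) auto
      qed (use sZ' hole(4) in auto)
      ultimately show ?thesis using sZ' by simp
    qed
    finally show ?thesis using hole(1) by simp
  qed
  moreover define \<epsilon> where "\<epsilon> = \<delta> * (real (length (ns @ [r])) / real j + 3)"
  ultimately have "W ((rs @ \<rho>) @ (ns @ [r])) ?Y \<le> W rs ?B + j * m + \<epsilon>"
    unfolding \<epsilon>_def
    by (intro W_one_hole[OF _ hole(3) _ _ sZZ(2) QP])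
      (use j sZZ(1) \<delta>_pos dQ sub ns r hole(2) q(1) in \<open>auto simp: subset_iff\<close>)
  moreover have "md ?A ?Y \<le> (real j - real (cnt ?T ?A)) * m + h * \<delta>"
  proof -
    let ?Y' = "Z + mset_set (?Q - {q})"
    have cY: "cnt ?T ?Y' = j"
    proof -
      have "cnt ?T Z = 0" using cnt_disjoint[of Z ?T] ZT(1) S_disj by blast
      moreover have "cnt ?T (mset_set (?Q - {q})) = size (mset_set (?Q - {q}))"
        by (rule cnt_subset) (use QT(1) in auto)
      ultimately show ?thesis using cQ by simp
    qed
    have "md (inR ?A) ?Y' \<le> (real (cnt ?T ?Y') - real (cnt ?T (inR ?A))) * m + size (inR ?A) * \<delta>"
    proof (rule md_stars_le)
      show "size (inR ?A) = size ?Y'" unfolding hA(3) using Z(2) cQ j by simp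
      show "set_mset (inR ?A) \<subseteq> R" by auto
      show "set_mset ?Y' \<subseteq> R" using ZT(1) QT(1) T_R[of b] T_R[of "\<not> b"] by auto
      show "cnt ?T (inR ?A) \<le> cnt ?T ?Y'" unfolding cY cnt_T_inR using A by simp
    qed
    then have "md (inR ?A) ?Y' \<le> (real j - real (cnt ?T ?A)) * m + h * \<delta>"
      unfolding cY cnt_T_inR hA(3) .
    moreover have "md (inR ?A + outR ?A) (?Y' + outR ?A) \<le> md (inR ?A) ?Y' + md (outR ?A) (outR ?A)"
    proof (rule matching_dist_union)
      show "size (inR ?A) = size ?Y'" unfolding hA(3) using Z(2) cQ j by simp
    qed simp
    moreover have "md (outR ?A) (outR ?A) \<le> 0" by (rule md_refl_le[OF oP(1)])
    moreover have "inR ?A + outR ?A = ?A" by (rule in_out_R)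
    moreover have "?Y' + outR ?A = ?Y" by (simp only: union_ac)
    ultimately show ?thesis by simp
  qed
  moreover have "W (?rs @ [r]) ?X + md ?A ?X \<le> W (?rs @ [r]) ?Y + md ?A ?Y" by (rule alg_min[OF sub(1) Y])
  ultimately have "2 * (m * cnt ?T ?X) \<le> 2 * (m * j) + \<epsilon> + h * \<delta>"
    using lower unfolding append_assoc by (simp add: left_diff_distrib right_diff_distrib mult.commute)
  moreover have "m * real (Suc j) \<le> m * cnt ?T ?X" using no m_pos by (intro mult_left_mono) auto
  ultimately have "2 * m \<le> \<epsilon> + h * \<delta>" by (simp add: distrib_left)
  then show False using next_len_bound[OF len j(1)] by (simp add: \<epsilon>_def)
qed

lemma next_fill:
  assumes good: "good \<tau> b rs" and \<tau>: "\<tau> + 3 * h + 1 \<le> 2 * \<mu>"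
  shows "\<exists>\<rho>. set \<rho> \<subseteq> T (\<not> b) \<and> good (Suc \<tau>) (\<not> b) (rs @ \<rho>) \<and>
     cost rs + \<delta> * real (\<Sum>j=1..<h. next_len j) + (m - \<delta>) * real h \<le> cost (rs @ \<rho>)"
proof -
  obtain ss where ss: "set ss = T (\<not> b)" "distinct ss" using finite_distinct_list[OF finite_S] by blast
  then have len: "length ss = h" using card_S distinct_card by metis
  have bnd: "bnd \<tau> b rs" and rs: "set rs \<subseteq> P" using good good_sub by (auto simp: good_def)
  have "\<exists>\<rho>. set \<rho> \<subseteq> set ss \<and> sat (set ss) (rs @ \<rho>) \<and> set ss \<subseteq> set_mset (alg (rs @ \<rho>)) \<and>
    cost rs + \<delta> * real (\<Sum>j=1..<h. next_len j) + (m - \<delta>) * real h \<le> cost (rs @ \<rho>)"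
  proof (rule fill[where U = "T (\<not> b)"])
    show "isolated \<delta> (set ss)" using isolated_side T_R ss by metis
    show "cnt (T (\<not> b)) (alg rs) = 0"
      using good cnt_T_ge[of b "alg rs"] cnt_R_split[of "alg rs" b] by (simp add: good_def)
    show "m \<le> d x y" if "x \<in> P" "x \<notin> T (\<not> b)" "y \<in> T (\<not> b)" for x y using star_sep that by blast
    show "\<delta> \<le> m" by (rule \<delta>_le_m)
  qed (use rs ss len h_pos next_step[OF good \<tau> ss len] in auto)
  then obtain \<rho> where \<rho>: "set \<rho> \<subseteq> T (\<not> b)" "sat (T (\<not> b)) (rs @ \<rho>)" "T (\<not> b) \<subseteq> set_mset (alg (rs @ \<rho>))"
    "cost rs + \<delta> * real (\<Sum>j=1..<h. next_len j) + (m - \<delta>) * real h \<le> cost (rs @ \<rho>)"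
    unfolding ss(1) by blast
  have "bnd (Suc \<tau>) (\<not> b) (rs @ \<rho>)"
    by (rule bnd_step[OF bnd rs \<rho>(1,2)]) (use \<tau> h_pos in simp)
  moreover have "\<exists>\<rho>'. rs @ \<rho> = rs0 @ \<rho>' \<and> set \<rho>' \<subseteq> R"
  proof -
    obtain \<rho>0 where "rs = rs0 @ \<rho>0" "set \<rho>0 \<subseteq> R" using good unfolding good_def by blast
    then show ?thesis using \<rho>(1) T_R[of "\<not> b"] by (intro exI[of _ "\<rho>0 @ \<rho>"]) auto
  qed
  ultimately show ?thesis
    using \<rho> good_stay[OF good \<tau> \<rho>(1)] unfolding good_def by blast
qed

end

section \<open>Gain and loss of one phase\<close>

context two_sided_space
begin

definition next_gain :: real where
  "next_gain = \<delta> * real (\<Sum>j=1..<h. next_len j) + (m - \<delta>) * real h"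

text \<open>Only \<open>2 * \<mu> - 3 * h\<close> alternations are credited, the range in which
  \<open>good_stay\<close> controls the algorithm. The last term is the transfer of its remaining
  \<open>h\<close> servers.\<close>

definition gain :: real where
  "gain = \<delta> * real (\<Sum>j=1..<h. first_len j) + (D - \<delta>) * real h
     + real (2 * \<mu> - 3 * h) * next_gain + real h * D"

text \<open>Since \<open>m = \<kappa> * \<delta>\<close>, \<open>4 * h * \<kappa>\<close> rounds
  make up the defect \<open>4 * h * m\<close> of \<open>near_cone\<close>, and \<open>2 * h\<close>
  more the \<open>2 * h * \<delta>\<close> lost in \<open>sharpen_rounds\<close>.\<close>

definition sharpen_len :: nat where
  "sharpen_len = 4 * h * \<kappa> + 2 * h"

text \<open>The last term charges \<open>m\<close> for every request of the sharpening rounds and of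
  the final \<open>descent\<close>.\<close>

definition loss :: real where
  "loss = real h * D + real (2 * \<mu> - 1) * (real h * m) + real (sharpen_len * (2 * h) + 2 * h) * m"

end

locale phase_adv = phase P d D S h \<kappa> \<mu> m \<delta> alg a rs0 + adv: work_function P d D h B0
  for P :: "'p set" and d D S h \<kappa> \<mu> m \<delta> alg a rs0 B0
begin

abbreviation star :: "bool \<Rightarrow> 'p multiset" where "star b \<equiv> mset_set (T b)"

lemma star_conf: "star b \<in> adv.conf"
  using S_sub card_S finite_S by (auto simp: configs_def)

lemma adv_fill:
  assumes "set rs \<subseteq> P" "set \<rho> \<subseteq> T b" "B \<in> adv.conf"
  shows "adv.W (rs @ \<rho>) (star b) \<le> adv.W rs B + md B (star b)"
proof -
  have sub: "set (rs @ \<rho>) \<subseteq> P" using assms(1,2) S_sub by fastforce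
  have "adv.W (rs @ \<rho>) (star b) = adv.W rs (star b)"
    by (rule adv.W_cover[OF sub star_conf]) (use assms(2) finite_S in auto)
  then show ?thesis using adv.W_lip[OF assms(1,3) star_conf] by simp
qed

lemma adv_walk:
  assumes "set rs \<subseteq> P" "B \<in> adv.conf" "set_mset B \<subseteq> R" "set \<rho> \<subseteq> R"
  shows "\<exists>B'\<in>adv.conf. set_mset B' \<subseteq> R \<and> adv.W (rs @ \<rho>) B' \<le> adv.W rs B + real (length \<rho>) * m"
  using assms(4)
proof (induction \<rho> rule: rev_induct)
  case Nil
  then show ?case using assms by auto
next
  case (snoc r \<rho>)
  then obtain B' where B': "B' \<in> adv.conf" "set_mset B' \<subseteq> R"
    "adv.W (rs @ \<rho>) B' \<le> adv.W rs B + real (length \<rho>) * m" by auto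
  have r: "r \<in> R" "r \<in> P" using snoc.prems side_sub by auto
  have "B' \<noteq> {#}" using B'(1) h_pos by (auto simp: configs_def)
  then obtain c E where c: "B' = add_mset c E" by (meson multiset_cases)
  have E: "add_mset r E \<in> adv.conf" "set_mset (add_mset r E) \<subseteq> R" "c \<in> R" "set_mset E \<subseteq> P"
    using B' c r by (auto simp: configs_def)
  have sub: "set (rs @ \<rho>) \<subseteq> P" using assms(1) snoc.prems side_sub by fastforce
  have "adv.W ((rs @ \<rho>) @ [r]) (add_mset r E) = adv.W (rs @ \<rho>) (add_mset r E)"
    by (rule adv.W_cover[OF _ E(1)]) (use sub r in auto)
  also have "\<dots> \<le> adv.W (rs @ \<rho>) B' + md B' (add_mset r E)" by (rule adv.W_lip[OF sub B'(1) E(1)])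
  also have "md B' (add_mset r E) \<le> m"
  proof -
    have "md ({#c#} + E) ({#r#} + E) \<le> md {#c#} {#r#} + md E E" by (rule matching_dist_union) auto
    moreover have "md E E \<le> 0" by (rule md_refl_le[OF E(4)])
    moreover have "md {#c#} {#r#} \<le> m"
      using matching_dist_le_const[of "{#c#}" "{#r#}" d m] d_in_side[OF E(3) r(1)] by auto
    ultimately show ?thesis by (simp add: c)
  qed
  finally show ?case using E B'(3) by (intro bexI[of _ "add_mset r E"]) (auto simp: algebra_simps)
qed

lemma good_fills:
  assumes "B \<in> adv.conf" "n \<le> 2 * \<mu> - 3 * h"
  shows "\<exists>\<rho> b. set \<rho> \<subseteq> R \<and> good n b (rs0 @ \<rho>) \<and>
    cost rs0 + \<delta> * real (\<Sum>j=1..<h. first_len j) + (D - \<delta>) * real h + n * next_gain \<le> cost (rs0 @ \<rho>) \<and>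
    adv.W (rs0 @ \<rho>) (star b) \<le> adv.W rs0 B + h * D + n * (h * m)"
  using assms(2)
proof (induction n)
  case 0
  obtain \<rho> where \<rho>: "set \<rho> \<subseteq> T True" "good 0 True (rs0 @ \<rho>)"
    "cost rs0 + \<delta> * real (\<Sum>j=1..<h. first_len j) + (D - \<delta>) * real h \<le> cost (rs0 @ \<rho>)"
    using first_fill by blast
  have "adv.W (rs0 @ \<rho>) (star True) \<le> adv.W rs0 B + h * D"
    using adv_fill[OF sub0 \<rho>(1) assms(1)] md_le[OF assms(1) star_conf[of True]] by linarith
  then show ?case using \<rho> T_R[of True] by (intro exI[of _ \<rho>] exI[of _ True]) auto
next
  case (Suc n)
  then obtain \<rho> b where \<rho>: "set \<rho> \<subseteq> R" "good n b (rs0 @ \<rho>)"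
    "cost rs0 + \<delta> * real (\<Sum>j=1..<h. first_len j) + (D - \<delta>) * real h + n * next_gain \<le> cost (rs0 @ \<rho>)"
    "adv.W (rs0 @ \<rho>) (star b) \<le> adv.W rs0 B + h * D + n * (h * m)" by auto
  have "n + 3 * h + 1 \<le> 2 * \<mu>" using Suc.prems by simp
  from next_fill[OF \<rho>(2) this] obtain \<rho>' where \<rho>': "set \<rho>' \<subseteq> T (\<not> b)" "good (Suc n) (\<not> b) ((rs0 @ \<rho>) @ \<rho>')"
    "cost (rs0 @ \<rho>) + next_gain \<le> cost ((rs0 @ \<rho>) @ \<rho>')"
    unfolding next_gain_def by auto
  have "adv.W ((rs0 @ \<rho>) @ \<rho>') (star (\<not> b)) \<le> adv.W (rs0 @ \<rho>) (star b) + h * m"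
    using adv_fill[OF good_sub[OF \<rho>(2)] \<rho>'(1) star_conf[of b]] md_switch[of b] by linarith
  then show ?case using \<rho> \<rho>' T_R[of "\<not> b"]
    by (intro exI[of _ "\<rho> @ \<rho>'"] exI[of _ "\<not> b"]) (auto simp: algebra_simps)
qed

text \<open>For the last alternations of a phase, in which the algorithm is no longer controlled.
  They only drive the work function on towards the cone at \<open>R\<close>.\<close>

lemma further_fills:
  assumes "bnd t b rs" "set rs \<subseteq> P" "t + n \<le> 2 * \<mu> - 1"
  shows "\<exists>\<rho> b'. set \<rho> \<subseteq> R \<and> bnd (t + n) b' (rs @ \<rho>) \<and>
    adv.W (rs @ \<rho>) (star b') \<le> adv.W rs (star b) + n * (h * m)"
  using assms(3)
proof (induction n)
  case 0
  then show ?case using assms by (intro exI[of _ "[]"] exI[of _ b]) auto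
next
  case (Suc n)
  then obtain \<rho> c where \<rho>: "set \<rho> \<subseteq> R" "bnd (t + n) c (rs @ \<rho>)"
    "adv.W (rs @ \<rho>) (star c) \<le> adv.W rs (star b) + n * (h * m)" by auto
  have sub: "set (rs @ \<rho>) \<subseteq> P" using \<rho>(1) side_sub assms(2) by fastforce
  obtain qs where qs: "set qs = T (\<not> c)" using finite_distinct_list[OF finite_S] by blast
  obtain \<rho>' where \<rho>': "set \<rho>' \<subseteq> T (\<not> c)" "sat (T (\<not> c)) ((rs @ \<rho>) @ \<rho>')"
    using saturate_and_cover[OF sub, of \<delta> qs] isolated_side[OF T_R, of "\<not> c"] card_S qs by auto
  have "bnd (Suc (t + n)) (\<not> c) ((rs @ \<rho>) @ \<rho>')"
    by (rule bnd_step[OF \<rho>(2) sub \<rho>']) (use Suc.prems in simp)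
  moreover have "adv.W ((rs @ \<rho>) @ \<rho>') (star (\<not> c)) \<le> adv.W (rs @ \<rho>) (star c) + h * m"
    using adv_fill[OF sub \<rho>'(1) star_conf[of c]] md_switch[of c] by linarith
  ultimately show ?case using \<rho> \<rho>'(1) T_R[of "\<not> c"]
    by (intro exI[of _ "\<rho> @ \<rho>'"] exI[of _ "\<not> c"]) (auto simp: algebra_simps)
qed

lemma md_full_side_le:
  assumes "Z \<in> conf"
  shows "md (mset_set R) Z \<le> (2 * real h - real (cnt R Z)) * D + 2 * (h * m)"
proof -
  have sZ: "size Z = 2 * h" using assms by (simp add: configs_def)
  have c: "cnt R Z \<le> size (mset_set R)" using cnt_le_size[of R Z] sZ card_side by simp
  then obtain C1 where C1: "C1 \<subseteq># mset_set R" "size C1 = cnt R Z" using submultiset_ex by blast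
  then obtain C2 where C2: "mset_set R = C1 + C2" by (metis subset_mset.le_iff_add)
  have sC2: "size C2 = 2 * h - cnt R Z" using arg_cong[OF C2, of size] C1(2) card_side by simp
  have inR: "set_mset C1 \<subseteq> R" "set_mset C2 \<subseteq> R"
    using C2 finite_side by (metis Un_upper1 Un_upper2 finite_set_mset_mset_set set_mset_union)+
  have "md (C1 + C2) (inR Z + outR Z) \<le> md C1 (inR Z) + md C2 (outR Z)"
    by (rule matching_dist_union) (use C1 sC2 sZ in \<open>auto simp: size_filter_cnt\<close>)
  moreover have "md C1 (inR Z) \<le> size C1 * m"
  proof (rule matching_dist_le_const)
    show "d x y \<le> m" if "x \<in># C1" "y \<in># inR Z" for x y
      using that inR(1) by (intro d_in_side[of _ "\<not> a"]) auto
  qed (use C1 in \<open>auto simp: size_filter_cnt\<close>)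
  moreover have "md C2 (outR Z) \<le> size C2 * D"
  proof (rule matching_dist_le_const)
    show "d x y \<le> D" if "x \<in># C2" "y \<in># outR Z" for x y
      using that inR(2) side_sub configs_memD[OF assms] by (intro d_le_D) auto
  qed (use sC2 sZ in \<open>auto simp: size_filter_cnt\<close>)
  moreover have "size C1 * m \<le> 2 * (h * m)"
    using C1(2) c card_side m_pos by simp
  moreover have "real (size C2) = 2 * real h - real (cnt R Z)" using sC2 c card_side by simp
  ultimately show ?thesis using C2 in_out_R[of Z] by simp
qed

text \<open>One alternation short of \<open>2 * \<mu>\<close> the slope in \<open>cnt R Z\<close> is
  \<open>m - D\<close>. The missing alternation and the distances within \<open>R\<close> contribute
  \<open>2 * h * m\<close> each to the defect.\<close>

lemma near_cone:
  assumes "bnd (2 * \<mu> - 1) b rs" "Z \<in> conf" "rs = rs0 @ \<rho>" "set \<rho> \<subseteq> R"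
  shows "W rs (mset_set R) + md (mset_set R) Z - 4 * (h * m) \<le> W rs Z"
proof -
  have CR: "mset_set R \<in> conf" using side_sub card_side finite_side by (auto simp: configs_def)
  have "W rs (mset_set R) = W rs0 (mset_set R)"
    unfolding assms(3) by (rule W_cover[OF sub_R[OF assms(4)] CR]) (use assms(4) finite_side in auto)
  then have "W rs (mset_set R) \<le> w0 + 2 * h * D"
    using W_rs0[OF CR] md_le[OF C_conf CR] by simp
  moreover have "m * real (2 * \<mu> - 1) = 2 * D - m"
    using \<mu>_ge by (simp add: D_def of_nat_diff algebra_simps)
  then have "w0 + 2 * h * (2 * D - m) + (D - (2 * D - m)) * cnt R Z \<le> W rs Z"
    using bnd_lower(1)[OF assms(1,2)] by simp
  moreover have "0 \<le> m * cnt R Z" using m_pos by simp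
  ultimately show ?thesis using md_full_side_le[OF assms(2)] by (simp add: algebra_simps)
qed

lemma full_phase:
  assumes B: "B \<in> adv.conf"
  shows "\<exists>\<rho>. set \<rho> \<subseteq> R \<and> sat R (rs0 @ \<rho>) \<and> alg (rs0 @ \<rho>) = mset_set R \<and>
    cost rs0 + gain \<le> cost (rs0 @ \<rho>) \<and>
    (\<exists>B'\<in>adv.conf. adv.W (rs0 @ \<rho>) B' \<le> adv.W rs0 B + loss)"
proof -
  obtain \<rho>1 b where \<rho>1: "set \<rho>1 \<subseteq> R" "good (2 * \<mu> - 3 * h) b (rs0 @ \<rho>1)"
    "cost rs0 + \<delta> * real (\<Sum>j=1..<h. first_len j) + (D - \<delta>) * real h
      + real (2 * \<mu> - 3 * h) * next_gain \<le> cost (rs0 @ \<rho>1)"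
    "adv.W (rs0 @ \<rho>1) (star b) \<le> adv.W rs0 B + h * D + real (2 * \<mu> - 3 * h) * (h * m)"
    using good_fills[OF B order_refl] by blast
  let ?rs1 = "rs0 @ \<rho>1"
  have sub1: "set ?rs1 \<subseteq> P" by (rule sub_R[OF \<rho>1(1)])
  let ?n = "2 * \<mu> - 1 - (2 * \<mu> - 3 * h)"
  have n: "2 * \<mu> - 3 * h + ?n = 2 * \<mu> - 1" using h_pos by simp
  obtain \<rho>2 b2 where \<rho>2: "set \<rho>2 \<subseteq> R" "bnd (2 * \<mu> - 1) b2 (?rs1 @ \<rho>2)"
    "adv.W (?rs1 @ \<rho>2) (star b2) \<le> adv.W ?rs1 (star b) + ?n * (h * m)"
    using further_fills[of "2 * \<mu> - 3 * h" b ?rs1 ?n] \<rho>1(2) sub1 n unfolding good_def by auto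
  let ?rs2 = "?rs1 @ \<rho>2"
  have eq2: "?rs2 = rs0 @ (\<rho>1 @ \<rho>2)" and R2: "set (\<rho>1 @ \<rho>2) \<subseteq> R" using \<rho>1 \<rho>2 by auto
  have sub2: "set ?rs2 \<subseteq> P" using sub_R[OF R2] by simp
  obtain qs where qs: "set qs = R" "distinct qs" using finite_distinct_list[OF finite_side] by blast
  have lqs: "length qs = 2 * h" using qs card_side distinct_card by metis
  let ?\<rho>3 = "rounds sharpen_len qs"
  have R3: "set ?\<rho>3 \<subseteq> R" using set_rounds[of sharpen_len qs] qs by simp
  let ?rs3 = "?rs2 @ ?\<rho>3"
  have sat3: "sat R ?rs3"
  proof -
    have "sat (set qs) ?rs3"
    proof (rule sharpen_rounds[OF sub2])
      show "isolated \<delta> (set qs)" using isolated_side[of R "\<not> a"] qs by simp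
      show "card (set qs) = 2 * h" using qs card_side by simp
      show "W ?rs2 (mset_set (set qs)) + md (mset_set (set qs)) Z - 4 * (h * m) \<le> W ?rs2 Z"
        if "Z \<in> conf" for Z
        using near_cone[OF \<rho>2(2) that eq2 R2] qs(1) by simp
      show "4 * (h * m) + real (2 * h) * \<delta> \<le> real sharpen_len * \<delta>"
        by (simp add: sharpen_len_def m_def algebra_simps)
    qed
    then show ?thesis using qs by simp
  qed
  have RP: "R \<subseteq> P" by (rule side_sub)
  have sub3: "set ?rs3 \<subseteq> P" using sub2 subset_trans[OF R3 RP] by simp
  obtain \<rho>4 where \<rho>4: "set \<rho>4 \<subseteq> R" "length \<rho>4 \<le> 2 * h" "R \<subseteq> set_mset (alg (?rs3 @ \<rho>4))"
    using descent[OF sat3 sub3 isolated_side[OF order_refl] finite_side] card_side by auto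
  let ?rs4 = "?rs3 @ \<rho>4"
  have sub4: "set ?rs4 \<subseteq> P" using sub3 subset_trans[OF \<rho>4(1) RP] by simp
  have sat4: "sat R ?rs4" by (rule sat_append[OF sat3 sub4 \<rho>4(1)])
  have alg4: "alg ?rs4 = mset_set R"
    by (rule full_config[OF finite_side card_side alg_conf[OF sub4] \<rho>4(3)])
  \<comment> \<open>Whatever the algorithm does in between, going from \<open>h\<close> to
    \<open>2 * h\<close> servers in \<open>R\<close> costs it \<open>h * D\<close>.\<close>
  have "D * (real (cnt R (alg ?rs4)) - real (cnt R (alg ?rs1))) \<le> md (alg ?rs1) (alg ?rs4)"
    by (rule md_side_cnt[OF alg_conf[OF sub1] alg_conf[OF sub4]])
  moreover have "cnt R (alg ?rs4) = 2 * h"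
    unfolding alg4 using cnt_subset[of "mset_set R" R] finite_side card_side by simp
  moreover have "cnt R (alg ?rs1) = h" using \<rho>1(2) by (simp add: good_def)
  moreover have "cost ?rs1 + md (alg ?rs1) (alg (?rs1 @ (\<rho>2 @ ?\<rho>3 @ \<rho>4))) \<le> cost (?rs1 @ (\<rho>2 @ ?\<rho>3 @ \<rho>4))"
    by (rule cost_append) (use sub4 in auto)
  ultimately have cost4: "cost ?rs1 + real h * D \<le> cost ?rs4" by (simp add: algebra_simps)
  have "star b2 \<in> adv.conf" "set_mset (star b2) \<subseteq> R" using star_conf T_R[of b2] finite_S by auto
  from adv_walk[OF sub2 this, of "?\<rho>3 @ \<rho>4"] R3 \<rho>4(1)
  obtain B' where B': "B' \<in> adv.conf"
    "adv.W ?rs4 B' \<le> adv.W ?rs2 (star b2) + real (length (?\<rho>3 @ \<rho>4)) * m" by auto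
  have "real (length (?\<rho>3 @ \<rho>4)) * m \<le> real (sharpen_len * (2 * h) + 2 * h) * m"
    using m_pos \<rho>4(2) lqs by (intro mult_right_mono) (auto simp: length_rounds)
  moreover have "real (2 * \<mu> - 3 * h) * (h * m) + ?n * (h * m) = real (2 * \<mu> - 1) * (h * m)"
    unfolding distrib_right[symmetric] of_nat_add[symmetric] n ..
  ultimately have "adv.W ?rs4 B' \<le> adv.W rs0 B + loss"
    using B'(2) \<rho>2(3) \<rho>1(4) unfolding loss_def by linarith
  moreover have "cost rs0 + gain \<le> cost ?rs4" using cost4 \<rho>1(3) unfolding gain_def by linarith
  moreover have R4: "set (\<rho>1 @ \<rho>2 @ ?\<rho>3 @ \<rho>4) \<subseteq> R" using \<rho>1 \<rho>2 R3 \<rho>4 by auto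
  ultimately show ?thesis using sat4 alg4 B'(1)
    by (intro exI[of _ "\<rho>1 @ \<rho>2 @ ?\<rho>3 @ \<rho>4"] conjI bexI[of _ B']) simp_all
qed

end

section \<open>Repetition of phases\<close>

locale game = two_sided_space P d D S h \<kappa> \<mu> m \<delta> + wfa P d D "2 * h" alg + adv: work_function P d D h B0
  for P :: "'p set" and d D S h \<kappa> \<mu> m \<delta> alg B0
begin

lemma many_phases:
  "\<exists>v. \<forall>n. \<exists>rs. set rs \<subseteq> P \<and> real n * gain \<le> cost rs \<and> opt_cost P d B0 rs \<le> v + real n * loss"
proof -
  \<comment> \<open>The initial configurations are arbitrary. Saturating on one side produces the
    state that \<open>phase\<close> assumes, and its effect on the optimum goes into the constant
    \<open>v\<close>.\<close>
  obtain qs where qs: "set qs = side True" using finite_distinct_list[OF finite_side] by blast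
  obtain rs1 where rs1: "set rs1 \<subseteq> side True" "sat (side True) rs1" "side True \<subseteq> set_mset (alg rs1)"
    using saturate_and_cover[of "[]" \<delta> qs] isolated_side[of "side True" True] card_side qs by auto
  have sub1: "set rs1 \<subseteq> P" using rs1(1) side_sub by blast
  have alg1: "alg rs1 = mset_set (side True)"
    by (rule full_config[OF finite_side card_side alg_conf[OF sub1] rs1(3)])
  have "\<exists>rs a B. set rs \<subseteq> P \<and> sat (side a) rs \<and> alg rs = mset_set (side a) \<and> real n * gain \<le> cost rs \<and>
      B \<in> adv.conf \<and> adv.W rs B \<le> adv.W rs1 B0 + real n * loss" for n
  proof (induction n)
    case 0
    have "0 \<le> cost rs1"
      unfolding alg_cost_def
    proof (rule sum_nonneg)
      fix i
      have "set (take j rs1) \<subseteq> P" for j using sub1 set_take_subset[of j rs1] by blast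
      then show "0 \<le> md (alg (take i rs1)) (alg (take (Suc i) rs1))" using md_nonneg alg_conf by blast
    qed
    then show ?case using sub1 rs1 alg1 adv.A0 by (intro exI[of _ rs1] exI[of _ True] exI[of _ B0]) auto
  next
    case (Suc n)
    then obtain rs a B where *: "set rs \<subseteq> P" "sat (side a) rs" "alg rs = mset_set (side a)"
      "real n * gain \<le> cost rs" "B \<in> adv.conf" "adv.W rs B \<le> adv.W rs1 B0 + real n * loss" by blast
    interpret ph: phase_adv P d D S h \<kappa> \<mu> m \<delta> alg a rs B0
      by unfold_locales (use * in auto)
    obtain \<rho> B' where "set \<rho> \<subseteq> side (\<not> a)" "sat (side (\<not> a)) (rs @ \<rho>)" "alg (rs @ \<rho>) = mset_set (side (\<not> a))"
      "cost rs + gain \<le> cost (rs @ \<rho>)" "B' \<in> adv.conf" "adv.W (rs @ \<rho>) B' \<le> adv.W rs B + loss"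
      using ph.full_phase[OF *(5)] by blast
    then show ?case using * side_sub[of "\<not> a"]
      by (intro exI[of _ "rs @ \<rho>"] exI[of _ "\<not> a"] exI[of _ B']) (auto simp: distrib_right)
  qed
  then have "\<exists>rs. set rs \<subseteq> P \<and> real n * gain \<le> cost rs \<and> opt_cost P d B0 rs \<le> adv.W rs1 B0 + real n * loss" for n
    using adv.opt_cost_le by (meson order_trans)
  then show ?thesis by blast
qed

lemma gain_le_loss:
  assumes comp: "competitive P d alg B0 c" and "0 < gain"
  shows "gain \<le> c * loss"
proof (rule ccontr)
  assume no: "\<not> ?thesis"
  obtain \<alpha> where \<alpha>: "\<And>rs. set rs \<subseteq> P \<Longrightarrow> cost rs \<le> c * opt_cost P d B0 rs + \<alpha>"
    using comp unfolding competitive_def by blast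
  obtain v where v: "\<And>n. \<exists>rs. set rs \<subseteq> P \<and> real n * gain \<le> cost rs \<and> opt_cost P d B0 rs \<le> v + real n * loss"
    using many_phases by blast
  show False
  proof (cases "0 \<le> c")
    case True
    obtain n where n: "c * v + \<alpha> < real n * (gain - c * loss)"
      using ex_less_of_nat_mult[of "gain - c * loss"] no by auto
    obtain rs where rs: "set rs \<subseteq> P" "real n * gain \<le> cost rs" "opt_cost P d B0 rs \<le> v + real n * loss"
      using v by blast
    have "c * opt_cost P d B0 rs \<le> c * (v + real n * loss)" by (rule mult_left_mono[OF rs(3) True])
    then show False using \<alpha>[OF rs(1)] rs(2) n by (simp add: algebra_simps)
  next
    \<comment> \<open>\<open>competitive\<close> does not exclude a negative \<open>c\<close>. As
      the optimum is nonnegative, the costs would then be bounded by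
      \<open>\<alpha>\<close>.\<close>
    case False
    obtain n where n: "\<alpha> < real n * gain" using ex_less_of_nat_mult assms(2) by blast
    obtain rs where rs: "set rs \<subseteq> P" "real n * gain \<le> cost rs" using v by blast
    have "c * opt_cost P d B0 rs \<le> 0"
      using False adv.opt_cost_nonneg[OF rs(1)] by (intro mult_nonpos_nonneg) auto
    then show False using \<alpha>[OF rs(1)] rs(2) n by linarith
  qed
qed

end

subsection \<open>The tree\<close>

context two_sided_space
begin

lemma sum_first_len:
  "\<delta> * real (\<Sum>j=1..<h. first_len j) = real (\<Sum>j=1..<h. j) * (2 * D - (2 * real h + 4) * m)"
proof -
  have 1: "(\<Sum>j=1..<h. first_len j) = (\<Sum>j=1..<h. j) * (\<kappa> * (2 * \<mu> - (2 * h + 4)))"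
    by (simp add: first_len_def sum_distrib_right)
  have 2: "real (\<kappa> * (2 * \<mu> - (2 * h + 4))) = real \<kappa> * (2 * real \<mu> - (2 * real h + 4))"
    using \<mu>_ge by (simp add: of_nat_diff)
  have 3: "\<delta> * (real \<kappa> * (2 * real \<mu> - (2 * real h + 4))) = 2 * D - (2 * real h + 4) * m"
    by (simp add: D_def m_def algebra_simps)
  show ?thesis unfolding 1 of_nat_mult[of "\<Sum>j=1..<h. j"] 2 mult.left_commute[of \<delta> "real (\<Sum>j=1..<h. j)"] 3 ..
qed

lemma sum_next_len:
  "\<delta> * real (\<Sum>j=1..<h. next_len j) = real (\<Sum>j=1..<h. j) * (2 * m - (real h + 4) * \<delta>)"
proof -
  have 1: "(\<Sum>j=1..<h. next_len j) = (\<Sum>j=1..<h. j) * (2 * \<kappa> - (h + 4))"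
    by (simp add: next_len_def sum_distrib_right)
  have 2: "real (2 * \<kappa> - (h + 4)) = 2 * real \<kappa> - (real h + 4)"
    using \<kappa>_ge by (simp add: of_nat_diff)
  have 3: "\<delta> * (2 * real \<kappa> - (real h + 4)) = 2 * m - (real h + 4) * \<delta>"
    by (simp add: m_def algebra_simps)
  show ?thesis unfolding 1 of_nat_mult[of "\<Sum>j=1..<h. j"] 2 mult.left_commute[of \<delta> "real (\<Sum>j=1..<h. j)"] 3 ..
qed

lemma gain_pos: "0 < gain"
proof -
  have "0 \<le> next_gain" unfolding next_gain_def
    by (intro add_nonneg_nonneg mult_nonneg_nonneg of_nat_0_le_iff) (use \<delta>_pos \<delta>_le_m in auto)
  then show ?thesis unfolding gain_def
    by (intro add_nonneg_pos add_nonneg_nonneg mult_nonneg_nonneg mult_pos_pos of_nat_0_le_iff)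
      (use \<delta>_pos \<delta>_le_m m_le_D D_pos h_pos in auto)
qed

end

text \<open>
  The tree has infinitely many pairs of isomorphic subtrees, the depth-one vertices \<open>[2 * n]\<close>
  and \<open>[2 * n + 1]\<close> forming the pair number \<open>n\<close>; the parameter \<open>K\<close> of a pair tends to infinity.
  \<open>rootdist N v\<close> is the distance of \<open>v\<close> to the root, so that all leaves are at distance \<open>1\<close>.
\<close>

fun rootdist :: "nat \<Rightarrow> nat list \<Rightarrow> real" where
  "rootdist N [] = 0"
| "rootdist N [i] = 1 - 1 / real (N + i div 2) ^ 2"
| "rootdist N [i, j] = 1 - 1 / real (N + i div 2) ^ 3"
| "rootdist N (i # j # l # xs) = 1"

definition pair_tree :: "nat \<Rightarrow> nat \<Rightarrow> nat list wtree" where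
  "pair_tree N h = \<lparr>
     verts = {[]} \<union> {[i] | i. True} \<union> {[i, j] | i j. j < 2} \<union> {[i, j, l] | i j l. j < 2 \<and> l < h},
     root_of = [], parent = butlast, elen = (\<lambda>v. rootdist N v - rootdist N (butlast v))\<rparr>"

lemma pair_tree_simps [simp]:
  "root_of (pair_tree N h) = []" "parent (pair_tree N h) = butlast"
  "elen (pair_tree N h) v = rootdist N v - rootdist N (butlast v)"
  by (simp_all add: pair_tree_def)

lemma verts_cases:
  assumes "v \<in> verts (pair_tree N h)"
  obtains "v = []" | i where "v = [i]" | i j where "v = [i, j]" "j < 2"
    | i j l where "v = [i, j, l]" "j < 2" "l < h"
  using assms by (auto simp: pair_tree_def)

lemma verts_intros [simp]:
  "[] \<in> verts (pair_tree N h)" "[i] \<in> verts (pair_tree N h)"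
  "[i, j] \<in> verts (pair_tree N h) \<longleftrightarrow> j < 2" "[i, j, l] \<in> verts (pair_tree N h) \<longleftrightarrow> j < 2 \<and> l < h"
  by (auto simp: pair_tree_def)

lemma butlast_verts: "v \<in> verts (pair_tree N h) \<Longrightarrow> butlast v \<in> verts (pair_tree N h)"
  by (erule verts_cases) auto

lemma nonroot_iff: "v \<in> nonroot (pair_tree N h) \<longleftrightarrow> v \<in> verts (pair_tree N h) \<and> v \<noteq> []"
  by (simp add: nonroot_def)

lemma elen_pos:
  assumes "v \<in> nonroot (pair_tree N h)" "2 \<le> N"
  shows "rootdist N (butlast v) < rootdist N v"
proof -
  have K: "(1::real) < real (N + i div 2)" for i using assms(2) by linarith
  have K2: "1 < real (N + i div 2) ^ 2" "1 < real (N + i div 2) ^ 3"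
    "real (N + i div 2) ^ 2 < real (N + i div 2) ^ 3" for i
    using K[of i] by (simp_all add: one_less_power power_strict_increasing)
  have v: "v \<in> verts (pair_tree N h)" "v \<noteq> []" using assms(1) by (simp_all add: nonroot_iff)
  from v(1) show ?thesis
  proof (cases rule: verts_cases)
    case (2 i)
    have "1 / real (N + i div 2) ^ 2 < 1"
      by (subst divide_less_eq_1_pos) (use K2(1)[of i] in linarith)+
    then show ?thesis using 2 by simp
  next
    case (3 i j)
    have "1 / real (N + i div 2) ^ 3 < 1 / real (N + i div 2) ^ 2"
      using K2[of i] K[of i] by (intro divide_strict_left_mono mult_pos_pos zero_less_power) linarith+
    then show ?thesis using 3 by simp
  next
    case (4 i j l)
    have "0 < 1 / real (N + i div 2) ^ 3" using K[of i] by (intro divide_pos_pos zero_less_power) linarith+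
    then show ?thesis using 4 by simp
  qed (use v in simp)
qed

lemma pair_tree_depth: "depth (pair_tree N h) v = length v"
proof -
  have "(LEAST n. (butlast ^^ n) v = []) = length v"
    by (rule Least_equality) (auto simp: butlast_power)
  then show ?thesis by (simp add: depth_def)
qed

lemma leaves_pair_tree:
  assumes "1 \<le> h"
  shows "leaves (pair_tree N h) = {[i, j, l] | i j l. j < 2 \<and> l < h}"
proof (intro set_eqI iffI)
  fix v assume v: "v \<in> leaves (pair_tree N h)"
  then have nc: "u \<in> verts (pair_tree N h) \<Longrightarrow> u \<noteq> [] \<Longrightarrow> butlast u \<noteq> v" for u
    by (auto simp: leaves_def nonroot_iff)
  have "v \<in> verts (pair_tree N h)" using v by (simp add: leaves_def)
  then show "v \<in> {[i, j, l] | i j l. j < 2 \<and> l < h}"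
  proof (cases rule: verts_cases)
    case 1 then show ?thesis using nc[of "[0]"] by simp
  next
    case (2 i) then show ?thesis using nc[of "[i, 0]"] by simp
  next
    case (3 i j) then show ?thesis using nc[of "[i, j, 0]"] assms by simp
  qed auto
next
  fix v assume "v \<in> {[i, j, l] | i j l. j < 2 \<and> l < h}"
  then show "v \<in> leaves (pair_tree N h)"
    by (auto simp: leaves_def nonroot_iff elim!: verts_cases)
qed

lemma rooted_pair_tree:
  assumes "2 \<le> N" shows "rooted_tree (pair_tree N h)"
proof -
  have "\<exists>n. (butlast ^^ n) v = []" for v :: "nat list"
    by (rule exI[of _ "length v"]) (simp add: butlast_power)
  then show ?thesis
    using elen_pos[OF _ assms] butlast_verts by (auto simp: rooted_tree_def nonroot_iff)
qed

text \<open>With \<open>K = N + i div 2\<close> the edges on a path have lengths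
  \<open>1 - 1 / K ^ 2\<close>, \<open>1 / K ^ 2 - 1 / K ^ 3\<close> and \<open>1 / K ^ 3\<close>.
  The ratios are \<open>K * (K + 1)\<close> and \<open>K - 1\<close>; the latter is the origin of
  \<open>\<sigma> + 1 \<le> real N\<close>.\<close>

lemma pair_tree_hst:
  assumes "1 \<le> h" "1 < \<sigma>" "2 \<le> N" "\<sigma> + 1 \<le> real N"
  shows "depth_hst \<sigma> 3 (pair_tree N h)"
proof -
  have "\<sigma> * (rootdist N v - rootdist N (butlast v))
      \<le> rootdist N (butlast v) - rootdist N (butlast (butlast v))"
    if v: "v \<in> verts (pair_tree N h)" "butlast v \<noteq> []" for v
    using v(1)
  proof (cases rule: verts_cases)
    case (3 i j)
    define K where "K = real (N + i div 2)"
    have K: "\<sigma> + 1 \<le> K" "0 < K" using assms by (auto simp: K_def)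
    have "\<sigma> * (K - 1) \<le> (K - 1) * (K * (K + 1))"
    proof -
      have "\<sigma> \<le> K * (K + 1)" using K assms(2) mult_mono[of 1 K \<sigma> "K + 1"] by auto
      then show ?thesis using K assms(2) mult_left_mono[of \<sigma> "K * (K + 1)" "K - 1"] by (simp add: mult.commute)
    qed
    then have "\<sigma> * (K - 1) / K ^ 3 \<le> (K - 1) * (K * (K + 1)) / K ^ 3"
      using K(2) by (intro divide_right_mono) auto
    moreover have "\<sigma> * (K - 1) / K ^ 3 = \<sigma> * (1 / K ^ 2 - 1 / K ^ 3)"
      using K(2) by (simp add: field_simps power2_eq_square power3_eq_cube)
    moreover have "(K - 1) * (K * (K + 1)) / K ^ 3 = 1 - 1 / K ^ 2"
      using K(2) by (simp add: field_simps power2_eq_square power3_eq_cube)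
    ultimately have "\<sigma> * (1 / K ^ 2 - 1 / K ^ 3) \<le> 1 - 1 / K ^ 2" by simp
    then show ?thesis using 3 by (simp add: K_def)
  next
    case (4 i j l)
    define K where "K = real (N + i div 2)"
    have K: "\<sigma> + 1 \<le> K" "0 < K" using assms by (auto simp: K_def)
    then have "\<sigma> * (1 / K ^ 3) \<le> 1 / K ^ 2 - 1 / K ^ 3"
      by (simp add: field_simps power2_eq_square power3_eq_cube)
    then show ?thesis using 4 by (simp add: K_def)
  qed (use v in auto)
  moreover have "length v \<le> 3" if "v \<in> verts (pair_tree N h)" for v
    using that by (rule verts_cases) auto
  ultimately show ?thesis
    using rooted_pair_tree[OF assms(3)] leaves_pair_tree[OF assms(1), of N]
    by (auto simp: depth_hst_def depth_tree_def pair_tree_depth nonroot_iff)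
qed

section \<open>Distances between leaves\<close>

definition lcp_dist :: "nat \<Rightarrow> nat list \<Rightarrow> nat list \<Rightarrow> real" where
  "lcp_dist N u v = rootdist N u + rootdist N v - 2 * rootdist N (longest_common_prefix u v)"

lemma lcp_self: "longest_common_prefix u u = u"
  by (induction u) auto

lemma lcp_butlast:
  assumes "u \<noteq> []"
  shows "longest_common_prefix u v = u \<and> longest_common_prefix (butlast u) v = butlast u
    \<or> longest_common_prefix (butlast u) v = longest_common_prefix u v"
  using assms
proof (induction u v rule: longest_common_prefix.induct)
  case (1 x xs y ys)
  then show ?case by (cases "xs = []") auto
qed auto

lemma lcp_dist_butlast:
  assumes "u \<in> nonroot (pair_tree N h)" "2 \<le> N"
  shows "lcp_dist N u v \<le> elen (pair_tree N h) u + lcp_dist N (butlast u) v"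
    "lcp_dist N (butlast u) v \<le> elen (pair_tree N h) u + lcp_dist N u v"
proof -
  have "u \<noteq> []" using assms(1) by (simp add: nonroot_iff)
  from lcp_butlast[OF this, of v] elen_pos[OF assms]
  show "lcp_dist N u v \<le> elen (pair_tree N h) u + lcp_dist N (butlast u) v"
    "lcp_dist N (butlast u) v \<le> elen (pair_tree N h) u + lcp_dist N u v"
    by (auto simp: lcp_dist_def)
qed

text \<open>\<open>tree_dist\<close> is an infimum over all walks. Along an edge
  \<open>lcp_dist\<close> changes by at most the edge length, which bounds every walk from below;
  the walk through the longest common prefix attains the bound.\<close>

lemma walk_ge_lcp_dist:
  assumes "walk (pair_tree N h) u v l" "2 \<le> N"
  shows "lcp_dist N u v \<le> l"
  using assms(1)
proof induction
  case (stay u)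
  then show ?case by (simp add: lcp_dist_def lcp_self)
next
  case (up u v l)
  then show ?case using lcp_dist_butlast(1)[OF up(1) assms(2), of v] by simp
next
  case (down u v l)
  then show ?case using lcp_dist_butlast(2)[OF down(1) assms(2), of v] by simp
qed

lemma walk_trans: "walk T u v l \<Longrightarrow> walk T v w l' \<Longrightarrow> walk T u w (l + l')"
  by (induction rule: walk.induct) (auto intro: walk.intros simp: add.assoc)

lemma walk_prefix:
  assumes "prefix p u" "u \<in> verts (pair_tree N h)"
  shows "walk (pair_tree N h) u p (rootdist N u - rootdist N p)"
    "walk (pair_tree N h) p u (rootdist N u - rootdist N p)"
  using assms
proof (induction u rule: rev_induct)
  case Nil
  {
    case 1 then show ?case by (auto intro: walk.intros)
  next
    case 2 then show ?case by (auto intro: walk.intros)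
  }
next
  case (snoc x u)
  let ?T = "pair_tree N h"
  have self: "walk ?T v v 0" if "v \<in> verts ?T" for v using that by (rule walk.intros)
  {
    case 1
    then have u: "u \<in> verts ?T" "u @ [x] \<in> nonroot ?T" using butlast_verts[of "u @ [x]" N h] by (auto simp: nonroot_iff)
    show ?case
    proof (cases "p = u @ [x]")
      case True then show ?thesis using self[OF 1(2)] by simp
    next
      case False
      then have "walk ?T u p (rootdist N u - rootdist N p)" using snoc(1) 1 u by auto
      then have "walk ?T (parent ?T (u @ [x])) p (rootdist N u - rootdist N p)" by simp
      from walk.up[OF u(2) this] show ?thesis by simp
    qed
  next
    case 2
    then have u: "u \<in> verts ?T" "u @ [x] \<in> nonroot ?T" using butlast_verts[of "u @ [x]" N h] by (auto simp: nonroot_iff)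
    show ?case
    proof (cases "p = u @ [x]")
      case True then show ?thesis using self[OF 2(2)] by simp
    next
      case False
      then have "walk ?T p u (rootdist N u - rootdist N p)" using snoc(2) 2 u by auto
      moreover have "walk ?T u (u @ [x]) (rootdist N (u @ [x]) - rootdist N u)"
        using walk.down[OF u(2) self[OF 2(2)]] by simp
      ultimately show ?thesis using walk_trans by fastforce
    qed
  }
qed

lemma tree_dist_pair_tree:
  assumes "u \<in> verts (pair_tree N h)" "v \<in> verts (pair_tree N h)" "2 \<le> N"
  shows "tree_dist (pair_tree N h) u v = lcp_dist N u v"
  unfolding tree_dist_def
proof (rule cInf_eq_minimum)
  let ?p = "longest_common_prefix u v"
  have "walk (pair_tree N h) u v ((rootdist N u - rootdist N ?p) + (rootdist N v - rootdist N ?p))"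
    by (rule walk_trans[OF walk_prefix(1) walk_prefix(2)])
      (use assms in \<open>auto intro: longest_common_prefix_prefix1 longest_common_prefix_prefix2\<close>)
  then show "lcp_dist N u v \<in> {l. walk (pair_tree N h) u v l}"
    by (simp add: lcp_dist_def algebra_simps)
qed (use walk_ge_lcp_dist assms(3) in blast)

lemma leaf_dist:
  assumes "[i, j, l] \<in> verts (pair_tree N h)" "[i', j', l'] \<in> verts (pair_tree N h)" "2 \<le> N"
  shows "tree_dist (pair_tree N h) [i, j, l] [i', j', l'] =
    (if i \<noteq> i' then 2 else if j \<noteq> j' then 2 / real (N + i div 2) ^ 2
     else if l \<noteq> l' then 2 / real (N + i div 2) ^ 3 else 0)"
  using tree_dist_pair_tree[OF assms] by (auto simp: lcp_dist_def)

lemma pair_tree_ultrametric: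
  assumes "1 \<le> h" "2 \<le> N"
  shows "bounded_ultrametric (leaves (pair_tree N h)) (tree_dist (pair_tree N h)) 2"
proof -
  have K: "0 \<le> 2 / real (N + i div 2) ^ 3" "2 / real (N + i div 2) ^ 3 \<le> 2 / real (N + i div 2) ^ 2"
    "2 / real (N + i div 2) ^ 2 \<le> 2" for i
  proof -
    have aux: "2 / K ^ 3 \<le> 2 / K ^ 2" "2 / K ^ 2 \<le> 2" if "1 \<le> K" for K :: real
    proof -
      have "1 \<le> K ^ 2" "K ^ 2 \<le> K ^ 3" using that by (auto intro: power_increasing)
      then show "2 / K ^ 3 \<le> 2 / K ^ 2" using that by (intro divide_left_mono) auto
      show "2 / K ^ 2 \<le> 2" using \<open>1 \<le> K ^ 2\<close> by (subst pos_divide_le_eq) auto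
    qed
    have "1 \<le> real (N + i div 2)" using assms(2) by linarith
    from aux[OF this] show "2 / real (N + i div 2) ^ 3 \<le> 2 / real (N + i div 2) ^ 2"
      "2 / real (N + i div 2) ^ 2 \<le> 2" .
  qed simp
  have K': "2 / real (N + i div 2) ^ 3 \<le> 2" "0 \<le> 2 / real (N + i div 2) ^ 2" for i
    using K(2,3)[of i] by (linarith, simp)
  show ?thesis
    by unfold_locales
      (use K K' in \<open>auto simp: leaves_pair_tree[OF assms(1)] leaf_dist[OF _ _ assms(2)] max_def\<close>)
qed

definition pair_star :: "nat \<Rightarrow> nat \<Rightarrow> bool \<Rightarrow> bool \<Rightarrow> nat list set" where
  "pair_star h n a b = (\<lambda>l. [2 * n + of_bool a, of_bool b, l]) ` {..<h}"

text \<open>For \<open>K = N + n\<close> the ratios are \<open>m / \<delta> = K\<close> and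
  \<open>D / m = K ^ 2\<close>, so the sharpening costs the adversary only a fraction of
  \<open>D\<close> of order \<open>1 / K\<close>.\<close>

lemma pair_star_space:
  assumes "1 \<le> h" "h + 5 \<le> N"
  shows "two_sided_space (leaves (pair_tree N h)) (tree_dist (pair_tree N h)) 2 (pair_star h n)
    h (N + n) ((N + n) ^ 2) (2 / real (N + n) ^ 2) (2 / real (N + n) ^ 3)"
proof -
  have N: "2 \<le> N" using assms by simp
  interpret bounded_ultrametric "leaves (pair_tree N h)" "tree_dist (pair_tree N h)" 2
    by (rule pair_tree_ultrametric[OF assms(1) N])
  have half: "(2 * n + of_bool a) div 2 = n" for a by (cases a) auto
  have pos: "0 < real (N + n)" using N by simp
  have scale: "2 / K ^ 2 = K * (2 / K ^ 3)" "2 = K ^ 2 * (2 / K ^ 2)" if "0 < K" for K :: real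
    using that by (simp_all add: power2_eq_square power3_eq_cube)
  show ?thesis
  proof unfold_locales
    show "card (pair_star h n a b) = h" for a b
      unfolding pair_star_def by (subst card_image) (auto simp: inj_on_def)
    have "4 * h + 4 \<le> (h + 5) ^ 2" by (simp add: power2_eq_square algebra_simps)
    also have "\<dots> \<le> (N + n) ^ 2" using assms by (intro power_mono) auto
    finally show "4 * h + 4 \<le> (N + n) ^ 2" .
    show "2 / real (N + n) ^ 2 = real (N + n) * (2 / real (N + n) ^ 3)"
      by (rule scale(1)[OF pos])
    show "(2::real) = real ((N + n) ^ 2) * (2 / real (N + n) ^ 2)"
      unfolding of_nat_power by (rule scale(2)[OF pos])
    show "tree_dist (pair_tree N h) x y = 2 / real (N + n) ^ 3"
      if "x \<in> pair_star h n a b" "y \<in> pair_star h n a b" "x \<noteq> y" for x y a b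
      using that by (auto simp: pair_star_def leaf_dist[OF _ _ N] half split: if_splits)
    show "tree_dist (pair_tree N h) x y = 2 / real (N + n) ^ 2"
      if "x \<in> pair_star h n a b" "y \<in> pair_star h n a (\<not> b)" for x y a b
      using that by (auto simp: pair_star_def leaf_dist[OF _ _ N] half split: if_splits)
    show "tree_dist (pair_tree N h) x y = 2"
      if xy: "x \<in> pair_star h n a b" "y \<in> leaves (pair_tree N h)" "y \<notin> pair_star h n a True"
        "y \<notin> pair_star h n a False" for x y a b
    proof -
      obtain l where x: "x = [2 * n + of_bool a, of_bool b, l]" "l < h" using xy(1) by (auto simp: pair_star_def)
      obtain i j l' where y: "y = [i, j, l']" "j < 2" "l' < h"
        using xy(2) by (auto simp: leaves_pair_tree[OF assms(1)])
      have "j = 0 \<or> j = 1" using y(2) by auto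
      then have "i \<noteq> 2 * n + of_bool a" using xy(3,4) y by (auto simp: pair_star_def)
      then show ?thesis using x y by (simp add: leaf_dist[OF _ _ N])
    qed
  qed (use assms pos in \<open>auto simp: pair_star_def leaves_pair_tree[OF assms(1)]\<close>)
qed

theorem theorem2:
  fixes h k :: nat and \<sigma> :: real
  assumes "1 \<le> h" and "k = 2 * h" and "1 < \<sigma>"
  shows "\<exists>T :: nat list wtree. depth_hst \<sigma> 3 T \<and>
           (\<forall>alg B0. is_wfa (leaves T) (tree_dist T) k alg \<longrightarrow> B0 \<in> configs (leaves T) h \<longrightarrow>
              ereal (real h + 1 / 3) \<le> competitive_ratio (leaves T) (tree_dist T) alg B0)"
proof -
  define N where "N = nat \<lceil>\<sigma>\<rceil> + h + 5"
  have N: "h + 5 \<le> N" "2 \<le> N" "\<sigma> + 1 \<le> real N" unfolding N_def by linarith+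
  let ?T = "pair_tree N h"
  have lower: "real h + 1 / 3 \<le> c"
    if wfa: "is_wfa (leaves ?T) (tree_dist ?T) k alg" and B0: "B0 \<in> configs (leaves ?T) h"
      and comp: "competitive (leaves ?T) (tree_dist ?T) alg B0 c" for alg B0 c
  proof -
    define u where "u n = 1 / real (N + n)" for n
    define Q where "Q = real (\<Sum>j=1..<h. j)"
    \<comment> \<open>\<open>G\<close> and \<open>F\<close> are the gain and the loss for the pair
      \<open>n\<close> as polynomials in \<open>x = 1 / (N + n)\<close>, where
      \<open>m = 2 * x ^ 2\<close> and \<open>\<delta> = 2 * x ^ 3\<close>. At \<open>x = 0\<close>
      they are \<open>12 * Q + 8 * h\<close> and \<open>6 * h\<close>, with
      \<open>Q = h * (h - 1) / 2\<close>.\<close>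
    define G where "G x = Q * (4 - (2 * real h + 4) * (2 * x ^ 2)) + (2 - 2 * x ^ 3) * real h
      + (Q * (2 * (4 - 6 * real h * x ^ 2) - (real h + 4) * (4 * x - 6 * real h * x ^ 3))
         + ((4 - 6 * real h * x ^ 2) - (4 * x - 6 * real h * x ^ 3)) * real h) + 2 * real h" for x :: real
    define F where "F x = 2 * real h + real h * (4 - 2 * x ^ 2) + 16 * real h ^ 2 * x
      + (8 * real h ^ 2 + 4 * real h) * x ^ 2" for x :: real
    have GF: "G (u n) \<le> c * F (u n)" for n
    proof -
      interpret sp: two_sided_space "leaves ?T" "tree_dist ?T" 2 "pair_star h n" h "N + n" "(N + n) ^ 2"
        "2 / real (N + n) ^ 2" "2 / real (N + n) ^ 3"
        by (rule pair_star_space[OF assms(1) N(1)])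
      interpret game "leaves ?T" "tree_dist ?T" 2 "pair_star h n" h "N + n" "(N + n) ^ 2"
        "2 / real (N + n) ^ 2" "2 / real (N + n) ^ 3" alg B0
        by unfold_locales (use assms wfa B0 in auto)
      define K where "K = real (N + n)"
      have pos: "0 < K" using N by (simp add: K_def)
      have \<mu>: "real (2 * (N + n) ^ 2 - 3 * h) = 2 * K ^ 2 - 3 * real h"
        "real (2 * (N + n) ^ 2 - 1) = 2 * K ^ 2 - 1"
        using sp.\<mu>_ge by (simp_all add: of_nat_diff K_def)
      have len: "real (sp.sharpen_len * (2 * h) + 2 * h) = 8 * real h ^ 2 * K + 4 * real h ^ 2 + 2 * real h"
        by (simp add: sp.sharpen_len_def K_def algebra_simps power2_eq_square)
      define y where "y = 1 / K"
      have y: "2 / real (N + n) ^ 2 = 2 * y ^ 2" "2 / real (N + n) ^ 3 = 2 * y ^ 3" "u n = y"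
        by (simp_all add: y_def K_def u_def power_divide)
      have Ky: "K * y = 1" using pos by (simp add: y_def)
      have "sp.gain = G y"
        unfolding sp.gain_def sp.next_gain_def sp.sum_first_len sp.sum_next_len \<mu> Q_def[symmetric] G_def
        unfolding y using Ky by algebra
      moreover have "sp.loss = F y"
        unfolding sp.loss_def len \<mu> F_def unfolding y using Ky by algebra
      ultimately show ?thesis using gain_le_loss[OF comp sp.gain_pos] y(3) by simp
    qed
    have u0: "u \<longlonglongrightarrow> 0"
      unfolding u_def using LIMSEQ_ignore_initial_segment[OF lim_1_over_n, of N] by (simp add: add.commute)
    have "(\<lambda>n. G (u n)) \<longlonglongrightarrow> G 0"
      unfolding G_def by (intro tendsto_intros u0)
    moreover have "(\<lambda>n. c * F (u n)) \<longlonglongrightarrow> c * F 0"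
      unfolding F_def by (intro tendsto_intros u0)
    ultimately have "G 0 \<le> c * F 0"
      using GF by (intro LIMSEQ_le) auto
    then have "12 * Q + 8 * real h \<le> c * (6 * real h)" by (simp add: G_def F_def)
    moreover have "2 * Q = real h * (real h - 1)"
    proof -
      have "2 * (\<Sum>j=1..<h. j) = h * (h - 1)"
        using assms(1) by (induction h rule: dec_induct) (auto simp: algebra_simps)
      then have "real (2 * (\<Sum>j=1..<h. j)) = real (h * (h - 1))" by simp
      then show ?thesis using assms(1) by (simp add: Q_def of_nat_diff)
    qed
    ultimately have "real h * (real h + 1 / 3) \<le> real h * c" by (simp add: algebra_simps)
    then show ?thesis using assms(1) by simp
  qed
  have "depth_hst \<sigma> 3 ?T" by (rule pair_tree_hst[OF assms(1,3) N(2,3)])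
  moreover have "ereal (real h + 1 / 3) \<le> competitive_ratio (leaves ?T) (tree_dist ?T) alg B0"
    if "is_wfa (leaves ?T) (tree_dist ?T) k alg" "B0 \<in> configs (leaves ?T) h" for alg B0
    unfolding competitive_ratio_def by (rule Inf_greatest) (use lower[OF that] in auto)
  ultimately show ?thesis by blast
qed

end
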